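(* Let $N\ge1$. With the notation of the context, $\mathfrak T_N$ gives a transversal of the set of varieties of rank-$N$ charge-conserving braid representations up to the action of the symmetric group $\Sigma_N$ and X-equivalence. That is: (i) for every $\lambda\in\mathfrak S_N$ there is exactly one $\tau\in\mathfrak T_N$ such that $[\mathcal V(\lambda)]=w\cdot[\mathcal V(\tau)]$ for some $w\in\Sigma_N$; and (ii) the operators $\mathsf R(g)$, with $g$ a germ whose underlying element of $\mathfrak S_N$ lies in $\mathfrak T_N$, form a complete set of rank-$N$ charge-conserving braid representations up to $\Sigma_N$ and X-equivalence, i.e. all of them are such representations and every rank-$N$ charge-conserving braid representation is X-equivalent to $w\cdot\mathsf R(g)$ for some $w\in\Sigma_N$ and some such germ $g$.
   Context: Let $V=\mathbb C^N$ with standard basis $e_1,\dots,e_N$ and write $|ij\rangle=e_i\otimes e_j$. A linear operator $R$ on $V\otimes V$ is charge-conserving if there are scalars with $R|ii\rangle=a_i|ii\rangle$ for all $i$, and for all $i<j$: $R|ij\rangle=a_{ij}|ij\rangle+b_{ij}|ji\rangle$, $R|ji\rangle=c_{ij}|ij\rangle+d_{ij}|ji\rangle$. Write $A(i,j)=\begin{pmatrix}a_{ij}&b_{ij}\\c_{ij}&d_{ij}\end{pmatrix}$ for $i<j$. A rank-$N$ charge-conserving braid representation is an invertible charge-conserving $R$ with $(R\otimes 1_V)(1_V\otimes R)(R\otimes 1_V)=(1_V\otimes R)(R\otimes 1_V)(1_V\otimes R)$. X-equivalence: $R,R'$ are X-equivalent if $R'=XRX^{-1}$ for some invertible $X$ on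 $V\otimes V$ diagonal in the basis $(|ij\rangle)$. The group $\Sigma_N$ acts by $w\cdot R=(P_w\otimes P_w)R(P_w\otimes P_w)^{-1}$, where $P_we_i=e_{w(i)}$; this action preserves X-equivalence, so $\Sigma_N$ acts on X-equivalence classes and on sets of them. $\mathfrak S_N$ is the set of quadruples $(p,q,\rho,s)$ where: $p$ is a set partition of $\{1,\dots,N\}$ (parts: nations); $q$ is a refinement of $p$ (parts: counties); $\rho$ is a choice, for each nation, of a total order on the counties in it; $s$ is a choice, for each nation, of a set partition of the set of its counties into at most two parts. A germ over $\lambda=(p,q,\rho,s)$ is a choice of: nonzero $\alpha_n\in\mathbb C$ for each nation $n$; nonzero $\beta_n\in\mathbb C$ with $\alpha_n+\beta_n\neq0$ for each nation $n$ with more than one county; nonzero $\mu_{n,n'}=\mu_{n',n}\in\mathbb C$ for each pair of distinct nations. The recipe $\mathsf R$ sends a germ to the charge-conserving operator given by: (i) if $i<j$ are in different nations $n,n'$, $A(i,j)=\begin{pmatrix}0&\mu_{n,n'}\\ \mu_{n,n'}&0\end{pmatrix}$; (ii) for $i$ in nation $n$, $a_i=\alpha_n$ if the county of $i$ is in the same part of $s$ as the $\rho$-first county of $n$, else $a_i=\beta_n$; (iii) if $i<j$ are in the same county, $A(i,j)=a_i\begin{pmatrix}1&0\\0&1\end{pmatrix}$; (iv) if $i<j$ are in the same nation $n$ but different counties, $A(i,j)=\begin{pmatrix}\alpha_n+\beta_n&1\\-\alpha_n\beta_n&0\end{pmatrix}$ if the county of $i$ precedes that of $j$ in $\rho$,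 and $A(i,j)=\begin{pmatrix}0&1\\-\alpha_n\beta_n&\alpha_n+\beta_n\end{pmatrix}$ otherwise. For $\lambda\in\mathfrak S_N$, the variety $\mathcal V(\lambda)$ is the set of all $\mathsf R(g)$ with $g$ a germ over $\lambda$, and $[\mathcal V(\lambda)]$ is the set of X-equivalence classes of its elements. A 2-coloured composition of $n\geq1$ is a composition of $n$, drawn as a stack of rows of boxes (row lengths the parts, top to bottom), in which each row is unshaded or shaded, the top row being unshaded. A word $w_1\cdots w_{n-1}\in\{1,2,3\}^{n-1}$ encodes the 2-coloured composition obtained from a single unshaded box by successively, for $k=1,\dots,n-1$: adding a box to the last row if $w_k=1$; adding a new unshaded row with one box at the bottom if $w_k=2$; adding a new shaded row with one box at the bottom if $w_k=3$. This is a bijection from words of length $n-1$ to 2-coloured compositions of $n$. Order words (hence 2-coloured compositions) totally: longer words come first, and words of equal length are in dictionary order. Given a finite multiset of 2-coloured compositions with $N$ boxes in total, list its diagrams (with multiplicity) in this order and fill the boxes with $1,2,\dots,N$ consecutively, diagram by diagram, within each diagram row by row from the top, and within each row left to right. This determines an element $(p,q,\rho,s)$ of $\mathfrak S_N$: nations are the sets of entries of the diagrams, counties the sets of entries of the rows, $\rho$ is the top-to-bottom order of rows, and $s$ separates unshaded from shaded rows in each diagram. $\mathfrak T_N\subset\mathfrak S_N$ is the set of all elements so obtained from multisets with $N$ boxes in total. *)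

theory Defs
  imports
    "HOL-Library.Disjoint_Sets"
    "HOL-Library.FuncSet"
    "HOL-Library.Multiset"
    "HOL-Combinatorics.Permutations"
    "Jordan_Normal_Form.Gauss_Jordan_Elimination"
begin

section \<open>Operators on tensor powers of a complex coordinate space\<close>

text \<open>
  Linear operators on $V = \mathbb C^N$, $V \otimes V$ and $V \otimes V \otimes V$ are represented by
  their matrices with respect to the standard (lexicographically ordered) product basis; column
  \<open>k\<close> of a matrix is the image of the \<open>k\<close>-th basis vector. Basis vectors of \<open>V\<close> are labelled
  by \<open>1, \<dots>, N\<close>, whereas the library indexes matrices and vectors from \<open>0\<close>.
\<close>

definition tensor_mat :: "complex mat \<Rightarrow> complex mat \<Rightarrow> complex mat" where
  "tensor_mat A B = mat (dim_row A * dim_row B) (dim_col A * dim_col B)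
     (\<lambda>(r, c). A $$ (r div dim_row B, c div dim_col B) * B $$ (r mod dim_row B, c mod dim_col B))"

definition tensor_vec :: "complex vec \<Rightarrow> complex vec \<Rightarrow> complex vec" where
  "tensor_vec v w = vec (dim_vec v * dim_vec w) (\<lambda>k. v $ (k div dim_vec w) * w $ (k mod dim_vec w))"

definition basis_vec :: "nat \<Rightarrow> nat \<Rightarrow> complex vec" where
  "basis_vec N i = unit_vec N (i - 1)"

definition ket :: "nat \<Rightarrow> nat \<Rightarrow> nat \<Rightarrow> complex vec" where
  "ket N i j = tensor_vec (basis_vec N i) (basis_vec N j)"

definition conj_mat :: "complex mat \<Rightarrow> complex mat \<Rightarrow> complex mat" where
  "conj_mat Q R = Q * R * the (mat_inverse Q)"

section \<open>Charge-conserving braid representations\<close>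

text \<open>
  The scalars of a charge-conserving operator are a function \<open>a\<close> and a function \<open>A\<close> giving, for
  \<open>i < j\<close>, the \<open>2 \<times> 2\<close> matrix $A(i,j)$ row by row as a tuple $(a_{ij}, b_{ij}, c_{ij}, d_{ij})$.
\<close>

type_synonym mat2 = "complex \<times> complex \<times> complex \<times> complex"

definition cc_image :: "nat \<Rightarrow> (nat \<Rightarrow> complex) \<Rightarrow> (nat \<Rightarrow> nat \<Rightarrow> mat2) \<Rightarrow> nat \<Rightarrow> nat \<Rightarrow> complex vec" where
  "cc_image N a A i j =
     (if i = j then a i \<cdot>\<^sub>v ket N i i
      else if i < j then (case A i j of (x, y, z, u) \<Rightarrow> x \<cdot>\<^sub>v ket N i j + y \<cdot>\<^sub>v ket N j i)
      else (case A j i of (x, y, z, u) \<Rightarrow> z \<cdot>\<^sub>v ket N j i + u \<cdot>\<^sub>v ket N i j))"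

definition charge_conserving :: "nat \<Rightarrow> complex mat \<Rightarrow> bool" where
  "charge_conserving N R \<longleftrightarrow> R \<in> carrier_mat (N * N) (N * N) \<and>
     (\<exists>a A. \<forall>i\<in>{1..N}. \<forall>j\<in>{1..N}. R *\<^sub>v ket N i j = cc_image N a A i j)"

text \<open>The charge-conserving operator with prescribed scalars, given column by column.\<close>

definition cc_op :: "nat \<Rightarrow> (nat \<Rightarrow> complex) \<Rightarrow> (nat \<Rightarrow> nat \<Rightarrow> mat2) \<Rightarrow> complex mat" where
  "cc_op N a A = mat (N * N) (N * N) (\<lambda>(r, c). cc_image N a A (c div N + 1) (c mod N + 1) $ r)"

definition braid_rep :: "nat \<Rightarrow> complex mat \<Rightarrow> bool" where
  "braid_rep N R \<longleftrightarrow> charge_conserving N R \<and> invertible_mat R \<and>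
     tensor_mat R (1\<^sub>m N) * tensor_mat (1\<^sub>m N) R * tensor_mat R (1\<^sub>m N) =
     tensor_mat (1\<^sub>m N) R * tensor_mat R (1\<^sub>m N) * tensor_mat (1\<^sub>m N) R"

definition X_equiv :: "nat \<Rightarrow> complex mat \<Rightarrow> complex mat \<Rightarrow> bool" where
  "X_equiv N R R' \<longleftrightarrow> R \<in> carrier_mat (N * N) (N * N) \<and>
     (\<exists>X\<in>carrier_mat (N * N) (N * N). diagonal_mat X \<and> invertible_mat X \<and> R' = conj_mat X R)"

definition X_rel :: "nat \<Rightarrow> complex mat rel" where
  "X_rel N = {(R, R'). X_equiv N R R'}"

definition perm_mat :: "nat \<Rightarrow> (nat \<Rightarrow> nat) \<Rightarrow> complex mat" where
  "perm_mat N w = mat N N (\<lambda>(r, c). if r + 1 = w (c + 1) then 1 else 0)"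

definition perm_act :: "nat \<Rightarrow> (nat \<Rightarrow> nat) \<Rightarrow> complex mat \<Rightarrow> complex mat" where
  "perm_act N w R = conj_mat (tensor_mat (perm_mat N w) (perm_mat N w)) R"

text \<open>The induced action on sets of X-equivalence classes.\<close>

definition perm_act_classes :: "nat \<Rightarrow> (nat \<Rightarrow> nat) \<Rightarrow> complex mat set set \<Rightarrow> complex mat set set" where
  "perm_act_classes N w \<C> = (\<lambda>C. perm_act N w ` C) ` \<C>"

section \<open>Nations, counties, germs and the recipe\<close>

text \<open>
  A quadruple $(p,q,\rho,s)$; the functions $\rho$ and $s$ on nations are \<open>undefined\<close> off \<open>p\<close>, so
  that equality of quadruples is the intended one.
\<close>

type_synonym quad =
  "nat set set \<times> nat set set \<times> (nat set \<Rightarrow> nat set rel) \<times> (nat set \<Rightarrow> nat set set set)"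

definition counties :: "nat set set \<Rightarrow> nat set \<Rightarrow> nat set set" where
  "counties q n = {c \<in> q. c \<subseteq> n}"

definition SS :: "nat \<Rightarrow> quad set" where
  "SS N = {(p, q, \<rho>, s). partition_on {1..N} p \<and> refines {1..N} q p \<and>
     \<rho> \<in> (\<Pi>\<^sub>E n\<in>p. {r. linear_order_on (counties q n) r}) \<and>
     s \<in> (\<Pi>\<^sub>E n\<in>p. {t. partition_on (counties q n) t \<and> card t \<le> 2})}"

text \<open>A germ \<open>(\<alpha>, \<beta>, \<mu>)\<close>; values at arguments not mentioned in \<open>is_germ\<close> are not used by \<open>recipe\<close>.\<close>

type_synonym germ =
  "(nat set \<Rightarrow> complex) \<times> (nat set \<Rightarrow> complex) \<times> (nat set \<Rightarrow> nat set \<Rightarrow> complex)"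

definition is_germ :: "quad \<Rightarrow> germ \<Rightarrow> bool" where
  "is_germ = (\<lambda>(p, q, \<rho>, s) (\<alpha>, \<beta>, \<mu>).
     (\<forall>n\<in>p. \<alpha> n \<noteq> 0) \<and>
     (\<forall>n\<in>p. card (counties q n) > 1 \<longrightarrow> \<beta> n \<noteq> 0 \<and> \<alpha> n + \<beta> n \<noteq> 0) \<and>
     (\<forall>n\<in>p. \<forall>n'\<in>p. n \<noteq> n' \<longrightarrow> \<mu> n n' = \<mu> n' n \<and> \<mu> n n' \<noteq> 0))"

definition block :: "'a set set \<Rightarrow> 'a \<Rightarrow> 'a set" where
  "block P x = (THE X. X \<in> P \<and> x \<in> X)"

definition first_elem :: "'a set \<Rightarrow> 'a rel \<Rightarrow> 'a" where
  "first_elem C r = (THE c. c \<in> C \<and> (\<forall>d\<in>C. (c, d) \<in> r))"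

definition recipe_a :: "quad \<Rightarrow> germ \<Rightarrow> nat \<Rightarrow> complex" where
  "recipe_a = (\<lambda>(p, q, \<rho>, s) (\<alpha>, \<beta>, \<mu>) i.
     (let n = block p i in
      if \<exists>t\<in>s n. block q i \<in> t \<and> first_elem (counties q n) (\<rho> n) \<in> t then \<alpha> n else \<beta> n))"

definition recipe_A :: "quad \<Rightarrow> germ \<Rightarrow> nat \<Rightarrow> nat \<Rightarrow> mat2" where
  "recipe_A = (\<lambda>(p, q, \<rho>, s) (\<alpha>, \<beta>, \<mu>) i j.
     (let n = block p i; n' = block p j; c = block q i; c' = block q j;
          a = recipe_a (p, q, \<rho>, s) (\<alpha>, \<beta>, \<mu>) i in
      if n \<noteq> n' then (0, \<mu> n n',
                      \<mu> n n', 0)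
      else if c = c' then (a, 0,
                           0, a)
      else if (c, c') \<in> \<rho> n then (\<alpha> n + \<beta> n, 1,
                                  - \<alpha> n * \<beta> n, 0)
      else (0, 1,
            - \<alpha> n * \<beta> n, \<alpha> n + \<beta> n)))"

definition recipe :: "nat \<Rightarrow> quad \<Rightarrow> germ \<Rightarrow> complex mat" where
  "recipe N l g = cc_op N (recipe_a l g) (recipe_A l g)"

definition variety :: "nat \<Rightarrow> quad \<Rightarrow> complex mat set" where
  "variety N l = {recipe N l g | g. is_germ l g}"

definition variety_classes :: "nat \<Rightarrow> quad \<Rightarrow> complex mat set set" where
  "variety_classes N l = variety N l // X_rel N"

section \<open>Two-coloured compositions\<close>

datatype shade = Unshaded | Shaded

text \<open>A diagram is the list of its rows from top to bottom, each with its length and shade.\<close>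

type_synonym diagram = "(nat \<times> shade) list"

definition boxes :: "diagram \<Rightarrow> nat" where
  "boxes D = (\<Sum>(r, x)\<leftarrow>D. r)"

definition two_coloured_composition :: "diagram \<Rightarrow> bool" where
  "two_coloured_composition D \<longleftrightarrow> D \<noteq> [] \<and> (\<forall>(r, x)\<in>set D. r \<ge> 1) \<and> snd (hd D) = Unshaded"

definition words :: "nat list set" where
  "words = lists {1, 2, 3}"

definition add_letter :: "nat \<Rightarrow> diagram \<Rightarrow> diagram" where
  "add_letter k D =
     (if k = 1 then butlast D @ [(fst (last D) + 1, snd (last D))]
      else if k = 2 then D @ [(1, Unshaded)]
      else D @ [(1, Shaded)])"

definition diagram_of_word :: "nat list \<Rightarrow> diagram" where
  "diagram_of_word w = fold add_letter w [(1, Unshaded)]"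

definition word_of_diagram :: "diagram \<Rightarrow> nat list" where
  "word_of_diagram D = (THE w. w \<in> words \<and> diagram_of_word w = D)"

definition word_before :: "nat list \<Rightarrow> nat list \<Rightarrow> bool" where
  "word_before u v \<longleftrightarrow> length u > length v \<or> (length u = length v \<and> (u, v) \<in> lex less_than)"

definition diagram_le :: "diagram \<Rightarrow> diagram \<Rightarrow> bool" where
  "diagram_le D E \<longleftrightarrow> D = E \<or> word_before (word_of_diagram D) (word_of_diagram E)"

text \<open>
  A filled diagram is the list of the sets of entries of its rows, with their shades. The first
  argument of the following functions is the number of boxes filled so far.
\<close>

type_synonym filled = "(nat set \<times> shade) list"

fun fill_rows :: "nat \<Rightarrow> diagram \<Rightarrow> filled" where
  "fill_rows k [] = []"
| "fill_rows k ((r, x) # D) = ({k + 1..k + r}, x) # fill_rows (k + r) D"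

fun fill_diagrams :: "nat \<Rightarrow> diagram list \<Rightarrow> filled list" where
  "fill_diagrams k [] = []"
| "fill_diagrams k (D # Ds) = fill_rows k D # fill_diagrams (k + boxes D) Ds"

definition row_sets :: "filled \<Rightarrow> nat set set" where
  "row_sets F = fst ` set F"

definition row_order :: "filled \<Rightarrow> nat set rel" where
  "row_order F = {(fst (F ! i), fst (F ! j)) | i j. i \<le> j \<and> j < length F}"

definition shade_parts :: "filled \<Rightarrow> nat set set set" where
  "shade_parts F = {{c. (c, Unshaded) \<in> set F}, {c. (c, Shaded) \<in> set F}} - {{}}"

definition quad_of_filled :: "filled list \<Rightarrow> quad" where
  "quad_of_filled Fs =
     (let p = (\<lambda>F. \<Union>(row_sets F)) ` set Fs;
          diag = (\<lambda>n. THE F. F \<in> set Fs \<and> \<Union>(row_sets F) = n)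
      in (p, \<Union>F\<in>set Fs. row_sets F, \<lambda>n\<in>p. row_order (diag n), \<lambda>n\<in>p. shade_parts (diag n)))"

definition TT :: "nat \<Rightarrow> quad set" where
  "TT N = {quad_of_filled (fill_diagrams 0 Ds) | M Ds.
     (\<forall>D\<in>#M. two_coloured_composition D) \<and> (\<Sum>D\<in>#M. boxes D) = N \<and>
     mset Ds = M \<and> sorted_wrt diagram_le Ds}"

section \<open>Consistency of the definitions\<close>

text \<open>
  \<open>cc_op_ket\<close>: \<open>cc_op\<close> is the operator with the prescribed action on the product basis.
  \<open>bij_words\<close>: words of length \<open>n - 1\<close> correspond bijectively to two-coloured compositions of
  \<open>n\<close>, so the definite description in \<open>word_of_diagram\<close> is meaningful. \<open>TT_SS\<close>: \<open>TT N\<close> is a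
  subset of \<open>SS N\<close>.
\<close>

lemma ket_eq:
  assumes "i \<in> {1..N}" "j \<in> {1..N}"
  shows "ket N i j = unit_vec (N * N) ((i - 1) * N + (j - 1))"
proof -
  have j: "j - 1 < N" using assms by auto
  show ?thesis
  proof (rule eq_vecI)
    fix k assume "k < dim_vec (unit_vec (N * N) ((i - 1) * N + (j - 1)) :: complex vec)"
    hence k: "k < N * N" by simp
    hence N: "N > 0" by (cases N) auto
    have kk: "k div N < N" "k mod N < N" using k N by (auto simp: less_mult_imp_div_less)
    have eq: "k = (i - 1) * N + (j - 1) \<longleftrightarrow> k div N = i - 1 \<and> k mod N = j - 1"
    proof
      assume "k = (i - 1) * N + (j - 1)"
      thus "k div N = i - 1 \<and> k mod N = j - 1" using j by simp
    next
      assume "k div N = i - 1 \<and> k mod N = j - 1"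
      thus "k = (i - 1) * N + (j - 1)" using div_mult_mod_eq[of k N] by simp
    qed
    show "ket N i j $ k = unit_vec (N * N) ((i - 1) * N + (j - 1)) $ k"
      using k kk eq by (simp add: ket_def tensor_vec_def basis_vec_def unit_vec_def)
  qed (simp add: ket_def tensor_vec_def basis_vec_def)
qed

lemma cc_op_ket:
  assumes "i \<in> {1..N}" "j \<in> {1..N}"
  shows "cc_op N a A *\<^sub>v ket N i j = cc_image N a A i j"
proof -
  have d: "dim_vec (ket N i j) = N * N" for i j by (simp add: ket_def tensor_vec_def basis_vec_def)
  have dim: "dim_vec (cc_image N a A i j) = N * N"
    by (auto simp: cc_image_def d split: prod.splits)
  have j: "j - 1 < N" using assms by auto
  have "(i - 1) * N + (j - 1) < (i - 1) * N + N" using j by simp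
  also have "\<dots> = i * N" using assms by (cases i) auto
  also have "\<dots> \<le> N * N" using assms by simp
  finally have lt: "(i - 1) * N + (j - 1) < N * N" .
  show ?thesis
  proof (rule eq_vecI)
    fix k assume "k < dim_vec (cc_image N a A i j)"
    hence k: "k < N * N" using dim by simp
    define m where "m = (i - 1) * N + (j - 1)"
    have m: "m < N * N" "m div N = i - 1" "m mod N = j - 1" using lt j by (auto simp: m_def)
    have r: "row (cc_op N a A) k \<in> carrier_vec (N * N)" using k by (simp add: cc_op_def)
    have "(cc_op N a A *\<^sub>v ket N i j) $ k = row (cc_op N a A) k \<bullet> unit_vec (N * N) m"
      using k unfolding ket_eq[OF assms] m_def by (simp add: cc_op_def)
    also have "\<dots> = row (cc_op N a A) k $ m" using r m(1) by simp
    also have "\<dots> = cc_image N a A i j $ k" using k m assms by (simp add: cc_op_def)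
    finally show "(cc_op N a A *\<^sub>v ket N i j) $ k = cc_image N a A i j $ k" .
  qed (simp add: cc_op_def dim)
qed


lemma dow_snoc: "diagram_of_word (w @ [k]) = add_letter k (diagram_of_word w)"
  by (simp add: diagram_of_word_def)

lemma boxes_append: "boxes (D @ E) = boxes D + boxes E" by (simp add: boxes_def)

lemma tcc_add: assumes "two_coloured_composition D"
  shows "two_coloured_composition (add_letter k D)" "boxes (add_letter k D) = Suc (boxes D)"
proof -
  have D: "D \<noteq> []" using assms by (auto simp: two_coloured_composition_def)
  then obtain E r x where E: "D = E @ [(r, x)]" by (metis rev_exhaust surj_pair)
  show "two_coloured_composition (add_letter k D)" "boxes (add_letter k D) = Suc (boxes D)"
    using assms unfolding E by (auto simp: two_coloured_composition_def add_letter_def boxes_def hd_append split: if_splits)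
qed

lemma dow_tcc: "two_coloured_composition (diagram_of_word w) \<and> boxes (diagram_of_word w) = length w + 1"
proof (induction w rule: rev_induct)
  case Nil show ?case by (simp add: diagram_of_word_def two_coloured_composition_def boxes_def)
next
  case (snoc k w) thus ?case using tcc_add by (simp add: dow_snoc)
qed

lemma add_letter_inj:
  assumes "two_coloured_composition D" "two_coloured_composition E" "k \<in> {1,2,3}" "l \<in> {1,2,3}"
    "add_letter k D = add_letter l E"
  shows "k = l \<and> D = E"
proof -
  obtain D' r x where D: "D = D' @ [(r, x)]" using assms(1) unfolding two_coloured_composition_def by (metis rev_exhaust surj_pair)
  obtain E' r' x' where E: "E = E' @ [(r', x')]" using assms(2) unfolding two_coloured_composition_def by (metis rev_exhaust surj_pair)
  show ?thesis using assms unfolding D E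
    by (auto simp: add_letter_def two_coloured_composition_def split: if_splits)
qed

lemma dow_inj: "w \<in> words \<Longrightarrow> v \<in> words \<Longrightarrow> diagram_of_word w = diagram_of_word v \<Longrightarrow> w = v"
proof (induction w arbitrary: v rule: rev_induct)
  case Nil
  have "length v = length ([]::nat list)" using dow_tcc[of v] dow_tcc[of "[]"] Nil by simp
  thus ?case by simp
next
  case (snoc k w)
  have "length v = Suc (length w)" using dow_tcc[of v] dow_tcc[of "w @ [k]"] snoc by simp
  then obtain u l where v: "v = u @ [l]" by (metis length_Suc_conv_rev)
  have "k = l \<and> diagram_of_word w = diagram_of_word u"
    using snoc(2-4) dow_tcc unfolding v words_def by (intro add_letter_inj) (simp_all add: dow_snoc)
  thus ?case using snoc(1)[of u] snoc(2,3) unfolding v words_def by simp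
qed

lemma dow_surj: "two_coloured_composition D \<Longrightarrow> boxes D = Suc n \<Longrightarrow> \<exists>w\<in>words. length w = n \<and> diagram_of_word w = D"
proof (induction n arbitrary: D)
  case 0
  obtain E r x where D: "D = (r, x) # E" using 0(1) unfolding two_coloured_composition_def by (metis neq_Nil_conv surj_pair)
  have "E = [] \<and> r = 1 \<and> x = Unshaded" using 0 unfolding D
    by (cases E) (auto simp: two_coloured_composition_def boxes_def)
  thus ?case unfolding D by (intro bexI[of _ "[]"]) (auto simp: diagram_of_word_def words_def)
next
  case (Suc n)
  obtain E r x where D: "D = E @ [(r, x)]" using Suc(2) unfolding two_coloured_composition_def by (metis rev_exhaust surj_pair)
  have "\<exists>F k. k \<in> {1,2,3} \<and> two_coloured_composition F \<and> boxes F = Suc n \<and> add_letter k F = D"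
  proof (cases "r = 1")
    case True
    have "E \<noteq> []" using Suc(3) True unfolding D by (auto simp: boxes_def)
    hence "two_coloured_composition E \<and> boxes E = Suc n \<and> add_letter (if x = Unshaded then 2 else 3) E = D"
      using Suc(2,3) True unfolding D by (cases x) (auto simp: two_coloured_composition_def boxes_def add_letter_def)
    thus ?thesis by (intro exI[of _ E] exI[of _ "if x = Unshaded then 2 else 3"]) auto
  next
    case False
    have "two_coloured_composition (E @ [(r - 1, x)]) \<and> boxes (E @ [(r - 1, x)]) = Suc n \<and> add_letter 1 (E @ [(r - 1, x)]) = D"
      using Suc(2,3) False unfolding D by (auto simp: two_coloured_composition_def boxes_def add_letter_def hd_append split: if_splits)
    thus ?thesis by blast
  qed
  then obtain F k where F: "k \<in> {1,2,3}" "two_coloured_composition F" "boxes F = Suc n" "add_letter k F = D" by blast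
  obtain w where "w \<in> words" "length w = n" "diagram_of_word w = F" using Suc(1)[OF F(2,3)] by blast
  thus ?case using F by (intro bexI[of _ "w @ [k]"]) (auto simp: dow_snoc words_def)
qed

lemma bij_words: "bij_betw diagram_of_word {w \<in> words. length w + 1 = n} {D. two_coloured_composition D \<and> boxes D = n}"
proof (rule bij_betw_imageI)
  show "inj_on diagram_of_word {w \<in> words. length w + 1 = n}" by (rule inj_onI) (blast intro: dow_inj)
  show "diagram_of_word ` {w \<in> words. length w + 1 = n} = {D. two_coloured_composition D \<and> boxes D = n}"
  proof (intro equalityI subsetI)
    fix D assume "D \<in> diagram_of_word ` {w \<in> words. length w + 1 = n}"
    thus "D \<in> {D. two_coloured_composition D \<and> boxes D = n}" using dow_tcc by auto
  next
    fix D assume D: "D \<in> {D. two_coloured_composition D \<and> boxes D = n}"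
    hence "D \<noteq> []" by (simp add: two_coloured_composition_def)
    then obtain E r x where E: "D = (r, x) # E" by (metis neq_Nil_conv surj_pair)
    have "boxes D \<ge> 1" using D unfolding E by (auto simp: two_coloured_composition_def boxes_def)
    then obtain m where m: "n = Suc m" using D by (cases n) auto
    obtain w where "w \<in> words" "length w = m" "diagram_of_word w = D" using dow_surj[of D m] D m by auto
    thus "D \<in> diagram_of_word ` {w \<in> words. length w + 1 = n}" using m by force
  qed
qed

lemma fill_rows_Union: "\<Union>(row_sets (fill_rows k D)) = {k+1..k + boxes D}"
  by (induction k D rule: fill_rows.induct) (auto simp: row_sets_def boxes_def)

lemma fill_rows_props:
  assumes "\<forall>(r,x)\<in>set D. r \<ge> 1"
  shows "distinct (map fst (fill_rows k D)) \<and> disjoint (row_sets (fill_rows k D)) \<and> {} \<notin> row_sets (fill_rows k D)"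
  using assms
proof (induction k D rule: fill_rows.induct)
  case (2 k r x D)
  have IH: "distinct (map fst (fill_rows (k+r) D)) \<and> disjoint (row_sets (fill_rows (k+r) D)) \<and> {} \<notin> row_sets (fill_rows (k+r) D)"
    using 2 by auto
  have sub: "c \<subseteq> {k+r+1..}" if "c \<in> row_sets (fill_rows (k+r) D)" for c
    using fill_rows_Union[of "k+r" D] that by fastforce
  have r: "r \<ge> 1" using 2 by auto
  have dj: "c \<inter> {k+1..k+r} = {}" if "c \<in> row_sets (fill_rows (k+r) D)" for c
    using sub[OF that] by fastforce
  have ni: "{k+1..k+r} \<notin> row_sets (fill_rows (k+r) D)" using dj[of "{k+1..k+r}"] r by auto
  show ?case using IH dj ni r by (auto simp: row_sets_def disjoint_def Int_commute)
qed (auto simp: row_sets_def)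

lemma fill_row_order:
  assumes "distinct (map fst F)"
  shows "linear_order_on (row_sets F) (row_order F)"
proof -
  have inj: "fst (F ! i) = fst (F ! j) \<longleftrightarrow> i = j" if "i < length F" "j < length F" for i j
    using assms that nth_eq_iff_index_eq[of "map fst F" i j] by simp
  have rw: "c \<in> row_sets F \<longleftrightarrow> (\<exists>i<length F. c = fst (F ! i))" for c
    by (force simp: row_sets_def in_set_conv_nth)
  have ro: "(c, d) \<in> row_order F \<longleftrightarrow> (\<exists>i j. c = fst (F!i) \<and> d = fst (F!j) \<and> i \<le> j \<and> j < length F)" for c d
    by (auto simp: row_order_def)
  have "row_order F \<subseteq> row_sets F \<times> row_sets F"
  proof (rule subrelI)
    fix c d assume "(c, d) \<in> row_order F"
    then obtain i j where "c = fst (F!i)" "d = fst (F!j)" "i \<le> j" "j < length F" unfolding ro by blast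
    moreover have "i < length F" using calculation by simp
    ultimately show "(c, d) \<in> row_sets F \<times> row_sets F" unfolding mem_Times_iff rw by (metis fst_conv snd_conv)
  qed
  moreover have "refl_on (row_sets F) (row_order F)"
  proof (rule refl_onI)
    fix c assume "c \<in> row_sets F"
    then obtain i where "i < length F" "c = fst (F ! i)" unfolding rw by blast
    thus "(c, c) \<in> row_order F" unfolding ro by blast
  qed
  moreover have "trans (row_order F)"
  proof (rule transI)
    fix x y z assume "(x,y) \<in> row_order F" "(y,z) \<in> row_order F"
    then obtain i j j' k where "x = fst (F!i)" "y = fst (F!j)" "y = fst (F!j')" "z = fst (F!k)"
      "i \<le> j" "j < length F" "j' \<le> k" "k < length F" unfolding ro by blast
    moreover have "j = j'" using calculation inj[of j j'] by auto
    ultimately show "(x,z) \<in> row_order F" unfolding ro by (metis le_trans)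
  qed
  moreover have "antisym (row_order F)"
  proof (rule antisymI)
    fix x y assume "(x,y) \<in> row_order F" "(y,x) \<in> row_order F"
    then obtain i j j' k where *: "x = fst (F!i)" "y = fst (F!j)" "y = fst (F!j')" "x = fst (F!k)"
      "i \<le> j" "j < length F" "j' \<le> k" "k < length F" unfolding ro by blast
    have "j = j'" "i = k" using * inj[of j j'] inj[of i k] by auto
    thus "x = y" using * by auto
  qed
  moreover have "total_on (row_sets F) (row_order F)"
  proof (rule total_onI)
    fix c d assume "c \<in> row_sets F" "d \<in> row_sets F"
    then obtain i j where "i < length F" "c = fst (F ! i)" "j < length F" "d = fst (F ! j)" unfolding rw by blast
    thus "(c, d) \<in> row_order F \<or> (d, c) \<in> row_order F" unfolding ro using linorder_le_cases[of i j] by blast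
  qed
  ultimately show ?thesis by (simp add: order_on_defs)
qed

lemma fill_shades:
  assumes "distinct (map fst F)"
  shows "partition_on (row_sets F) (shade_parts F) \<and> card (shade_parts F) \<le> 2"
proof
  let ?U = "{c. (c, Unshaded) \<in> set F}" and ?S = "{c. (c, Shaded) \<in> set F}"
  have "x = y" if "(c,x) \<in> set F" "(c,y) \<in> set F" for c x y
    using assms that by (metis eq_key_imp_eq_value)
  hence "?U \<inter> ?S = {}" by blast
  hence dj: "disjoint (shade_parts F)" unfolding disjoint_def shade_parts_def by blast
  have "row_sets F = ?U \<union> ?S"
  proof (rule Set.set_eqI)
    fix c
    have "c \<in> row_sets F \<longleftrightarrow> (\<exists>x. (c, x) \<in> set F)" unfolding row_sets_def by force
    also have "\<dots> \<longleftrightarrow> (c, Unshaded) \<in> set F \<or> (c, Shaded) \<in> set F" using shade.exhaust by metis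
    finally show "c \<in> row_sets F \<longleftrightarrow> c \<in> ?U \<union> ?S" by blast
  qed
  moreover have "\<Union>(A - {{}}) = \<Union>A" for A :: "nat set set set" by auto
  ultimately have "\<Union>(shade_parts F) = row_sets F" unfolding shade_parts_def by simp
  moreover have "{} \<notin> shade_parts F" unfolding shade_parts_def by blast
  ultimately show "partition_on (row_sets F) (shade_parts F)" using dj unfolding partition_on_def by blast
  have "card (shade_parts F) \<le> card {{c. (c, Unshaded) \<in> set F}, {c. (c, Shaded) \<in> set F}}"
    unfolding shade_parts_def by (intro card_mono) auto
  also have "\<dots> \<le> 2" by (simp add: card_insert_if)
  finally show "card (shade_parts F) \<le> 2" .
qed

lemma fill_diagrams_props:
  assumes "\<forall>D\<in>set Ds. two_coloured_composition D"
  shows "(\<Union>F\<in>set (fill_diagrams k Ds). \<Union>(row_sets F)) = {k+1..k + sum_list (map boxes Ds)}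
    \<and> (\<forall>F\<in>set (fill_diagrams k Ds). \<exists>k' D. two_coloured_composition D \<and> F = fill_rows k' D)
    \<and> (\<forall>F\<in>set (fill_diagrams k Ds). \<forall>G\<in>set (fill_diagrams k Ds). F \<noteq> G \<longrightarrow> \<Union>(row_sets F) \<inter> \<Union>(row_sets G) = {})"
  using assms
proof (induction k Ds rule: fill_diagrams.induct)
  case (2 k D Ds)
  let ?k = "k + boxes D"
  have IH: "(\<Union>F\<in>set (fill_diagrams ?k Ds). \<Union>(row_sets F)) = {?k+1..?k + sum_list (map boxes Ds)}"
    "\<forall>F\<in>set (fill_diagrams ?k Ds). \<exists>k' D. two_coloured_composition D \<and> F = fill_rows k' D"
    "\<forall>F\<in>set (fill_diagrams ?k Ds). \<forall>G\<in>set (fill_diagrams ?k Ds). F \<noteq> G \<longrightarrow> \<Union>(row_sets F) \<inter> \<Union>(row_sets G) = {}"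
    using 2 by auto
  have "\<Union>(row_sets (fill_rows k D)) \<inter> \<Union>(row_sets G) = {}" if "G \<in> set (fill_diagrams ?k Ds)" for G
  proof -
    have "\<Union>(row_sets G) \<subseteq> {?k+1..?k + sum_list (map boxes Ds)}" using IH(1) that by blast
    thus ?thesis unfolding fill_rows_Union by fastforce
  qed
  moreover have "(\<Union>F\<in>set (fill_diagrams k (D#Ds)). \<Union>(row_sets F)) = {k+1..k + sum_list (map boxes (D#Ds))}"
    using IH(1) fill_rows_Union[of k D] by (auto simp del: Union_iff UN_iff)
  ultimately show ?case using IH(2,3) 2(2) by (auto simp: Int_commute simp del: Union_iff UN_iff)
qed auto

lemma TT_SS: "TT N \<subseteq> SS N"
proof
  fix t assume "t \<in> TT N"
  then obtain Ds where t: "t = quad_of_filled (fill_diagrams 0 Ds)" "\<forall>D\<in>set Ds. two_coloured_composition D"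
    "sum_list (map boxes Ds) = N"
    by (auto simp: TT_def sum_mset_sum_list simp flip: mset_map)
  define Fs where "Fs = fill_diagrams 0 Ds"
  have un: "(\<Union>F\<in>set Fs. \<Union>(row_sets F)) = {1..N}" and
    ex: "\<And>F. F \<in> set Fs \<Longrightarrow> \<exists>k' D. two_coloured_composition D \<and> F = fill_rows k' D" and
    dj: "\<And>F G. F \<in> set Fs \<Longrightarrow> G \<in> set Fs \<Longrightarrow> F \<noteq> G \<Longrightarrow> \<Union>(row_sets F) \<inter> \<Union>(row_sets G) = {}"
    using fill_diagrams_props[OF t(2), of 0] t(3) by (auto simp: Fs_def)
  have pr: "distinct (map fst F)" "disjoint (row_sets F)" "{} \<notin> row_sets F" "\<Union>(row_sets F) \<noteq> {}" if F: "F \<in> set Fs" for F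
  proof -
    obtain k' D where D: "two_coloured_composition D" "F = fill_rows k' D" using ex[OF F] by blast
    show *: "distinct (map fst F)" "disjoint (row_sets F)" "{} \<notin> row_sets F"
      using fill_rows_props[of D k'] D unfolding two_coloured_composition_def by auto
    have "D \<noteq> []" using D by (auto simp: two_coloured_composition_def)
    hence "F \<noteq> []" using D(2) by (cases D) auto
    hence "row_sets F \<noteq> {}" by (auto simp: row_sets_def)
    thus "\<Union>(row_sets F) \<noteq> {}" using * by auto
  qed
  define p where "p = (\<lambda>F. \<Union>(row_sets F)) ` set Fs"
  define q where "q = (\<Union>F\<in>set Fs. row_sets F)"
  define diag where "diag = (\<lambda>n. THE F. F \<in> set Fs \<and> \<Union>(row_sets F) = n)"
  have diag: "diag (\<Union>(row_sets F)) = F" if "F \<in> set Fs" for F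
    unfolding diag_def using that dj[of F] pr(4) by (intro the_equality) fastforce+
  have cnt: "counties q (\<Union>(row_sets F)) = row_sets F" if F: "F \<in> set Fs" for F
  proof
    show "row_sets F \<subseteq> counties q (\<Union>(row_sets F))" using F by (auto simp: counties_def q_def)
    show "counties q (\<Union>(row_sets F)) \<subseteq> row_sets F"
    proof
      fix c assume "c \<in> counties q (\<Union>(row_sets F))"
      then obtain G where G: "G \<in> set Fs" "c \<in> row_sets G" "c \<subseteq> \<Union>(row_sets F)" by (auto simp: counties_def q_def)
      have "c \<noteq> {}" using pr(3)[OF G(1)] G(2) by blast
      hence "F = G" using dj[OF F G(1)] G by blast
      thus "c \<in> row_sets F" using G by simp
    qed
  qed
  have P: "partition_on {1..N} p"
  proof -
    have "disjoint p" unfolding disjoint_def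
    proof (intro ballI impI)
      fix a b assume "a \<in> p" "b \<in> p" "a \<noteq> b"
      then obtain F G where "F \<in> set Fs" "a = \<Union>(row_sets F)" "G \<in> set Fs" "b = \<Union>(row_sets G)" "F \<noteq> G"
        by (auto simp: p_def simp del: Union_iff)
      thus "a \<inter> b = {}" using dj by blast
    qed
    moreover have "{} \<notin> p" using pr(4) unfolding p_def by (metis imageE)
    ultimately show ?thesis using un unfolding partition_on_def p_def by blast
  qed
  have Q1: "\<Union>q = {1..N}" using un unfolding q_def by blast
  have Q2: "disjoint q" unfolding disjoint_def
  proof (intro ballI impI)
    fix a b assume "a \<in> q" "b \<in> q" "a \<noteq> b"
    then obtain F G where FG: "F \<in> set Fs" "a \<in> row_sets F" "G \<in> set Fs" "b \<in> row_sets G" by (auto simp: q_def)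
    show "a \<inter> b = {}"
    proof (cases "F = G")
      case True thus ?thesis using pr(2)[OF FG(1)] FG \<open>a \<noteq> b\<close> by (auto simp: disjoint_def)
    next
      case False thus ?thesis using dj[OF FG(1,3)] FG by blast
    qed
  qed
  have Q: "refines {1..N} q p" unfolding refines_def
    using P Q1 Q2 pr(3) by (auto simp: partition_on_def q_def p_def)
  have "t = (p, q, \<lambda>n\<in>p. row_order (diag n), \<lambda>n\<in>p. shade_parts (diag n))"
    unfolding t(1) quad_of_filled_def Let_def p_def q_def diag_def Fs_def ..
  moreover have "(\<lambda>n\<in>p. row_order (diag n)) \<in> (\<Pi>\<^sub>E n\<in>p. {r. linear_order_on (counties q n) r})"
  proof (rule restrict_PiE_iff[THEN iffD2], rule ballI)
    fix n assume "n \<in> p"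
    then obtain F where F: "F \<in> set Fs" "n = \<Union>(row_sets F)" unfolding p_def by blast
    show "row_order (diag n) \<in> {r. linear_order_on (counties q n) r}"
      unfolding F(2) diag[OF F(1)] cnt[OF F(1)] using fill_row_order[OF pr(1)[OF F(1)]] by blast
  qed
  moreover have "(\<lambda>n\<in>p. shade_parts (diag n)) \<in> (\<Pi>\<^sub>E n\<in>p. {t. partition_on (counties q n) t \<and> card t \<le> 2})"
  proof (rule restrict_PiE_iff[THEN iffD2], rule ballI)
    fix n assume "n \<in> p"
    then obtain F where F: "F \<in> set Fs" "n = \<Union>(row_sets F)" unfolding p_def by blast
    show "shade_parts (diag n) \<in> {t. partition_on (counties q n) t \<and> card t \<le> 2}"
      unfolding F(2) diag[OF F(1)] cnt[OF F(1)] using fill_shades[OF pr(1)[OF F(1)]] by blast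
  qed
  ultimately show "t \<in> SS N" using P Q unfolding SS_def by simp
qed

end

theory Submission
  imports Defs
begin

text \<open>
  A charge-conserving operator acts by $R|ij\rangle = p_{ij}|ij\rangle + q_{ij}|ji\rangle$, and the braid
  relation becomes three polynomial relations between the \<open>p\<close> and \<open>q\<close> for each triple of indices. They
  leave three possibilities for a pair \<open>i\<close>, \<open>j\<close>: both $p_{ij}$ and $p_{ji}$ vanish (different
  nations), neither does and then $q_{ij} = q_{ji} = 0$ (same county), or exactly one of them vanishes
  (ordered counties of a nation). Thus $p_{ij} \neq 0$ defines a preorder, total on each nation, and within a nation
  all $a_i$ are roots of one quadratic polynomial, which gives the shading.

  X-equivalence only remembers \<open>p\<close>, the products $q_{ij} q_{ji}$ and where \<open>q\<close> vanishes. Hence the classes of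
  $\mathcal V(\lambda)$ are those of all pairs \<open>(p, q)\<close> compatible with the order and the shading of $\lambda$,
  and conversely a germ with $\alpha_n \neq \beta_n$ determines both relations. What remains is to
  classify such pairs of relations on \<open>{1..N}\<close> up to permutations, and the isomorphism types are the
  multisets of two-coloured compositions with \<open>N\<close> boxes.
\<close>

section \<open>Charge-conserving operators\<close>

text \<open>The recipe's constants are symmetric functions of eigenvalues. On an ordered pair the
  block on |ij>, |ji> has trace \<open>p i j\<close> and determinant \<open>- q i j * q j i\<close>,
  and the braid relation on triples with a repeated label makes \<open>p i i\<close> and
  \<open>p j j\<close> eigenvalues of it. If these are \<alpha> and \<beta>, the trace is \<alpha> +
  \<beta> and the product of the off-diagonal entries is - \<alpha> * \<beta>; the split into 1 and
  - \<alpha> * \<beta> is a normalisation within the X-class. The obstacle is that one operator need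
  not determine its shading: if \<alpha> and \<beta> of a nation coincide, every shading of that
  nation fits, so varieties of different quadruples overlap. Therefore \<open>realises\<close> is a
  relation between operators and pairs of relations, not a function, and equality of whole sets of
  classes is tested on one operator with distinct eigenvalues, which then has to occur in both sets.
  Uniqueness in the transversal avoids matching nations under a permutation. It counts the labels
  whose nation has a given profile; this number is visibly invariant and equals the multiplicity of
  a diagram times its number of boxes.\<close>

lemma mult_mat_unit_vec:
  fixes A :: "'a :: semiring_1 mat"
  assumes "A \<in> carrier_mat m n" "k < n"
  shows "A *\<^sub>v unit_vec n k = col A k"
proof (rule eq_vecI)
  fix r assume "r < dim_vec (col A k)"
  hence r: "r < m" "r < dim_row A" "k < dim_col A" using assms(1,2) by auto
  have "(A *\<^sub>v unit_vec n k) $ r = row A r \<bullet> unit_vec n k" using r by (simp only: index_mult_mat_vec)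
  also have "\<dots> = row A r $ k" by (rule scalar_prod_right_unit[OF assms(2)])
  also have "\<dots> = col A k $ r" using r by (simp only: index_row index_col)
  finally show "(A *\<^sub>v unit_vec n k) $ r = col A k $ r" .
next
  show "dim_vec (A *\<^sub>v unit_vec n k) = dim_vec (col A k)" by simp
qed 

lemma ket_carrier [simp]: "ket N i j \<in> carrier_vec (N * N)" "dim_vec (ket N i j) = N * N"
proof -
  show "dim_vec (ket N i j) = N * N" by (simp add: ket_def tensor_vec_def basis_vec_def)
  thus "ket N i j \<in> carrier_vec (N * N)" by (rule carrier_vecI)
qed
lemma pair_index_less:
  fixes i j M N :: nat
  assumes "i < M" "j < N"
  shows "i * N + j < M * N"
proof -
  have "i * N + j < Suc i * N" using assms by simp
  also have "\<dots> \<le> M * N" using assms by (intro mult_le_mono1) simp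
  finally show ?thesis .
qed

lemma pair_index_less1:
  assumes "i \<in> {1..M}" "j \<in> {1..N}"
  shows "(i - 1) * N + (j - 1) < M * (N::nat)"
  using assms by (intro pair_index_less) auto

definition pair_index :: "nat \<Rightarrow> nat \<Rightarrow> nat \<Rightarrow> nat" where
  "pair_index N i j = (i - 1) * N + (j - 1)"

lemma pair_index_div_mod:
  assumes "i \<in> {1..N}" "j \<in> {1..N}"
  shows "pair_index N i j div N + 1 = i" "pair_index N i j mod N + 1 = j" "pair_index N i j < N * N"
proof -
  have "j - 1 < N" using assms by auto
  hence "pair_index N i j div N = i - 1" "pair_index N i j mod N = j - 1"
    by (simp_all only: pair_index_def div_mult_self3 mod_mult_self3 div_less mod_less add_0_right gr_implies_not0 simp_thms)
  thus "pair_index N i j div N + 1 = i" "pair_index N i j mod N + 1 = j"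
    using assms by auto
  show "pair_index N i j < N * N"
    unfolding pair_index_def by (rule pair_index_less1[OF assms])
qed

lemma ket_eq_unit_vec:
  assumes "i \<in> {1..N}" "j \<in> {1..N}"
  shows "ket N i j = unit_vec (N * N) (pair_index N i j)"
  unfolding pair_index_def by (rule ket_eq[OF assms])

lemma ket_pair_index:
  assumes "i \<in> {1..N}" "j \<in> {1..N}" "k \<in> {1..N}" "l \<in> {1..N}"
  shows "ket N i j $ pair_index N k l = (if k = i \<and> l = j then 1 else 0)"
proof -
  have "pair_index N k l = pair_index N i j \<longleftrightarrow> k = i \<and> l = j"
    using pair_index_div_mod[OF assms(1,2)] pair_index_div_mod[OF assms(3,4)] by metis
  thus ?thesis
    using pair_index_div_mod[OF assms(1,2)] pair_index_div_mod[OF assms(3,4)]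
    by (simp add: ket_eq_unit_vec[OF assms(1,2)])
qed

lemma mat_eq_ketI:
  assumes "A \<in> carrier_mat m (N * N)" "B \<in> carrier_mat m (N * N)"
    and "\<And>i j. i \<in> {1..N} \<Longrightarrow> j \<in> {1..N} \<Longrightarrow> A *\<^sub>v ket N i j = B *\<^sub>v ket N i j"
  shows "A = B"
proof (rule mat_col_eqI)
  fix c assume "c < dim_col B"
  hence c: "c < N * N" using assms by simp
  hence N: "N > 0" by (cases N) auto
  have ij: "c div N + 1 \<in> {1..N}" "c mod N + 1 \<in> {1..N}"
    using c N by (auto simp: less_mult_imp_div_less Suc_le_eq)
  have "ket N (c div N + 1) (c mod N + 1) = unit_vec (N * N) c"
    unfolding ket_eq[OF ij] by simp
  thus "col A c = col B c"
    using assms(3)[OF ij] mult_mat_unit_vec[OF assms(1) c] mult_mat_unit_vec[OF assms(2) c] by simp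
qed (use assms in auto)

lemma ket_lincomb_eqD:
  assumes "x \<cdot>\<^sub>v ket N i j + y \<cdot>\<^sub>v ket N j i = x' \<cdot>\<^sub>v ket N i j + y' \<cdot>\<^sub>v ket N j i"
    "i \<in> {1..N}" "j \<in> {1..N}" "i \<noteq> j"
  shows "x = x'" "y = y'"
proof -
  note [simp] = ket_pair_index pair_index_div_mod(3)
  show "x = x'" using arg_cong[OF assms(1), of "\<lambda>v. v $ pair_index N i j"] assms(2-)
    by (simp del: One_nat_def atLeastAtMost_iff)
  show "y = y'" using arg_cong[OF assms(1), of "\<lambda>v. v $ pair_index N j i"] assms(2-)
    by (simp del: One_nat_def atLeastAtMost_iff)
qed

text \<open>
  Writing $R|ij\rangle = p_{ij}|ij\rangle + q_{ij}|ji\rangle$ also for $i = j$ avoids case distinctions.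
  Only $p_{ii} + q_{ii}$ matters on the diagonal, and \<open>diag0\<close> normalises the splitting.
\<close>

definition pq_op :: "nat \<Rightarrow> (nat \<Rightarrow> nat \<Rightarrow> complex) \<Rightarrow> (nat \<Rightarrow> nat \<Rightarrow> complex) \<Rightarrow> complex mat" where
  "pq_op N p q = mat (N * N) (N * N) (\<lambda>(r, c). let i = c div N + 1; j = c mod N + 1 in
     (p i j \<cdot>\<^sub>v ket N i j + q i j \<cdot>\<^sub>v ket N j i) $ r)"

definition diag0 :: "nat \<Rightarrow> (nat \<Rightarrow> nat \<Rightarrow> complex) \<Rightarrow> bool" where
  "diag0 N q \<longleftrightarrow> (\<forall>i\<in>{1..N}. q i i = 0)"

lemma pq_op_carrier [simp]: "pq_op N p q \<in> carrier_mat (N * N) (N * N)"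
  "dim_row (pq_op N p q) = N * N" "dim_col (pq_op N p q) = N * N"
  by (simp_all add: pq_op_def)

lemma pq_op_ket:
  assumes "i \<in> {1..N}" "j \<in> {1..N}"
  shows "pq_op N p q *\<^sub>v ket N i j = p i j \<cdot>\<^sub>v ket N i j + q i j \<cdot>\<^sub>v ket N j i"
proof -
  note m = pair_index_div_mod[OF assms]
  show ?thesis
    unfolding ket_eq_unit_vec[OF assms(1,2)] mult_mat_unit_vec[OF pq_op_carrier(1) m(3)]
    using m by (intro eq_vecI) (simp_all add: pq_op_def Let_def ket_eq_unit_vec[OF assms(1,2)] del: One_nat_def)
qed

lemma eq_pq_opI:
  assumes "A \<in> carrier_mat (N * N) (N * N)"
    and "\<And>i j. i \<in> {1..N} \<Longrightarrow> j \<in> {1..N} \<Longrightarrow> A *\<^sub>v ket N i j = p i j \<cdot>\<^sub>v ket N i j + q i j \<cdot>\<^sub>v ket N j i"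
  shows "A = pq_op N p q"
  by (rule mat_eq_ketI[OF assms(1) pq_op_carrier(1)]) (simp add: assms(2) pq_op_ket)

lemma pq_op_cong:
  assumes "\<And>i j. i \<in> {1..N} \<Longrightarrow> j \<in> {1..N} \<Longrightarrow> p i j = p' i j \<and> q i j = q' i j"
  shows "pq_op N p q = pq_op N p' q'"
  by (rule eq_pq_opI) (simp_all add: pq_op_ket assms)

lemma pq_op_eqD:
  assumes "pq_op N p q = pq_op N p' q'" "diag0 N q" "diag0 N q'" "i \<in> {1..N}" "j \<in> {1..N}"
  shows "p i j = p' i j" "q i j = q' i j"
proof -
  have e: "p i j \<cdot>\<^sub>v ket N i j + q i j \<cdot>\<^sub>v ket N j i = p' i j \<cdot>\<^sub>v ket N i j + q' i j \<cdot>\<^sub>v ket N j i"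
    using assms pq_op_ket by metis
  have "p i j = p' i j \<and> q i j = q' i j"
  proof (cases "i = j")
    case True
    thus ?thesis
      using arg_cong[OF e, of "\<lambda>v. v $ pair_index N i i"] assms(2-)
      by (simp add: ket_pair_index pair_index_div_mod(3) diag0_def del: One_nat_def atLeastAtMost_iff)
  qed (use ket_lincomb_eqD[OF e assms(4,5)] in auto)
  thus "p i j = p' i j" "q i j = q' i j" by auto
qed

lemma smult_ket_arith:
  fixes v :: "complex vec"
  shows "0 \<cdot>\<^sub>v ket N i j = 0\<^sub>v (N * N)" "v \<in> carrier_vec (N * N) \<Longrightarrow> v + 0\<^sub>v (N * N) = v"
  "v \<in> carrier_vec (N * N) \<Longrightarrow> 0\<^sub>v (N * N) + v = v"
  by auto

text \<open>For \<open>i > j\<close> the vector |ij> is the second one of its pair, so its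
  coefficients stand in the second row of \<open>A j i\<close>, its own coefficient last.\<close>

definition cc_p :: "(nat \<Rightarrow> complex) \<Rightarrow> (nat \<Rightarrow> nat \<Rightarrow> mat2) \<Rightarrow> nat \<Rightarrow> nat \<Rightarrow> complex" where
  "cc_p a A i j = (if i = j then a i else if i < j then fst (A i j) else snd (snd (snd (A j i))))"

definition cc_q :: "(nat \<Rightarrow> nat \<Rightarrow> mat2) \<Rightarrow> nat \<Rightarrow> nat \<Rightarrow> complex" where
  "cc_q A i j = (if i = j then 0 else if i < j then fst (snd (A i j)) else fst (snd (snd (A j i))))"

lemma cc_q_diag0: "diag0 N (cc_q A)"
  by (simp add: diag0_def cc_q_def)

lemma cc_image_eq: "cc_image N a A i j = cc_p a A i j \<cdot>\<^sub>v ket N i j + cc_q A i j \<cdot>\<^sub>v ket N j i"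
proof (cases i j rule: linorder_cases)
  case greater
  have "z \<cdot>\<^sub>v ket N j i + u \<cdot>\<^sub>v ket N i j = u \<cdot>\<^sub>v ket N i j + z \<cdot>\<^sub>v ket N j i" for z u
    by (rule comm_add_vec[of _ "N * N"]) simp_all
  thus ?thesis using greater by (simp add: cc_image_def cc_p_def cc_q_def split: prod.splits)
qed (simp_all add: cc_image_def cc_p_def cc_q_def smult_ket_arith split: prod.splits)

lemma cc_op_eq: "cc_op N a A = pq_op N (cc_p a A) (cc_q A)"
proof (rule eq_pq_opI)
  show "cc_op N a A \<in> carrier_mat (N * N) (N * N)" by (simp add: cc_op_def)
qed (simp add: cc_op_ket cc_image_eq)

lemma charge_conserving_iff:
  "charge_conserving N R \<longleftrightarrow> (\<exists>p q. diag0 N q \<and> R = pq_op N p q)"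
proof
  assume "charge_conserving N R"
  then obtain a A where R: "R \<in> carrier_mat (N * N) (N * N)"
    "\<forall>i\<in>{1..N}. \<forall>j\<in>{1..N}. R *\<^sub>v ket N i j = cc_image N a A i j" by (auto simp: charge_conserving_def)
  hence "R = pq_op N (cc_p a A) (cc_q A)" by (intro eq_pq_opI) (auto simp: cc_image_eq)
  thus "\<exists>p q. diag0 N q \<and> R = pq_op N p q" using cc_q_diag0 by blast
next
  assume "\<exists>p q. diag0 N q \<and> R = pq_op N p q"
  then obtain p q where q: "diag0 N q" and R: "R = pq_op N p q" by blast
  define A where "A = (\<lambda>i j. (p i j, q i j, q j i, p j i))"
  have "R = pq_op N (cc_p (\<lambda>i. p i i) A) (cc_q A)"
    unfolding R using q by (intro pq_op_cong) (auto simp: cc_p_def cc_q_def A_def diag0_def)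
  hence "R *\<^sub>v ket N i j = cc_image N (\<lambda>i. p i i) A i j" if "i \<in> {1..N}" "j \<in> {1..N}" for i j
    using that by (simp add: pq_op_ket cc_image_eq)
  thus "charge_conserving N R" using R by (auto simp: charge_conserving_def)
qed

section \<open>Products and inverses of charge-conserving operators, block by block\<close>

lemma pq_op_mult:
  "pq_op N p q * pq_op N p' q' =
   pq_op N (\<lambda>i j. p' i j * p i j + q' i j * q j i) (\<lambda>i j. p' i j * q i j + q' i j * p j i)"
proof (rule eq_pq_opI)
  fix i j assume ij: "i \<in> {1..N}" "j \<in> {1..N}"
  have "pq_op N p q * pq_op N p' q' *\<^sub>v ket N i j =
     pq_op N p q *\<^sub>v (p' i j \<cdot>\<^sub>v ket N i j + q' i j \<cdot>\<^sub>v ket N j i)"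
    using ij by (subst assoc_mult_mat_vec) (auto simp: pq_op_ket)
  also have "\<dots> = p' i j \<cdot>\<^sub>v (p i j \<cdot>\<^sub>v ket N i j + q i j \<cdot>\<^sub>v ket N j i) +
     q' i j \<cdot>\<^sub>v (p j i \<cdot>\<^sub>v ket N j i + q j i \<cdot>\<^sub>v ket N i j)"
    using ij by (simp add: mult_add_distrib_mat_vec[of _ "N*N" "N*N"] mult_mat_vec[of _ "N*N" "N*N"] pq_op_ket)
  also have "\<dots> = (p' i j * p i j + q' i j * q j i) \<cdot>\<^sub>v ket N i j + (p' i j * q i j + q' i j * p j i) \<cdot>\<^sub>v ket N j i"
    by (intro eq_vecI) (auto simp: algebra_simps)
  finally show "pq_op N p q * pq_op N p' q' *\<^sub>v ket N i j = (p' i j * p i j + q' i j * q j i) \<cdot>\<^sub>v ket N i j +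
     (p' i j * q i j + q' i j * p j i) \<cdot>\<^sub>v ket N j i" .
qed (intro mult_carrier_mat[of _ _ "N*N"], auto)

lemma pq_op_one: "1\<^sub>m (N * N) = pq_op N (\<lambda>i j. 1) (\<lambda>i j. 0)"
  by (intro eq_pq_opI) (auto simp: smult_ket_arith)

lemma invertible_matI:
  assumes "A \<in> carrier_mat n n" "B \<in> carrier_mat n n" "A * B = 1\<^sub>m n" "B * A = 1\<^sub>m n"
  shows "invertible_mat A"
  using assms by (auto simp: invertible_mat_def inverts_mat_def intro!: exI[of _ B])

lemma invertible_mat_left_inverse:
  assumes "A \<in> carrier_mat n n" "invertible_mat A"
  obtains B where "B \<in> carrier_mat n n" "B * A = 1\<^sub>m n"
proof -
  obtain B where B: "A * B = 1\<^sub>m n" "B * A = 1\<^sub>m (dim_row B)"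
    using assms by (auto simp: invertible_mat_def inverts_mat_def)
  have "dim_col B = n" using arg_cong[OF B(1), of dim_col] by simp
  moreover have "dim_row B = n" using arg_cong[OF B(2), of dim_col] assms by simp
  ultimately show ?thesis using B that by auto
qed

text \<open>\<open>conj_mat\<close> inverts by Gauss-Jordan elimination. An inverse exhibited by
  hand has to be its result: failure would contradict invertibility, and inverses are
  unique.\<close>

lemma the_mat_inverse:
  fixes A B :: "complex mat"
  assumes "A \<in> carrier_mat n n" "B \<in> carrier_mat n n" "A * B = 1\<^sub>m n" "B * A = 1\<^sub>m n"
  shows "the (mat_inverse A) = B"
proof (cases "mat_inverse A")
  case None
  hence "A \<in> Units (ring_mat TYPE(complex) n ())" using assms by (auto simp: Units_def ring_mat_simps)
  thus ?thesis using mat_inverse(1)[OF assms(1) None, of "()"] by simp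
next
  case (Some C)
  hence C: "C * A = 1\<^sub>m n" "C \<in> carrier_mat n n" using mat_inverse(2)[OF assms(1)] by auto
  have "C = C * (A * B)" using assms C by simp
  also have "\<dots> = C * A * B" using assms C by (intro assoc_mult_mat[symmetric]) auto
  also have "\<dots> = B" using assms C by simp
  finally show ?thesis using Some by simp
qed

text \<open>Cramer's rule in each 2 by 2 block. The same formula covers the diagonal: there
  \<open>q i i = 0\<close>, so \<open>D i i\<close> is the square of \<open>p i i\<close> and the
  inverse acts by \<open>1 / p i i\<close>.\<close>

lemma pq_op_inverse:
  assumes "diag0 N q" "\<forall>i\<in>{1..N}. p i i \<noteq> 0"
    "\<forall>i\<in>{1..N}. \<forall>j\<in>{1..N}. i \<noteq> j \<longrightarrow> p i j * p j i \<noteq> q i j * q j i"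
  defines "D \<equiv> \<lambda>i j. p i j * p j i - q i j * q j i"
  shows "pq_op N p q * pq_op N (\<lambda>i j. p j i / D i j) (\<lambda>i j. - q i j / D i j) = 1\<^sub>m (N * N)"
    "pq_op N (\<lambda>i j. p j i / D i j) (\<lambda>i j. - q i j / D i j) * pq_op N p q = 1\<^sub>m (N * N)"
proof -
  have D: "D i j \<noteq> 0" "D j i = D i j" if "i \<in> {1..N}" "j \<in> {1..N}" for i j
    using that assms(1-3) unfolding D_def diag0_def
     apply (metis diff_zero divisors_zero eq_iff_diff_eq_0 mult_zero_left)
    by (simp add: mult.commute)
  show "pq_op N p q * pq_op N (\<lambda>i j. p j i / D i j) (\<lambda>i j. - q i j / D i j) = 1\<^sub>m (N * N)"
    unfolding pq_op_mult pq_op_one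
  proof (rule pq_op_cong, intro conjI)
    fix i j assume ij: "i \<in> {1..N}" "j \<in> {1..N}"
    have "p j i / D i j * p i j + - q i j / D i j * q j i = D i j / D i j"
      unfolding D_def by (simp add: diff_divide_distrib mult.commute del: divide_self_if)
    thus "p j i / D i j * p i j + - q i j / D i j * q j i = 1" using D ij by simp
    show "p j i / D i j * q i j + - q i j / D i j * p j i = 0" by simp
  qed
  show "pq_op N (\<lambda>i j. p j i / D i j) (\<lambda>i j. - q i j / D i j) * pq_op N p q = 1\<^sub>m (N * N)"
    unfolding pq_op_mult pq_op_one
  proof (rule pq_op_cong, intro conjI)
    fix i j assume ij: "i \<in> {1..N}" "j \<in> {1..N}"
    have "p i j * (p j i / D i j) + q i j * (- q j i / D j i) = D i j / D i j"
      unfolding D(2)[OF ij] by (simp add: D_def diff_divide_distrib del: divide_self_if)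
    thus "p i j * (p j i / D i j) + q i j * (- q j i / D j i) = 1" using D ij by simp
    show "p i j * (- q i j / D i j) + q i j * (p i j / D j i) = 0" using D(2)[OF ij] by simp
  qed
qed

lemma pq_op_invertible:
  assumes "diag0 N q"
  shows "invertible_mat (pq_op N p q) \<longleftrightarrow> (\<forall>i\<in>{1..N}. p i i \<noteq> 0) \<and>
     (\<forall>i\<in>{1..N}. \<forall>j\<in>{1..N}. i \<noteq> j \<longrightarrow> p i j * p j i \<noteq> q i j * q j i)"
proof
  assume "invertible_mat (pq_op N p q)"
  then obtain B where B: "B \<in> carrier_mat (N * N) (N * N)" "B * pq_op N p q = 1\<^sub>m (N * N)"
    using invertible_mat_left_inverse[OF pq_op_carrier(1)] by blast
  have inj: "v = 0\<^sub>v (N * N)" if "v \<in> carrier_vec (N * N)" "pq_op N p q *\<^sub>v v = 0\<^sub>v (N * N)" for v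
  proof -
    have "v = B * pq_op N p q *\<^sub>v v" using that B by simp
    also have "\<dots> = B *\<^sub>v (pq_op N p q *\<^sub>v v)" using that B by (intro assoc_mult_mat_vec) auto
    also have "\<dots> = 0\<^sub>v (N * N)" unfolding that(2) using B by auto
    finally show ?thesis .
  qed
  have ne: "ket N i j \<noteq> 0\<^sub>v (N * N)" if "i \<in> {1..N}" "j \<in> {1..N}" for i j
    using ket_pair_index[OF that that] pair_index_div_mod(3)[OF that] by auto
  have ker: "x * p i j + y * q j i \<noteq> 0 \<or> x * q i j + y * p j i \<noteq> 0"
    if ij: "i \<in> {1..N}" "j \<in> {1..N}" "i \<noteq> j" and xy: "x \<noteq> 0 \<or> y \<noteq> 0" for i j x y
  proof (rule ccontr)
    assume c: "\<not> ?thesis"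
    have "pq_op N p q *\<^sub>v (x \<cdot>\<^sub>v ket N i j + y \<cdot>\<^sub>v ket N j i) =
      x \<cdot>\<^sub>v (p i j \<cdot>\<^sub>v ket N i j + q i j \<cdot>\<^sub>v ket N j i) + y \<cdot>\<^sub>v (p j i \<cdot>\<^sub>v ket N j i + q j i \<cdot>\<^sub>v ket N i j)"
      using ij by (simp add: mult_add_distrib_mat_vec[of _ "N*N" "N*N"] mult_mat_vec[of _ "N*N" "N*N"] pq_op_ket)
    also have "\<dots> = (x * p i j + y * q j i) \<cdot>\<^sub>v ket N i j + (x * q i j + y * p j i) \<cdot>\<^sub>v ket N j i"
      by (intro eq_vecI) (auto simp: algebra_simps)
    also have "\<dots> = 0\<^sub>v (N * N)" using c by (simp add: smult_ket_arith)
    finally have "x \<cdot>\<^sub>v ket N i j + y \<cdot>\<^sub>v ket N j i = 0\<^sub>v (N * N)" by (rule inj[rotated]) auto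
    also have "\<dots> = 0 \<cdot>\<^sub>v ket N i j + 0 \<cdot>\<^sub>v ket N j i" by (simp add: smult_ket_arith)
    finally show False using ket_lincomb_eqD[of x N i j y 0 0] ij xy by simp
  qed
  show "(\<forall>i\<in>{1..N}. p i i \<noteq> 0) \<and> (\<forall>i\<in>{1..N}. \<forall>j\<in>{1..N}. i \<noteq> j \<longrightarrow> p i j * p j i \<noteq> q i j * q j i)"
  proof (intro conjI ballI impI notI)
    fix i assume i: "i \<in> {1..N}" "p i i = 0"
    hence "pq_op N p q *\<^sub>v ket N i i = 0\<^sub>v (N * N)"
      using assms by (simp add: pq_op_ket diag0_def smult_ket_arith)
    thus False using inj[of "ket N i i"] ne i by auto
  next
    fix i j assume ij: "i \<in> {1..N}" "j \<in> {1..N}" "i \<noteq> j" "p i j * p j i = q i j * q j i"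
    show False
    \<comment> \<open>When the determinant vanishes, \<open>(p j i, - q i j)\<close> is in the
      kernel of the block. If this vector is zero, \<open>(q j i, - p i j)\<close> takes its place,
      and if that is zero too, the whole column of |ij> vanishes.\<close>
    proof (cases "p j i = 0 \<and> q i j = 0")
      case True
      thus False using ker[OF ij(1-3), of "q j i" "- p i j"] ker[OF ij(1-3), of 1 0] by auto
    next
      case False
      thus False using ker[OF ij(1-3), of "p j i" "- q i j"] ij(4) by (auto simp: mult.commute)
    qed
  qed
next
  assume *: "(\<forall>i\<in>{1..N}. p i i \<noteq> 0) \<and> (\<forall>i\<in>{1..N}. \<forall>j\<in>{1..N}. i \<noteq> j \<longrightarrow> p i j * p j i \<noteq> q i j * q j i)"
  show "invertible_mat (pq_op N p q)"
    by (rule invertible_matI[OF _ _ pq_op_inverse]) (use * assms in auto)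
qed

section \<open>The braid relation in coordinates\<close>

lemma dim_tensor_vec [simp]: "dim_vec (tensor_vec v w) = dim_vec v * dim_vec w"
  by (simp add: tensor_vec_def)

lemma dim_tensor_mat [simp]:
  "dim_row (tensor_mat A B) = dim_row A * dim_row B" "dim_col (tensor_mat A B) = dim_col A * dim_col B"
  by (simp_all add: tensor_mat_def)

lemma tensor_vec_lincomb_left:
  assumes "dim_vec v = dim_vec w"
  shows "tensor_vec (a \<cdot>\<^sub>v v + b \<cdot>\<^sub>v w) u = a \<cdot>\<^sub>v tensor_vec v u + b \<cdot>\<^sub>v tensor_vec w u"
  using assms
  by (intro eq_vecI) (simp_all add: tensor_vec_def less_mult_imp_div_less algebra_simps)

lemma tensor_vec_lincomb_right:
  assumes "dim_vec v = dim_vec w"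
  shows "tensor_vec u (a \<cdot>\<^sub>v v + b \<cdot>\<^sub>v w) = a \<cdot>\<^sub>v tensor_vec u v + b \<cdot>\<^sub>v tensor_vec u w"
proof (rule eq_vecI)
  fix k assume "k < dim_vec (a \<cdot>\<^sub>v tensor_vec u v + b \<cdot>\<^sub>v tensor_vec u w)"
  hence k: "k < dim_vec u * dim_vec w" by simp
  hence "k mod dim_vec w < dim_vec w" by (cases "dim_vec w") auto
  thus "tensor_vec u (a \<cdot>\<^sub>v v + b \<cdot>\<^sub>v w) $ k = (a \<cdot>\<^sub>v tensor_vec u v + b \<cdot>\<^sub>v tensor_vec u w) $ k"
    using k assms by (simp add: tensor_vec_def algebra_simps)
qed (simp add: assms)

lemma tensor_unit_vec:
  assumes "i < n" "j < m"
  shows "tensor_vec (unit_vec n i) (unit_vec m j) = unit_vec (n * m) (i * m + j)"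
proof (rule eq_vecI)
  fix k assume "k < dim_vec (unit_vec (n * m) (i * m + j) :: complex vec)"
  hence k: "k < n * m" by simp
  hence "k mod m < m" "k div m < n" by (cases "m = 0"; simp add: less_mult_imp_div_less)+
  moreover have "k = i * m + j \<longleftrightarrow> k div m = i \<and> k mod m = j"
    using assms div_mult_mod_eq[of k m] by auto
  ultimately show "tensor_vec (unit_vec n i) (unit_vec m j) $ k = unit_vec (n * m) (i * m + j) $ k"
    using k by (simp add: tensor_vec_def unit_vec_def)
qed simp

lemma tensor_mat_unit_vec:
  assumes "A \<in> carrier_mat m n" "B \<in> carrier_mat m' n'" "i < n" "j < n'"
  shows "tensor_mat A B *\<^sub>v tensor_vec (unit_vec n i) (unit_vec n' j) =
    tensor_vec (A *\<^sub>v unit_vec n i) (B *\<^sub>v unit_vec n' j)"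
proof -
  have AB: "tensor_mat A B \<in> carrier_mat (m * m') (n * n')" using assms by (simp add: tensor_mat_def)
  have l: "i * n' + j < n * n'" using assms(3,4) by (rule pair_index_less)
  show ?thesis
    unfolding tensor_unit_vec[OF assms(3,4)] mult_mat_unit_vec[OF AB l]
      mult_mat_unit_vec[OF assms(1,3)] mult_mat_unit_vec[OF assms(2,4)]
  proof (rule eq_vecI)
    fix k assume "k < dim_vec (tensor_vec (col A i) (col B j))"
    hence k: "k < m * m'" using assms by simp
    hence "k mod m' < m'" "k div m' < m" by (cases "m' = 0"; simp add: less_mult_imp_div_less)+
    thus "col (tensor_mat A B) (i * n' + j) $ k = tensor_vec (col A i) (col B j) $ k"
      using k l assms by (simp add: tensor_mat_def tensor_vec_def)
  qed (use assms in simp)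
qed

definition ket3 :: "nat \<Rightarrow> nat \<Rightarrow> nat \<Rightarrow> nat \<Rightarrow> complex vec" where
  "ket3 N i j k = tensor_vec (ket N i j) (basis_vec N k)"

definition triple_index :: "nat \<Rightarrow> nat \<Rightarrow> nat \<Rightarrow> nat \<Rightarrow> nat" where
  "triple_index N i j k = pair_index N i j * N + (k - 1)"

lemma ket3_carrier [simp]: "dim_vec (ket3 N i j k) = N * N * N" "ket3 N i j k \<in> carrier_vec (N * N * N)"
proof -
  show "dim_vec (ket3 N i j k) = N * N * N" by (simp add: ket3_def basis_vec_def)
  thus "ket3 N i j k \<in> carrier_vec (N * N * N)" by (rule carrier_vecI)
qed

lemma ket3_eq_unit_vec:
  assumes "i \<in> {1..N}" "j \<in> {1..N}" "k \<in> {1..N}"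
  shows "ket3 N i j k = unit_vec (N * N * N) (triple_index N i j k)"
proof -
  have "k - 1 < N" using assms by auto
  from tensor_unit_vec[OF pair_index_div_mod(3)[OF assms(1,2)] this] show ?thesis
    unfolding ket3_def triple_index_def ket_eq_unit_vec[OF assms(1,2)] basis_vec_def .
qed

text \<open>\<open>ket3\<close> is bracketed to the left, which suits R \<otimes> 1. This regrouping
  lets 1 \<otimes> R act on the last two factors.\<close>

lemma ket3_eq_right:
  assumes "i \<in> {1..N}" "j \<in> {1..N}" "k \<in> {1..N}"
  shows "ket3 N i j k = tensor_vec (basis_vec N i) (ket N j k)"
proof -
  have "tensor_vec (basis_vec N i) (ket N j k) = unit_vec (N * (N * N)) ((i - 1) * (N * N) + pair_index N j k)"
    unfolding basis_vec_def ket_eq_unit_vec[OF assms(2,3)]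
    by (rule tensor_unit_vec[OF _ pair_index_div_mod(3)[OF assms(2,3)]]) (use assms in auto)
  also have "(i - 1) * (N * N) + pair_index N j k = triple_index N i j k"
    by (simp add: triple_index_def pair_index_def algebra_simps)
  finally show ?thesis unfolding ket3_eq_unit_vec[OF assms] by (simp add: mult.assoc)
qed

lemma triple_index_props:
  assumes "i \<in> {1..N}" "j \<in> {1..N}" "k \<in> {1..N}"
  shows "triple_index N i j k div N = pair_index N i j" "triple_index N i j k mod N = k - 1"
    "triple_index N i j k < N * N * N"
proof -
  have k: "k - 1 < N" using assms by auto
  thus "triple_index N i j k div N = pair_index N i j" "triple_index N i j k mod N = k - 1"
    by (simp_all only: triple_index_def div_mult_self3 mod_mult_self3 div_less mod_less add_0_right gr_implies_not0 simp_thms)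
  show "triple_index N i j k < N * N * N"
    unfolding triple_index_def by (rule pair_index_less[OF pair_index_div_mod(3)[OF assms(1,2)] k])
qed

lemma ket3_index:
  assumes "i \<in> {1..N}" "j \<in> {1..N}" "k \<in> {1..N}" "a \<in> {1..N}" "b \<in> {1..N}" "c \<in> {1..N}"
  shows "ket3 N i j k $ triple_index N a b c = (if a = i \<and> b = j \<and> c = k then 1 else 0)"
proof -
  have "triple_index N a b c = triple_index N i j k \<longleftrightarrow> a = i \<and> b = j \<and> c = k"
  proof
    assume *: "triple_index N a b c = triple_index N i j k"
    hence "pair_index N a b = pair_index N i j" "c - 1 = k - 1"
      using triple_index_props(1,2)[OF assms(1-3)] triple_index_props(1,2)[OF assms(4-6)] by simp_all
    moreover from this have "a = i" "b = j"
      using pair_index_div_mod(1,2)[OF assms(1,2)] pair_index_div_mod(1,2)[OF assms(4,5)] by simp_all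
    ultimately show "a = i \<and> b = j \<and> c = k" using assms(3,6) by auto
  qed auto
  thus ?thesis
    using triple_index_props(3)[OF assms(4-6)] triple_index_props(3)[OF assms(1-3)]
    by (simp add: ket3_eq_unit_vec[OF assms(1-3)])
qed

lemma tensor_left_ket3:
  assumes "i \<in> {1..N}" "j \<in> {1..N}" "k \<in> {1..N}"
  shows "tensor_mat (pq_op N p q) (1\<^sub>m N) *\<^sub>v ket3 N i j k = p i j \<cdot>\<^sub>v ket3 N i j k + q i j \<cdot>\<^sub>v ket3 N j i k"
proof -
  have k: "k - 1 < N" using assms by auto
  have "tensor_mat (pq_op N p q) (1\<^sub>m N) *\<^sub>v ket3 N i j k =
      tensor_vec (pq_op N p q *\<^sub>v ket N i j) (1\<^sub>m N *\<^sub>v basis_vec N k)"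
    unfolding ket3_def ket_eq_unit_vec[OF assms(1,2)] basis_vec_def
    by (rule tensor_mat_unit_vec[OF pq_op_carrier(1) one_carrier_mat pair_index_div_mod(3)[OF assms(1,2)] k])
  also have "1\<^sub>m N *\<^sub>v basis_vec N k = basis_vec N k"
    unfolding basis_vec_def by (rule one_mult_mat_vec) (rule unit_vec_carrier)
  finally show ?thesis
    unfolding pq_op_ket[OF assms(1,2)] ket3_def by (simp add: tensor_vec_lincomb_left)
qed

lemma tensor_right_ket3:
  assumes "i \<in> {1..N}" "j \<in> {1..N}" "k \<in> {1..N}"
  shows "tensor_mat (1\<^sub>m N) (pq_op N p q) *\<^sub>v ket3 N i j k = p j k \<cdot>\<^sub>v ket3 N i j k + q j k \<cdot>\<^sub>v ket3 N i k j"
proof -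
  have i: "i - 1 < N" using assms by auto
  have "tensor_mat (1\<^sub>m N) (pq_op N p q) *\<^sub>v ket3 N i j k =
      tensor_vec (1\<^sub>m N *\<^sub>v basis_vec N i) (pq_op N p q *\<^sub>v ket N j k)"
    unfolding ket3_eq_right[OF assms] ket_eq_unit_vec[OF assms(2,3)] basis_vec_def
    by (rule tensor_mat_unit_vec[OF one_carrier_mat pq_op_carrier(1) i pair_index_div_mod(3)[OF assms(2,3)]])
  also have "1\<^sub>m N *\<^sub>v basis_vec N i = basis_vec N i"
    unfolding basis_vec_def by (rule one_mult_mat_vec) (rule unit_vec_carrier)
  finally show ?thesis
    unfolding pq_op_ket[OF assms(2,3)] ket3_eq_right[OF assms] ket3_eq_right[OF assms(1,3,2)]
    by (simp add: tensor_vec_lincomb_right)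
qed

text \<open>
  The coefficients of \<open>|ijk\<rangle>\<close>, \<open>|jik\<rangle>\<close> and \<open>|ikj\<rangle>\<close> in the braid relation applied to
  \<open>|ijk\<rangle>\<close>; the other three cancel. As \<open>q\<close> vanishes on the diagonal, they remain valid
  separate conditions when some of the indices coincide.
\<close>

definition ybe :: "nat \<Rightarrow> (nat \<Rightarrow> nat \<Rightarrow> complex) \<Rightarrow> (nat \<Rightarrow> nat \<Rightarrow> complex) \<Rightarrow> bool" where
  "ybe N p q \<longleftrightarrow> (\<forall>i\<in>{1..N}. \<forall>j\<in>{1..N}. \<forall>k\<in>{1..N}.
     p i j * p i j * p j k + p i k * (q i j * q j i) = p i j * p j k * p j k + p i k * (q j k * q k j) \<and>
     q i j * (p i j * p j k + p i k * p j i - p j k * p i k) = 0 \<and>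
     q j k * (p i j * p i k - p j k * p i j - p i k * p k j) = 0)"

lemma mult_mat_vec_lincomb:
  fixes A :: "complex mat"
  assumes "A \<in> carrier_mat m n" "v \<in> carrier_vec n" "w \<in> carrier_vec n"
  shows "A *\<^sub>v (a \<cdot>\<^sub>v v + b \<cdot>\<^sub>v w) = a \<cdot>\<^sub>v (A *\<^sub>v v) + b \<cdot>\<^sub>v (A *\<^sub>v w)"
  using assms by (simp add: mult_add_distrib_mat_vec[OF assms(1)] mult_mat_vec[OF assms(1)])

text \<open>The entrywise form serves both directions of the equivalence: the entry at one basis
  index isolates a single coefficient, and all entries together give equality of vectors. It holds
  also when some of \<open>i\<close>, \<open>j\<close>, \<open>k\<close> coincide.\<close>

lemma braid_equation_ket3:
  fixes p q :: "nat \<Rightarrow> nat \<Rightarrow> complex"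
  assumes ijk: "i \<in> {1..N}" "j \<in> {1..N}" "k \<in> {1..N}" and t: "t < N * N * N"
  defines "S \<equiv> tensor_mat (pq_op N p q) (1\<^sub>m N)" and "T \<equiv> tensor_mat (1\<^sub>m N) (pq_op N p q)"
  shows "(S * T * S *\<^sub>v ket3 N i j k) $ t - (T * S * T *\<^sub>v ket3 N i j k) $ t =
    (p i j * p i j * p j k + p i k * (q i j * q j i) - (p i j * p j k * p j k + p i k * (q j k * q k j))) * ket3 N i j k $ t +
    q i j * (p i j * p j k + p i k * p j i - p j k * p i k) * ket3 N j i k $ t +
    q j k * (p i j * p i k - p j k * p i j - p i k * p k j) * ket3 N i k j $ t"
proof -
  have ST: "S \<in> carrier_mat (N * N * N) (N * N * N)" "T \<in> carrier_mat (N * N * N) (N * N * N)"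
    unfolding S_def T_def by (auto intro!: carrier_matI)
  note lin = mult_mat_vec_lincomb[OF ST(1)] mult_mat_vec_lincomb[OF ST(2)]
  note act = tensor_left_ket3[of _ N _ _ p q, folded S_def] tensor_right_ket3[of _ N _ _ p q, folded T_def]
  have c: "S *\<^sub>v v \<in> carrier_vec (N * N * N)" "T *\<^sub>v v \<in> carrier_vec (N * N * N)" for v
    using ST by (auto intro!: carrier_vecI)
  have cl: "a \<cdot>\<^sub>v v + b \<cdot>\<^sub>v w \<in> carrier_vec (N * N * N)" if "v \<in> carrier_vec (N * N * N)" "w \<in> carrier_vec (N * N * N)"
    for a b :: complex and v w using that by simp
  have STS: "S * T * S *\<^sub>v ket3 N i j k = S *\<^sub>v (T *\<^sub>v (S *\<^sub>v ket3 N i j k))"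
    using ST by (simp only: assoc_mult_mat_vec[of _ "N*N*N" "N*N*N" _ "N*N*N"] mult_carrier_mat[of _ "N*N*N" "N*N*N" _ "N*N*N"] c ket3_carrier)
  have TST: "T * S * T *\<^sub>v ket3 N i j k = T *\<^sub>v (S *\<^sub>v (T *\<^sub>v ket3 N i j k))"
    using ST by (simp only: assoc_mult_mat_vec[of _ "N*N*N" "N*N*N" _ "N*N*N"] mult_carrier_mat[of _ "N*N*N" "N*N*N" _ "N*N*N"] c ket3_carrier)
  have 1: "S *\<^sub>v (T *\<^sub>v (S *\<^sub>v ket3 N i j k)) =
     p i j \<cdot>\<^sub>v (p j k \<cdot>\<^sub>v (p i j \<cdot>\<^sub>v ket3 N i j k + q i j \<cdot>\<^sub>v ket3 N j i k) + q j k \<cdot>\<^sub>v (p i k \<cdot>\<^sub>v ket3 N i k j + q i k \<cdot>\<^sub>v ket3 N k i j)) +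
     q i j \<cdot>\<^sub>v (p i k \<cdot>\<^sub>v (p j i \<cdot>\<^sub>v ket3 N j i k + q j i \<cdot>\<^sub>v ket3 N i j k) + q i k \<cdot>\<^sub>v (p j k \<cdot>\<^sub>v ket3 N j k i + q j k \<cdot>\<^sub>v ket3 N k j i))"
    by (simp only: act ijk lin ket3_carrier cl c)
  have 2: "T *\<^sub>v (S *\<^sub>v (T *\<^sub>v ket3 N i j k)) =
     p j k \<cdot>\<^sub>v (p i j \<cdot>\<^sub>v (p j k \<cdot>\<^sub>v ket3 N i j k + q j k \<cdot>\<^sub>v ket3 N i k j) + q i j \<cdot>\<^sub>v (p i k \<cdot>\<^sub>v ket3 N j i k + q i k \<cdot>\<^sub>v ket3 N j k i)) +
     q j k \<cdot>\<^sub>v (p i k \<cdot>\<^sub>v (p k j \<cdot>\<^sub>v ket3 N i k j + q k j \<cdot>\<^sub>v ket3 N i j k) + q i k \<cdot>\<^sub>v (p i j \<cdot>\<^sub>v ket3 N k i j + q i j \<cdot>\<^sub>v ket3 N k j i))"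
    by (simp only: act ijk lin ket3_carrier cl c)
  show ?thesis
    unfolding STS TST 1 2
    by (simp only: index_add_vec index_smult_vec ket3_carrier t) (simp only: algebra_simps)
qed

lemma mat_eq_ket3I:
  assumes "A \<in> carrier_mat m (N * N * N)" "B \<in> carrier_mat m (N * N * N)"
    and "\<And>i j k. i \<in> {1..N} \<Longrightarrow> j \<in> {1..N} \<Longrightarrow> k \<in> {1..N} \<Longrightarrow> A *\<^sub>v ket3 N i j k = B *\<^sub>v ket3 N i j k"
  shows "A = B"
proof (rule mat_col_eqI)
  fix c assume "c < dim_col B"
  hence c: "c < N * N * N" using assms(2) by simp
  hence N: "N > 0" by (cases N) auto
  have c': "c div N < N * N" using c by (simp add: less_mult_imp_div_less)
  have ijk: "c div N div N + 1 \<in> {1..N}" "c div N mod N + 1 \<in> {1..N}" "c mod N + 1 \<in> {1..N}"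
    using c' N by (auto simp: less_mult_imp_div_less Suc_le_eq)
  have "ket3 N (c div N div N + 1) (c div N mod N + 1) (c mod N + 1) = unit_vec (N * N * N) c"
    unfolding ket3_eq_unit_vec[OF ijk] by (simp add: triple_index_def pair_index_def)
  thus "col A c = col B c"
    using assms(3)[OF ijk] mult_mat_unit_vec[OF assms(1) c] mult_mat_unit_vec[OF assms(2) c] by simp
qed (use assms in auto)

lemma braid_equation_iff_ybe:
  fixes p q :: "nat \<Rightarrow> nat \<Rightarrow> complex"
  assumes "diag0 N q"
  defines "S \<equiv> tensor_mat (pq_op N p q) (1\<^sub>m N)" and "T \<equiv> tensor_mat (1\<^sub>m N) (pq_op N p q)"
  shows "S * T * S = T * S * T \<longleftrightarrow> ybe N p q"
proof
  note key = braid_equation_ket3[of _ N _ _ _ p q, folded S_def T_def]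
  have ST: "S * T * S \<in> carrier_mat (N * N * N) (N * N * N)" "T * S * T \<in> carrier_mat (N * N * N) (N * N * N)"
    unfolding S_def T_def by (auto intro!: carrier_matI)
  {
    assume e: "S * T * S = T * S * T"
    show "ybe N p q"
      unfolding ybe_def
    proof (intro ballI)
      fix i j k assume ijk: "i \<in> {1..N}" "j \<in> {1..N}" "k \<in> {1..N}"
      let ?C1 = "p i j * p i j * p j k + p i k * (q i j * q j i) - (p i j * p j k * p j k + p i k * (q j k * q k j))"
      let ?C2 = "q i j * (p i j * p j k + p i k * p j i - p j k * p i k)"
      let ?C3 = "q j k * (p i j * p i k - p j k * p i j - p i k * p k j)"
      have 0: "0 = ?C1 * ket3 N i j k $ t + ?C2 * ket3 N j i k $ t + ?C3 * ket3 N i k j $ t" if "t < N * N * N" for t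
        using key[OF ijk that] unfolding e by simp
      have qd: "q j j = 0" "q k k = 0" using assms(1) ijk(2,3) unfolding diag0_def by blast+
      \<comment> \<open>At the index of |ijk> the vector |jik> contributes only if
        \<open>i = j\<close>, and then its coefficient contains \<open>q j j = 0\<close>. Likewise
        |ikj> contributes only if \<open>j = k\<close>. So the three coefficients separate even for
        repeated labels.\<close>
      have z2: "?C2 * ket3 N j i k $ triple_index N i j k = 0"
        by (cases "i = j") (simp_all only: qd ket3_index[OF ijk(2,1,3) ijk] mult_zero_left mult_zero_right simp_thms if_False)
      have z3: "?C3 * ket3 N i k j $ triple_index N i j k = 0"
        by (cases "j = k") (simp_all only: qd ket3_index[OF ijk(1,3,2) ijk] mult_zero_left mult_zero_right simp_thms if_False)
      have z1: "ket3 N i j k $ triple_index N i j k = 1"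
        by (simp only: ket3_index[OF ijk ijk] simp_thms if_True)
      have C1: "?C1 = 0" using 0[OF triple_index_props(3)[OF ijk]] unfolding z1 z2 z3 by simp
      moreover have "?C2 = 0"
      proof (cases "i = j")
        case True
        thus ?thesis using qd by simp
      next
        case False
        hence "ket3 N i k j $ triple_index N j i k = 0" "ket3 N j i k $ triple_index N j i k = 1"
          by (simp_all only: ket3_index[OF ijk(1,3,2) ijk(2,1,3)] ket3_index[OF ijk(2,1,3) ijk(2,1,3)] simp_thms if_True if_False eq_commute[of j])
        thus ?thesis using 0[OF triple_index_props(3)[OF ijk(2,1,3)]] unfolding C1 by simp
      qed
      moreover have "?C3 = 0"
      proof (cases "j = k")
        case True
        thus ?thesis using qd by simp
      next
        case False
        hence "ket3 N j i k $ triple_index N i k j = 0" "ket3 N i k j $ triple_index N i k j = 1"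
          by (simp_all only: ket3_index[OF ijk(2,1,3) ijk(1,3,2)] ket3_index[OF ijk(1,3,2) ijk(1,3,2)] simp_thms if_True if_False eq_commute[of k])
        thus ?thesis using 0[OF triple_index_props(3)[OF ijk(1,3,2)]] unfolding C1 by simp
      qed
      ultimately show "p i j * p i j * p j k + p i k * (q i j * q j i) = p i j * p j k * p j k + p i k * (q j k * q k j) \<and>
        ?C2 = 0 \<and> ?C3 = 0" by simp
    qed
  next
    assume y: "ybe N p q"
    show "S * T * S = T * S * T"
    proof (rule mat_eq_ket3I[OF ST])
      fix i j k assume ijk: "i \<in> {1..N}" "j \<in> {1..N}" "k \<in> {1..N}"
      note y' = y[unfolded ybe_def, rule_format, OF ijk]
      show "S * T * S *\<^sub>v ket3 N i j k = T * S * T *\<^sub>v ket3 N i j k"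
      proof (rule eq_vecI)
        fix t assume "t < dim_vec (T * S * T *\<^sub>v ket3 N i j k)"
        hence t: "t < N * N * N" using ST(2) by (metis carrier_matD(1) dim_mult_mat_vec)
        show "(S * T * S *\<^sub>v ket3 N i j k) $ t = (T * S * T *\<^sub>v ket3 N i j k) $ t"
          using key[OF ijk t] y' by simp
      qed (metis ST carrier_matD(1) dim_mult_mat_vec)
    qed
  }
qed

section \<open>X-equivalence and the action of permutations\<close>

lemma conj_pq_op_diagonal:
  assumes "\<forall>i\<in>{1..N}. \<forall>j\<in>{1..N}. x i j \<noteq> 0"
  shows "conj_mat (pq_op N x (\<lambda>_ _. 0)) (pq_op N p q) = pq_op N p (\<lambda>i j. x j i / x i j * q i j)"
proof -
  let ?B = "pq_op N (\<lambda>i j. 1 / x i j) (\<lambda>_ _. 0)"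
  have inv: "pq_op N x (\<lambda>_ _. 0) * ?B = 1\<^sub>m (N * N)" "?B * pq_op N x (\<lambda>_ _. 0) = 1\<^sub>m (N * N)"
    unfolding pq_op_mult pq_op_one using assms by (auto intro!: pq_op_cong)
  show ?thesis
    unfolding conj_mat_def the_mat_inverse[OF pq_op_carrier(1) pq_op_carrier(1) inv] pq_op_mult
    using assms by (auto intro!: pq_op_cong)
qed

lemma diagonal_mat_pq_op:
  assumes "X \<in> carrier_mat (N * N) (N * N)" "diagonal_mat X"
  shows "X = pq_op N (\<lambda>i j. X $$ (pair_index N i j, pair_index N i j)) (\<lambda>_ _. 0)"
proof (rule eq_pq_opI[OF assms(1)])
  fix i j assume ij: "i \<in> {1..N}" "j \<in> {1..N}"
  note m = pair_index_div_mod(3)[OF ij]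
  have "col X (pair_index N i j) = X $$ (pair_index N i j, pair_index N i j) \<cdot>\<^sub>v unit_vec (N * N) (pair_index N i j)"
    using assms m by (intro eq_vecI) (auto simp: diagonal_mat_def unit_vec_def)
  thus "X *\<^sub>v ket N i j = X $$ (pair_index N i j, pair_index N i j) \<cdot>\<^sub>v ket N i j + 0 \<cdot>\<^sub>v ket N j i"
    unfolding ket_eq_unit_vec[OF ij] mult_mat_unit_vec[OF assms(1) m] smult_ket_arith by simp
qed

lemma diagonal_pq_op: "diagonal_mat (pq_op N x (\<lambda>_ _. 0))"
  unfolding diagonal_mat_def
proof (intro allI impI)
  fix r c assume rc: "r < dim_row (pq_op N x (\<lambda>_ _. 0))" "c < dim_col (pq_op N x (\<lambda>_ _. 0))" "r \<noteq> c"
  hence rc': "r < N * N" "c < N * N" by simp_all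
  hence N: "N > 0" by (cases N) auto
  have ij: "c div N + 1 \<in> {1..N}" "c mod N + 1 \<in> {1..N}"
    using rc' N by (auto simp: less_mult_imp_div_less Suc_le_eq)
  have "pair_index N (c div N + 1) (c mod N + 1) = c" by (simp add: pair_index_def)
  hence "ket N (c div N + 1) (c mod N + 1) $ r = 0"
    using rc rc' unfolding ket_eq_unit_vec[OF ij] by simp
  thus "pq_op N x (\<lambda>_ _. 0) $$ (r, c) = 0"
    using rc' by (simp add: pq_op_def Let_def smult_ket_arith)
qed

lemma X_equiv_pq_op:
  "X_equiv N (pq_op N p q) R' \<longleftrightarrow> (\<exists>x. (\<forall>i\<in>{1..N}. \<forall>j\<in>{1..N}. x i j \<noteq> 0) \<and>
     R' = pq_op N p (\<lambda>i j. x j i / x i j * q i j))"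
proof
  assume "X_equiv N (pq_op N p q) R'"
  then obtain X where X: "X \<in> carrier_mat (N * N) (N * N)" "diagonal_mat X" "invertible_mat X"
    "R' = conj_mat X (pq_op N p q)" by (auto simp: X_equiv_def)
  define x where "x = (\<lambda>i j. X $$ (pair_index N i j, pair_index N i j))"
  have Xx: "X = pq_op N x (\<lambda>_ _. 0)" unfolding x_def by (rule diagonal_mat_pq_op[OF X(1,2)])
  have "diag0 N (\<lambda>_ _. 0)" by (simp add: diag0_def)
  hence nz: "\<forall>i\<in>{1..N}. \<forall>j\<in>{1..N}. x i j \<noteq> 0"
    using X(3) unfolding Xx by (subst (asm) pq_op_invertible) (simp, metis mult_eq_0_iff)
  show "\<exists>x. (\<forall>i\<in>{1..N}. \<forall>j\<in>{1..N}. x i j \<noteq> 0) \<and> R' = pq_op N p (\<lambda>i j. x j i / x i j * q i j)"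
    using nz X(4) conj_pq_op_diagonal[OF nz] unfolding Xx by blast
next
  assume "\<exists>x. (\<forall>i\<in>{1..N}. \<forall>j\<in>{1..N}. x i j \<noteq> 0) \<and> R' = pq_op N p (\<lambda>i j. x j i / x i j * q i j)"
  then obtain x where x: "\<forall>i\<in>{1..N}. \<forall>j\<in>{1..N}. x i j \<noteq> 0" "R' = pq_op N p (\<lambda>i j. x j i / x i j * q i j)" by blast
  have "diag0 N (\<lambda>_ _. 0)" by (simp add: diag0_def)
  hence "invertible_mat (pq_op N x (\<lambda>_ _. 0))" using x(1) by (simp add: pq_op_invertible)
  thus "X_equiv N (pq_op N p q) R'"
    unfolding X_equiv_def x(2) conj_pq_op_diagonal[OF x(1), symmetric]
    using diagonal_pq_op pq_op_carrier(1) by blast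
qed

text \<open>The zero pattern of \<open>q\<close> is a clause of its own because a vanishing product
  does not tell which of its factors vanishes.\<close>

definition xeq :: "nat \<Rightarrow> (nat \<Rightarrow> nat \<Rightarrow> complex) \<Rightarrow> (nat \<Rightarrow> nat \<Rightarrow> complex) \<Rightarrow>
    (nat \<Rightarrow> nat \<Rightarrow> complex) \<Rightarrow> (nat \<Rightarrow> nat \<Rightarrow> complex) \<Rightarrow> bool" where
  "xeq N p q p' q' \<longleftrightarrow> (\<forall>i\<in>{1..N}. \<forall>j\<in>{1..N}.
     p' i j = p i j \<and> q' i j * q' j i = q i j * q j i \<and> (q' i j = 0 \<longleftrightarrow> q i j = 0))"

lemma X_equiv_iff_xeq:
  assumes "diag0 N q"
  shows "X_equiv N (pq_op N p q) R' \<longleftrightarrow> (\<exists>p' q'. diag0 N q' \<and> xeq N p q p' q' \<and> R' = pq_op N p' q')"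
proof
  assume "X_equiv N (pq_op N p q) R'"
  then obtain x where x: "\<forall>i\<in>{1..N}. \<forall>j\<in>{1..N}. x i j \<noteq> 0" "R' = pq_op N p (\<lambda>i j. x j i / x i j * q i j)"
    unfolding X_equiv_pq_op by blast
  have "diag0 N (\<lambda>i j. x j i / x i j * q i j)" using assms by (simp add: diag0_def)
  moreover have "xeq N p q p (\<lambda>i j. x j i / x i j * q i j)" using x(1) by (auto simp: xeq_def)
  ultimately show "\<exists>p' q'. diag0 N q' \<and> xeq N p q p' q' \<and> R' = pq_op N p' q'" using x(2) by blast
next
  assume "\<exists>p' q'. diag0 N q' \<and> xeq N p q p' q' \<and> R' = pq_op N p' q'"
  then obtain p' q' where *: "diag0 N q'" "xeq N p q p' q'" "R' = pq_op N p' q'" by blast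
  \<comment> \<open>Only the ratio of \<open>x i j\<close> and \<open>x j i\<close> matters, so
    \<open>x\<close> is 1 for \<open>i \<le> j\<close>. For \<open>i > j\<close> it has to turn
    \<open>q j i\<close> into \<open>q' j i\<close>; if both of these vanish, \<open>q i j\<close>
    and \<open>q' i j\<close> fix it, and if these vanish too, any nonzero value does.\<close>
  define x where "x = (\<lambda>i j. if i \<le> j then 1 else if q j i \<noteq> 0 then q' j i / q j i
    else if q i j \<noteq> 0 then q i j / q' i j else 1 :: complex)"
  have nz: "\<forall>i\<in>{1..N}. \<forall>j\<in>{1..N}. x i j \<noteq> 0"
    using *(2) by (auto simp: x_def xeq_def)
  have "q' i j = x j i / x i j * q i j" if ij: "i \<in> {1..N}" "j \<in> {1..N}" for i j
  proof -
    have h: "q' i j * q' j i = q i j * q j i" "q' i j = 0 \<longleftrightarrow> q i j = 0" "q' j i = 0 \<longleftrightarrow> q j i = 0"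
      using *(2) ij by (auto simp: xeq_def)
    have d: "i = j \<Longrightarrow> q i j = 0" using assms ij by (auto simp: diag0_def)
    show ?thesis
      using h d by (cases i j rule: linorder_cases) (auto simp: x_def field_simps)
  qed
  hence "R' = pq_op N p (\<lambda>i j. x j i / x i j * q i j)"
    unfolding *(3) using *(2) by (intro pq_op_cong) (auto simp: xeq_def)
  thus "X_equiv N (pq_op N p q) R'" unfolding X_equiv_pq_op using nz by blast
qed

lemma xeq_sym: "xeq N p q p' q' \<Longrightarrow> xeq N p' q' p q"
  by (simp add: xeq_def)

lemma xeq_trans: "xeq N p q p' q' \<Longrightarrow> xeq N p' q' p'' q'' \<Longrightarrow> xeq N p q p'' q''"
  by (simp add: xeq_def)

lemma xeq_refl: "xeq N p q p q"
  by (simp add: xeq_def)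

definition cls :: "nat \<Rightarrow> (nat \<Rightarrow> nat \<Rightarrow> complex) \<Rightarrow> (nat \<Rightarrow> nat \<Rightarrow> complex) \<Rightarrow> complex mat set" where
  "cls N p q = {pq_op N p' q' | p' q'. diag0 N q' \<and> xeq N p q p' q'}"

lemma X_rel_class:
  assumes "diag0 N q"
  shows "X_rel N `` {pq_op N p q} = cls N p q"
  using assms by (auto simp: X_rel_def cls_def X_equiv_iff_xeq)

lemma cls_eqI:
  assumes "xeq N p q p' q'"
  shows "cls N p q = cls N p' q'"
  using assms unfolding cls_def by (blast intro: xeq_trans xeq_sym)

lemma cls_eqD:
  assumes "cls N p q = cls N p' q'" "diag0 N q"
  shows "xeq N p q p' q'"
proof -
  have "pq_op N p q \<in> cls N p' q'" using assms xeq_refl unfolding cls_def by blast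
  then obtain p'' q'' where *: "pq_op N p q = pq_op N p'' q''" "diag0 N q''" "xeq N p' q' p'' q''"
    unfolding cls_def by blast
  have "xeq N p q p'' q''" using pq_op_eqD[OF *(1) assms(2) *(2)] by (simp add: xeq_def)
  thus ?thesis using *(3) xeq_sym xeq_trans by blast
qed

section \<open>The action of permutations in coordinates\<close>

lemma perm_mat_unit_vec:
  assumes "w permutes {1..N}" "i \<in> {1..N}"
  shows "perm_mat N w *\<^sub>v unit_vec N (i - 1) = unit_vec N (w i - 1)"
proof -
  have P: "perm_mat N w \<in> carrier_mat N N" by (simp add: perm_mat_def)
  have i: "i - 1 < N" "i - 1 + 1 = i" using assms(2) by auto
  have wi: "w i \<in> {1..N}" using assms by (simp only: permutes_in_image)
  show ?thesis
    unfolding mult_mat_unit_vec[OF P i(1)]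
  proof (rule eq_vecI)
    fix r assume "r < dim_vec (unit_vec N (w i - 1) :: complex vec)"
    hence r: "r < N" by simp
    have "r + 1 = w i \<longleftrightarrow> r = w i - 1" using wi by auto
    thus "col (perm_mat N w) (i - 1) $ r = unit_vec N (w i - 1) $ r"
      using i r by (simp add: perm_mat_def unit_vec_def)
  qed (simp add: perm_mat_def)
qed

lemma tensor_perm_ket:
  assumes "w permutes {1..N}" "i \<in> {1..N}" "j \<in> {1..N}"
  shows "tensor_mat (perm_mat N w) (perm_mat N w) *\<^sub>v ket N i j = ket N (w i) (w j)"
proof -
  have P: "perm_mat N w \<in> carrier_mat N N" by (simp add: perm_mat_def)
  have i: "i - 1 < N" "j - 1 < N" using assms(2,3) by auto
  show ?thesis
    unfolding ket_def basis_vec_def tensor_mat_unit_vec[OF P P i]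
    by (simp only: perm_mat_unit_vec[OF assms(1,2)] perm_mat_unit_vec[OF assms(1,3)])
qed

text \<open>The inverse appears because the conjugated operator first carries |ij> back along
  \<open>w\<close>, applies R there, and then returns.\<close>

lemma perm_act_pq_op:
  assumes w: "w permutes {1..N}"
  shows "perm_act N w (pq_op N p q) = pq_op N (\<lambda>i j. p (inv_into UNIV w i) (inv_into UNIV w j)) (\<lambda>i j. q (inv_into UNIV w i) (inv_into UNIV w j))"
proof -
  define Q where "Q = tensor_mat (perm_mat N w) (perm_mat N w)"
  define B where "B = tensor_mat (perm_mat N (inv_into UNIV w)) (perm_mat N (inv_into UNIV w))"
  have w': "inv_into UNIV w permutes {1..N}" using w by (rule permutes_inv)
  have QB: "Q \<in> carrier_mat (N * N) (N * N)" "B \<in> carrier_mat (N * N) (N * N)"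
    unfolding Q_def B_def by (auto intro!: carrier_matI simp: perm_mat_def)
  have in_w: "w i \<in> {1..N}" "inv_into UNIV w i \<in> {1..N}" if "i \<in> {1..N}" for i
    using that permutes_in_image[OF w] permutes_in_image[OF w'] by blast+
  have wi: "w (inv_into UNIV w i) = i" "inv_into UNIV w (w i) = i" for i
    using permutes_inverses[OF w] by auto
  have Q: "Q *\<^sub>v ket N i j = ket N (w i) (w j)" and B: "B *\<^sub>v ket N i j = ket N (inv_into UNIV w i) (inv_into UNIV w j)"
    if "i \<in> {1..N}" "j \<in> {1..N}" for i j
    unfolding Q_def B_def by (rule tensor_perm_ket[OF w that], rule tensor_perm_ket[OF w' that])
  have "Q * B = 1\<^sub>m (N * N)"
    by (rule mat_eq_ketI[OF mult_carrier_mat[OF QB] one_carrier_mat])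
       (simp only: assoc_mult_mat_vec[OF QB ket_carrier(1)] Q B in_w wi one_mult_mat_vec[OF ket_carrier(1)])
  moreover have "B * Q = 1\<^sub>m (N * N)"
    by (rule mat_eq_ketI[OF mult_carrier_mat[OF QB(2,1)] one_carrier_mat])
       (simp only: assoc_mult_mat_vec[OF QB(2,1) ket_carrier(1)] Q B in_w wi one_mult_mat_vec[OF ket_carrier(1)])
  ultimately have inv: "the (mat_inverse Q) = B" by (rule the_mat_inverse[OF QB])
  show ?thesis
    unfolding perm_act_def Q_def[symmetric] conj_mat_def inv
  proof (rule eq_pq_opI)
    show "Q * pq_op N p q * B \<in> carrier_mat (N * N) (N * N)"
      using QB by (intro mult_carrier_mat[of _ _ "N * N"] pq_op_carrier(1))
    fix i j assume ij: "i \<in> {1..N}" "j \<in> {1..N}"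
    have "Q * pq_op N p q * B *\<^sub>v ket N i j = Q *\<^sub>v (pq_op N p q *\<^sub>v (B *\<^sub>v ket N i j))"
      using QB by (simp only: assoc_mult_mat_vec[of _ "N * N" "N * N" _ "N * N"]
          mult_carrier_mat[of _ "N * N" "N * N" _ "N * N"] mult_mat_vec_carrier[of _ "N * N" "N * N"] pq_op_carrier ket_carrier)
    also have "\<dots> = p (inv_into UNIV w i) (inv_into UNIV w j) \<cdot>\<^sub>v ket N i j + q (inv_into UNIV w i) (inv_into UNIV w j) \<cdot>\<^sub>v ket N j i"
      by (simp only: B ij pq_op_ket in_w mult_mat_vec_lincomb[OF QB(1) ket_carrier(1) ket_carrier(1)] Q wi)
    finally show "Q * pq_op N p q * B *\<^sub>v ket N i j =
      p (inv_into UNIV w i) (inv_into UNIV w j) \<cdot>\<^sub>v ket N i j + q (inv_into UNIV w i) (inv_into UNIV w j) \<cdot>\<^sub>v ket N j i" .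
  qed
qed

section \<open>Nation structures\<close>

definition conn :: "(nat \<Rightarrow> nat \<Rightarrow> bool) \<Rightarrow> nat \<Rightarrow> nat \<Rightarrow> bool" where
  "conn L i j \<longleftrightarrow> L i j \<or> L j i"

definition strict :: "(nat \<Rightarrow> nat \<Rightarrow> bool) \<Rightarrow> nat \<Rightarrow> nat \<Rightarrow> bool" where
  "strict L i j \<longleftrightarrow> L i j \<and> \<not> L j i"

text \<open>
  An element of $\mathfrak S_N$ as a pair of relations on \<open>{1..N}\<close>: \<open>L i j\<close> if \<open>i\<close> and \<open>j\<close> are in the
  same nation and the county of \<open>i\<close> does not come after that of \<open>j\<close>, and \<open>S i j\<close> if they are in the
  same nation and their counties have the same shade.
\<close>

definition nation_structure :: "nat \<Rightarrow> (nat \<Rightarrow> nat \<Rightarrow> bool) \<Rightarrow> (nat \<Rightarrow> nat \<Rightarrow> bool) \<Rightarrow> bool" where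
  "nation_structure N L S \<longleftrightarrow> (\<forall>i\<in>{1..N}. L i i \<and> S i i) \<and>
     (\<forall>i\<in>{1..N}. \<forall>j\<in>{1..N}. (S i j \<longrightarrow> conn L i j \<and> S j i) \<and> (L i j \<and> L j i \<longrightarrow> S i j)) \<and>
     (\<forall>i\<in>{1..N}. \<forall>j\<in>{1..N}. \<forall>k\<in>{1..N}.
        (L i j \<and> L j k \<longrightarrow> L i k) \<and> (conn L i j \<and> conn L j k \<longrightarrow> conn L i k) \<and>
        (S i j \<and> S j k \<longrightarrow> S i k) \<and> (conn L i j \<and> conn L j k \<longrightarrow> S i j \<or> S j k \<or> S i k))"

text \<open>The quadratic equations say that \<open>p i i\<close> and \<open>p j j\<close> are
  eigenvalues of the block on |ij>, |ji>, whose other diagonal entry is 0. Labels of different shade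
  carry both roots of the characteristic polynomial, hence the clause on their sum. If the roots
  coincide, this clause agrees with equality of the diagonal values, and the same
  \<open>(p, q)\<close> realises several \<open>S\<close>.\<close>

definition realises :: "nat \<Rightarrow> (nat \<Rightarrow> nat \<Rightarrow> bool) \<Rightarrow> (nat \<Rightarrow> nat \<Rightarrow> bool) \<Rightarrow>
    (nat \<Rightarrow> nat \<Rightarrow> complex) \<Rightarrow> (nat \<Rightarrow> nat \<Rightarrow> complex) \<Rightarrow> bool" where
  "realises N L S p q \<longleftrightarrow> (\<forall>i\<in>{1..N}. p i i \<noteq> 0) \<and>
     (\<forall>i\<in>{1..N}. \<forall>j\<in>{1..N}.
        (\<not> conn L i j \<longrightarrow> p i j = 0 \<and> q i j \<noteq> 0) \<and>
        (L i j \<and> L j i \<and> i \<noteq> j \<longrightarrow> p i j = p i i \<and> q i j = 0) \<and>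
        (strict L i j \<longrightarrow> p i j \<noteq> 0 \<and> p j i = 0 \<and> q i j \<noteq> 0 \<and> q j i \<noteq> 0 \<and>
          p i i * p i i = p i j * p i i + q i j * q j i \<and> p j j * p j j = p i j * p j j + q i j * q j i) \<and>
        (S i j \<longrightarrow> p i i = p j j) \<and>
        (strict L i j \<and> \<not> S i j \<longrightarrow> p i i + p j j = p i j)) \<and>
     (\<forall>i\<in>{1..N}. \<forall>j\<in>{1..N}. \<forall>k\<in>{1..N}.
        conn L i j \<and> \<not> conn L i k \<longrightarrow> q i k * q k i = q j k * q k j) \<and>
     (\<forall>i\<in>{1..N}. \<forall>j\<in>{1..N}. \<forall>k\<in>{1..N}. \<forall>l\<in>{1..N}.
        strict L i j \<and> strict L k l \<and> conn L i k \<longrightarrow> p i j = p k l)"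

definition nonsingular :: "nat \<Rightarrow> (nat \<Rightarrow> nat \<Rightarrow> complex) \<Rightarrow> (nat \<Rightarrow> nat \<Rightarrow> complex) \<Rightarrow> bool" where
  "nonsingular N p q \<longleftrightarrow> (\<forall>i\<in>{1..N}. p i i \<noteq> 0) \<and>
     (\<forall>i\<in>{1..N}. \<forall>j\<in>{1..N}. i \<noteq> j \<longrightarrow> p i j * p j i \<noteq> q i j * q j i)"

lemma conn_sym: "conn L i j \<longleftrightarrow> conn L j i"
  by (auto simp: conn_def)

lemma nation_structureD:
  assumes "nation_structure N L S" "i \<in> {1..N}" "j \<in> {1..N}" "k \<in> {1..N}"
  shows "L i i" "S i i" "S i j \<Longrightarrow> conn L i j" "S i j \<Longrightarrow> S j i" "L i j \<Longrightarrow> L j i \<Longrightarrow> S i j"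
    "L i j \<Longrightarrow> L j k \<Longrightarrow> L i k" "conn L i j \<Longrightarrow> conn L j k \<Longrightarrow> conn L i k"
    "S i j \<Longrightarrow> S j k \<Longrightarrow> S i k" "conn L i j \<Longrightarrow> conn L j k \<Longrightarrow> S i j \<or> S j k \<or> S i k"
  using assms unfolding nation_structure_def by blast+

lemma realisesD:
  assumes "realises N L S p q" "i \<in> {1..N}" "j \<in> {1..N}"
  shows "p i i \<noteq> 0" "\<not> conn L i j \<Longrightarrow> p i j = 0" "\<not> conn L i j \<Longrightarrow> q i j \<noteq> 0"
    "L i j \<Longrightarrow> L j i \<Longrightarrow> i \<noteq> j \<Longrightarrow> p i j = p i i" "L i j \<Longrightarrow> L j i \<Longrightarrow> i \<noteq> j \<Longrightarrow> q i j = 0"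
    "strict L i j \<Longrightarrow> p i j \<noteq> 0" "strict L i j \<Longrightarrow> p j i = 0" "strict L i j \<Longrightarrow> q i j \<noteq> 0" "strict L i j \<Longrightarrow> q j i \<noteq> 0"
    "strict L i j \<Longrightarrow> p i i * p i i = p i j * p i i + q i j * q j i"
    "strict L i j \<Longrightarrow> p j j * p j j = p i j * p j j + q i j * q j i"
    "S i j \<Longrightarrow> p i i = p j j" "strict L i j \<Longrightarrow> \<not> S i j \<Longrightarrow> p i i + p j j = p i j"
  using assms unfolding realises_def by blast+

lemma realisesD3:
  assumes "realises N L S p q" "i \<in> {1..N}" "j \<in> {1..N}" "k \<in> {1..N}"
  shows "conn L i j \<Longrightarrow> \<not> conn L i k \<Longrightarrow> q i k * q k i = q j k * q k j"
  using assms unfolding realises_def by blast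

lemma realisesD4:
  assumes "realises N L S p q" "i \<in> {1..N}" "j \<in> {1..N}" "k \<in> {1..N}" "l \<in> {1..N}"
  shows "strict L i j \<Longrightarrow> strict L k l \<Longrightarrow> conn L i k \<Longrightarrow> p i j = p k l"
  using assms unfolding realises_def by blast

text \<open>\<open>realises\<close> makes only \<open>P\<close> constant. Constancy of the products
  follows from the diagonal: starting from one strict pair \<open>(a, b)\<close>, each
  \<open>p x x\<close> of the nation is shown to be a root of the same quadratic, and conversely the
  root \<open>p x x\<close> together with \<open>P\<close> fixes \<open>q x y * q y x\<close>. A
  nation with a single county has no strict pair, so there the clause containing \<open>P\<close>
  and \<open>Q\<close> is vacuous.\<close>

lemma realises_nation_constants:
  assumes s: "nation_structure N L S" and r: "realises N L S p q" and d: "diag0 N q" and n: "n \<in> {1..N}"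
  obtains P Q where
    "\<And>x y. x \<in> {1..N} \<Longrightarrow> y \<in> {1..N} \<Longrightarrow> conn L n x \<Longrightarrow> conn L n y \<Longrightarrow>
       (L x y \<or> L y x) \<and>
       (L x y \<and> L y x \<longrightarrow> p x y = p x x \<and> p x x = p y y \<and> q x y = 0) \<and>
       (L x y \<and> \<not> L y x \<longrightarrow> p x y = P \<and> p y x = 0 \<and> q x y * q y x = Q \<and> p x x * p x x = P * p x x + Q \<and> p y y * p y y = P * p y y + Q)"
proof (cases "\<exists>a\<in>{1..N}. \<exists>b\<in>{1..N}. conn L n a \<and> strict L a b")
  case True
  then obtain a b where ab: "a \<in> {1..N}" "b \<in> {1..N}" "conn L n a" "strict L a b" by blast
  let ?P = "p a b" and ?Q = "q a b * q b a"
  have conn2: "conn L x y" if "x \<in> {1..N}" "y \<in> {1..N}" "conn L n x" "conn L n y" for x y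
    using nation_structureD(7)[OF s that(1) n that(2)] that conn_sym[of L] by blast
  have root_a: "p a a * p a a = ?P * p a a + ?Q" "p b b * p b b = ?P * p b b + ?Q"
    using realisesD(10,11)[OF r ab(1,2,4)] by auto
  have root: "p x x * p x x = ?P * p x x + ?Q" if x: "x \<in> {1..N}" "conn L n x" for x
  proof (cases "L a x \<and> L x a")
    case True
    hence "p a a = p x x" using nation_structureD(5)[OF s ab(1) x(1) n] realisesD(12)[OF r ab(1) x(1)] by blast
    thus ?thesis using root_a by simp
  next
    case False
    hence "strict L a x \<or> strict L x a" using conn2[OF ab(1) x(1) ab(3) x(2)] by (auto simp: conn_def strict_def)
    thus ?thesis
    proof
      assume *: "strict L a x"
      have P: "p a x = ?P" using realisesD4[OF r ab(1) x(1) ab(1,2) * ab(4)] nation_structureD(1)[OF s ab(1) n n] by (simp add: conn_def)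
      show ?thesis using realisesD(10,11)[OF r ab(1) x(1) *] root_a unfolding P by simp
    next
      assume *: "strict L x a"
      have P: "p x a = ?P" using realisesD4[OF r x(1) ab(1) ab(1,2) * ab(4)] * by (simp add: conn_def strict_def)
      show ?thesis using realisesD(10,11)[OF r x(1) ab(1) *] root_a unfolding P by simp
    qed
  qed
  show ?thesis
  proof (rule that[of ?P ?Q], intro conjI impI)
    fix x y assume x: "x \<in> {1..N}" and y: "y \<in> {1..N}" and c: "conn L n x" "conn L n y"
    show "L x y \<or> L y x" using conn2[OF x y c] by (simp add: conn_def)
    { assume *: "L x y \<and> L y x"
      show "p x x = p y y" using realisesD(12)[OF r x y] nation_structureD(5)[OF s x y n] * by blast
      show "p x y = p x x" using realisesD(4)[OF r x y] * by (cases "x = y") auto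
      show "q x y = 0" using realisesD(5)[OF r x y] * d x by (cases "x = y") (auto simp: diag0_def) }
    { assume "L x y \<and> \<not> L y x"
      hence *: "strict L x y" by (simp add: strict_def)
      show P: "p x y = ?P" using realisesD4[OF r x y ab(1,2) * ab(4) conn2[OF x ab(1) c(1) ab(3)]] .
      show "p y x = 0" using realisesD(7)[OF r x y *] .
      show "q x y * q y x = ?Q" using realisesD(10)[OF r x y *] root[OF x c(1)] unfolding P by simp
      show "p x x * p x x = ?P * p x x + ?Q" "p y y * p y y = ?P * p y y + ?Q" using root x y c by auto }
  qed
next
  case False
  show ?thesis
  proof (rule that, intro conjI impI)
    fix x y assume x: "x \<in> {1..N}" and y: "y \<in> {1..N}" and c: "conn L n x" "conn L n y"
    show "L x y \<or> L y x" using nation_structureD(7)[OF s x n y] c conn_sym[of L] by (auto simp: conn_def)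
    { assume *: "L x y \<and> L y x"
      show "p x x = p y y" using realisesD(12)[OF r x y] nation_structureD(5)[OF s x y n] * by blast
      show "p x y = p x x" using realisesD(4)[OF r x y] * by (cases "x = y") auto
      show "q x y = 0" using realisesD(5)[OF r x y] * d x by (cases "x = y") (auto simp: diag0_def) }
    { assume *: "L x y \<and> \<not> L y x"
      hence F: False using False x y c by (auto simp: strict_def)
      show "p x y = 0" "p y x = 0" "q x y * q y x = 0" "p x x * p x x = 0 * p x x + 0"
        "p y y * p y y = 0 * p y y + 0" using F by simp_all }
  qed
qed

text \<open>If the three labels are not all in one nation, the vanishing of \<open>p\<close> between
  nations settles everything, except when \<open>i\<close> and \<open>k\<close> are together and
  \<open>j\<close> is foreign; that case is the constancy of the products between two nations.
  Inside a nation there are nine cases: each of the pairs \<open>i, j\<close> and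
  \<open>j, k\<close> is in one county, ascending or descending.\<close>

lemma realises_ybe:
  assumes s: "nation_structure N L S" and r: "realises N L S p q" and d: "diag0 N q"
  shows "ybe N p q"
  unfolding ybe_def
proof (intro ballI)
  fix i j k assume ijk: "i \<in> {1..N}" "j \<in> {1..N}" "k \<in> {1..N}"
  let ?goal = "p i j * p i j * p j k + p i k * (q i j * q j i) = p i j * p j k * p j k + p i k * (q j k * q k j) \<and>
     q i j * (p i j * p j k + p i k * p j i - p j k * p i k) = 0 \<and>
     q j k * (p i j * p i k - p j k * p i j - p i k * p k j) = 0"
  note ct = nation_structureD(7)[OF s]
  note p0 = realisesD(2)[OF r]
  show ?goal
  proof (cases "conn L i j")
    case True
    note ij = True
    show ?goal
    proof (cases "conn L j k")
      case True
      hence ik: "conn L i k" using ct[OF ijk] ij by blast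
      have ii: "conn L i i" using nation_structureD(1)[OF s ijk(1) ijk(1,1)] by (simp add: conn_def)
      obtain P Q where PQ: "\<And>x y. x \<in> {1..N} \<Longrightarrow> y \<in> {1..N} \<Longrightarrow> conn L i x \<Longrightarrow> conn L i y \<Longrightarrow>
         (L x y \<or> L y x) \<and>
         (L x y \<and> L y x \<longrightarrow> p x y = p x x \<and> p x x = p y y \<and> q x y = 0) \<and>
         (L x y \<and> \<not> L y x \<longrightarrow> p x y = P \<and> p y x = 0 \<and> q x y * q y x = Q \<and> p x x * p x x = P * p x x + Q \<and> p y y * p y y = P * p y y + Q)"
        using realises_nation_constants[OF s r d ijk(1)] by blast
      define V where "V = {i, j, k}"
      have V: "i \<in> V" "j \<in> V" "k \<in> V" by (auto simp: V_def)
      have Vn: "x \<in> {1..N}" "conn L i x" if "x \<in> V" for x using that ijk ii ij ik by (auto simp: V_def)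
      have lt: "p x y = P" "p y x = 0" "q x y * q y x = Q" "q y x * q x y = Q" if "x \<in> V" "y \<in> V" "L x y" "\<not> L y x" for x y
        using PQ[OF Vn(1)[OF that(1)] Vn(1)[OF that(2)] Vn(2)[OF that(1)] Vn(2)[OF that(2)]] that(3,4) mult.commute[of "q y x"]
        by metis+
      have eq: "p x y = p x x" "p x x = p y y" "q x y = 0" if "x \<in> V" "y \<in> V" "L x y" "L y x" for x y
        using PQ[OF Vn(1)[OF that(1)] Vn(1)[OF that(2)] Vn(2)[OF that(1)] Vn(2)[OF that(2)]] that(3,4)
        by blast+
      \<comment> \<open>Used when one of \<open>i\<close> and \<open>k\<close> shares the county of
        \<open>j\<close> and the other does not. The first braid relation is then either trivial or
        \<open>P\<close> times this equation.\<close>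
      have root: "p j j * p j j = P * p j j + Q" if "x \<in> V" "L x j \<and> \<not> L j x \<or> L j x \<and> \<not> L x j" for x
        using PQ[OF Vn(1)[OF that(1)] ijk(2) Vn(2)[OF that(1)] ij] PQ[OF ijk(2) Vn(1)[OF that(1)] ij Vn(2)[OF that(1)]] that(2)
        by blast
      have tot: "L x y \<or> L y x" if "x \<in> V" "y \<in> V" for x y
        using PQ[OF Vn(1)[OF that(1)] Vn(1)[OF that(2)] Vn(2)[OF that(1)] Vn(2)[OF that(2)]] by blast
      have zero: "p x y = 0" if "x \<in> V" "y \<in> V" "\<not> L x y" for x y
        using lt(2)[OF that(2,1)] tot[OF that(1,2)] that(3) by blast
      have tr: "L x z" if "x \<in> V" "y \<in> V" "z \<in> V" "L x y" "L y z" for x y z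
        using nation_structureD(6)[OF s] Vn(1) that by blast
      consider "L i j" "L j i" | "L i j" "\<not> L j i" | "\<not> L i j" "L j i" using tot V by blast
      note c1 = this
      consider "L j k" "L k j" | "L j k" "\<not> L k j" | "\<not> L j k" "L k j" using tot V by blast
      note c2 = this
      have "p i j * p i j * p j k + p i k * (q i j * q j i) = p i j * p j k * p j k + p i k * (q j k * q k j)"
        using c1
      proof cases
        case 1
        note ij = 1 eq[OF V(1,2) 1]
        show ?thesis
          using c2
        proof cases
          case 1
          show ?thesis using ij eq[OF V(2,3) 1] by simp
        next
          case 2
          have "L i k" "\<not> L k i" using tr V ij 2 by blast+
          hence "p i k = P" by (rule lt(1)[OF V(1,3)])
          moreover have "p j j * p j j = P * p j j + Q" using root[OF V(3)] 2 by blast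
          ultimately show ?thesis using ij(3-5) lt(1,3)[OF V(2,3) 2] by (simp add: algebra_simps)
        next
          case 3
          have "\<not> L i k" using tr V ij 3 by blast
          thus ?thesis using zero V 3 by simp
        qed
      next
        case 2
        note ij = 2 lt[OF V(1,2) 2]
        show ?thesis
          using c2
        proof cases
          case 1
          have "L i k" "\<not> L k i" using tr V ij 1 by blast+
          hence "p i k = P" by (rule lt(1)[OF V(1,3)])
          moreover have "p j j * p j j = P * p j j + Q" using root[OF V(1)] 2 by blast
          ultimately show ?thesis using ij(3-5) eq[OF V(2,3) 1] by (simp add: algebra_simps)
        next
          case 2
          show ?thesis using ij(3-5) lt(1,3)[OF V(2,3) 2] by simp
        next
          case 3
          show ?thesis using ij(3-5) lt(2,4)[OF V(3,2) 3(2,1)] by simp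
        qed
      next
        case 3
        note ij = 3 lt[OF V(2,1) 3(2,1)]
        show ?thesis
          using c2
        proof cases
          case 1
          have "\<not> L i k" using tr V ij 1 by blast
          thus ?thesis using zero V ij by simp
        next
          case 2
          show ?thesis using ij(4,6) lt(1,3)[OF V(2,3) 2] by simp
        next
          case 3
          show ?thesis using ij(4,6) lt(2,4)[OF V(3,2) 3(2,1)] by simp
        qed
      qed
      moreover have "q i j * (p i j * p j k + p i k * p j i - p j k * p i k) = 0"
        using c1
      proof cases
        case 1
        thus ?thesis using eq(3)[OF V(1,2) 1] by simp
      next
        case 2
        have "p j k = 0 \<or> p i k = P"
          using zero[OF V(2,3)] lt(1)[OF V(1,3)] tr[OF V(1,2,3)] tr[OF V(2,3,1)] 2 by blast
        thus ?thesis using lt[OF V(1,2) 2] by auto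
      next
        case 3
        have "p i k = 0 \<or> p j k = P"
          using zero[OF V(1,3)] lt(1)[OF V(2,3)] tr[OF V(2,1,3)] tr[OF V(1,3,2)] 3 by blast
        thus ?thesis using lt[OF V(2,1) 3(2,1)] by auto
      qed
      moreover have "q j k * (p i j * p i k - p j k * p i j - p i k * p k j) = 0"
        using c2
      proof cases
        case 1
        thus ?thesis using eq(3)[OF V(2,3) 1] by simp
      next
        case 2
        have "p i j = 0 \<or> p i k = P"
          using zero[OF V(1,2)] lt(1)[OF V(1,3)] tr[OF V(1,2,3)] tr[OF V(3,1,2)] 2 by blast
        thus ?thesis using lt[OF V(2,3) 2] by auto
      next
        case 3
        have "p i k = 0 \<or> p i j = P"
          using zero[OF V(1,3)] lt(1)[OF V(1,2)] tr[OF V(1,3,2)] tr[OF V(2,1,3)] 3 by blast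
        thus ?thesis using lt[OF V(3,2) 3(2,1)] by auto
      qed
      ultimately show ?goal by blast
    next
      case False
      hence "\<not> conn L i k" using ct[OF ijk(2,1,3)] ij conn_sym[of L] by blast
      thus ?goal using False p0 ijk conn_sym[of L] by simp
    qed
  next
    case False
    note ij = False
    show ?goal
    proof (cases "conn L i k")
      case True
      hence "\<not> conn L j k" using ct[OF ijk(1,3,2)] ij conn_sym[of L] by blast
      thus ?goal using ij p0 ijk conn_sym[of L] realisesD3[OF r ijk(1,3,2)] True by (simp add: mult.commute)
    next
      case False
      thus ?goal using ij p0 ijk conn_sym[of L] by simp
    qed
  qed
qed

lemma realises_nonsingular:
  assumes s: "nation_structure N L S" and r: "realises N L S p q"
  shows "nonsingular N p q"
  unfolding nonsingular_def
proof (intro conjI ballI impI)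
  fix i j assume ij: "i \<in> {1..N}" "j \<in> {1..N}" "i \<noteq> j"
  note i = realisesD[OF r ij(1,2)] and j = realisesD[OF r ij(2,1)]
  consider "\<not> conn L i j" | "strict L i j" | "strict L j i" | "L i j" "L j i" by (auto simp: conn_def strict_def)
  thus "p i j * p j i \<noteq> q i j * q j i"
  proof cases
    case 1 thus ?thesis using i j by (simp add: conn_sym[of L j i])
  next
    case 2 thus ?thesis using i by simp
  next
    case 3 thus ?thesis using j by simp
  next
    case 4 thus ?thesis using i j ij by simp
  qed
qed (use realisesD(1)[OF r] in blast)

section \<open>The structure of a solution\<close>

definition rep_le :: "(nat \<Rightarrow> nat \<Rightarrow> complex) \<Rightarrow> nat \<Rightarrow> nat \<Rightarrow> bool" where
  "rep_le p i j \<longleftrightarrow> i = j \<or> p i j \<noteq> 0"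

text \<open>When the eigenvalues of a nation coincide, this puts all its counties into one part,
  which is one choice among the shadings that fit.\<close>

definition rep_shade :: "(nat \<Rightarrow> nat \<Rightarrow> complex) \<Rightarrow> nat \<Rightarrow> nat \<Rightarrow> bool" where
  "rep_shade p i j \<longleftrightarrow> conn (rep_le p) i j \<and> p i i = p j j"

locale ybe_solution =
  fixes N p q
  assumes ybe_pq: "ybe N p q" and nonsing: "nonsingular N p q" and diag0_q: "diag0 N q"
begin

lemma relations:
  assumes "i \<in> {1..N}" "j \<in> {1..N}" "k \<in> {1..N}"
  shows "p i j * p i j * p j k + p i k * (q i j * q j i) = p i j * p j k * p j k + p i k * (q j k * q k j)"
    "q i j * (p i j * p j k + p i k * p j i - p j k * p i k) = 0"
    "q j k * (p i j * p i k - p j k * p i j - p i k * p k j) = 0"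
  using ybe_pq assms unfolding ybe_def by blast+

text \<open>The braid relations on triples with a repeated label. \<open>(i, i, j)\<close> and
  \<open>(i, j, j)\<close> give the two eigenvalue equations after cancelling \<open>p i j\<close>;
  \<open>(i, j, i)\<close> reads \<open>q i j * p i j * p j i = 0\<close>, and with
  \<open>q i j = 0\<close> the eigenvalue equations identify all values of \<open>p\<close> on the
  pair.\<close>

lemma pair_relations:
  assumes ij: "i \<in> {1..N}" "j \<in> {1..N}"
  shows "p i j \<noteq> 0 \<Longrightarrow> p i i * p i i = p i j * p i i + q i j * q j i"
    "p i j \<noteq> 0 \<Longrightarrow> p j j * p j j = p i j * p j j + q i j * q j i"
    "p i j \<noteq> 0 \<Longrightarrow> p j i \<noteq> 0 \<Longrightarrow> q i j = 0 \<and> p i j = p j i \<and> p i j = p i i \<and> p i i = p j j"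
    "i \<noteq> j \<Longrightarrow> p i j = 0 \<Longrightarrow> q i j \<noteq> 0 \<and> q j i \<noteq> 0" "p i i \<noteq> 0"
proof -
  have q0: "q i i = 0" "q j j = 0" using diag0_q ij by (auto simp: diag0_def)
  show 1: "p i i * p i i = p i j * p i i + q i j * q j i" if "p i j \<noteq> 0"
  proof -
    have "p i j * (p i i * p i i) = p i j * (p i j * p i i + q i j * q j i)"
      using relations(1)[OF ij(1,1,2)] q0 by (simp add: algebra_simps)
    thus ?thesis using that by simp
  qed
  show "p j j * p j j = p i j * p j j + q i j * q j i" if "p i j \<noteq> 0"
  proof -
    have "p i j * (p j j * p j j) = p i j * (p i j * p j j + q i j * q j i)"
      using relations(1)[OF ij(1,2,2)] q0 by (simp add: algebra_simps)
    thus ?thesis using that by simp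
  qed
  note 2 = this
  show nz: "p i i \<noteq> 0" using nonsing ij by (simp add: nonsingular_def)
  have nzj: "p j j \<noteq> 0" using nonsing ij by (simp add: nonsingular_def)
  show "q i j \<noteq> 0 \<and> q j i \<noteq> 0" if "i \<noteq> j" "p i j = 0"
  proof -
    have "p i j * p j i \<noteq> q i j * q j i" using nonsing ij that(1) unfolding nonsingular_def by blast
    thus ?thesis using that(2) by auto
  qed
  show "q i j = 0 \<and> p i j = p j i \<and> p i j = p i i \<and> p i i = p j j" if nz2: "p i j \<noteq> 0" "p j i \<noteq> 0"
  proof -
    have q: "q i j = 0" using relations(2)[OF ij ij(1)] nz2 by (auto simp: algebra_simps)
    have "p j i \<noteq> 0 \<Longrightarrow> p j j * p j j = p j i * p j j + q j i * q i j"
    proof -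
      have "p j i * (p j j * p j j) = p j i * (p j i * p j j + q j i * q i j)"
        using relations(1)[OF ij(2,2,1)] q0 by (simp add: algebra_simps)
      thus ?thesis using nz2 by simp
    qed
    hence "p j j = p j i" using q nz2 nzj by simp
    moreover have "p i i = p i j" using 1[OF nz2(1)] q nz by simp
    moreover have "p j j = p i j" using 2[OF nz2(1)] q nzj by simp
    ultimately show ?thesis using q by simp
  qed
qed

text \<open>If \<open>p i k\<close> and \<open>p k i\<close> vanish, then \<open>q i k\<close> and
  \<open>q k i\<close> do not. The relations then exclude that \<open>i\<close> and \<open>k\<close>
  both point to \<open>j\<close>, or that \<open>j\<close> points to both. What is left is a chain
  through \<open>j\<close>, and the second relation along it makes a \<open>q\<close> vanish that
  nonsingularity keeps nonzero.\<close>

lemma conn_trans: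
  assumes ijk: "i \<in> {1..N}" "j \<in> {1..N}" "k \<in> {1..N}"
    and c: "conn (rep_le p) i j" "conn (rep_le p) j k"
  shows "conn (rep_le p) i k"
proof (rule ccontr)
  assume n: "\<not> conn (rep_le p) i k"
  hence ik: "i \<noteq> k" "p i k = 0" "p k i = 0" by (auto simp: conn_def rep_le_def)
  have c': "p i j \<noteq> 0 \<or> p j i \<noteq> 0" "p j k \<noteq> 0 \<or> p k j \<noteq> 0" "i \<noteq> j" "j \<noteq> k"
    using c n by (auto simp: conn_def rep_le_def)
  have q: "q i k \<noteq> 0" using pair_relations(4)[OF ijk(1,3) ik(1,2)] by simp
  have 1: "p k j = 0 \<or> p i j = 0" using relations(2)[OF ijk(1,3,2)] ik q by simp
  have 2: "p j i = 0 \<or> p j k = 0" using relations(3)[OF ijk(2,1,3)] ik q by simp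
  have 3: "q i j = 0 \<or> p i j = 0 \<or> p j k = 0" using relations(2)[OF ijk] ik by simp
  have 4: "q k j = 0 \<or> p k j = 0 \<or> p j i = 0" using relations(2)[OF ijk(3,2,1)] ik by simp
  show False
    using 1 2 3 4 c' pair_relations(4)[OF ijk(2,1)] pair_relations(4)[OF ijk(2,3)] by metis
qed

text \<open>If \<open>p i k = 0\<close>, connectedness gives \<open>p k i \<noteq> 0\<close>, and
  the second relation forces \<open>q i j = 0\<close>, so \<open>i\<close> and \<open>j\<close>
  behave as one county. The third relation then gives \<open>p k i = p i i\<close>, and the
  eigenvalue equation for the pair \<open>k, i\<close> makes \<open>q k i * q i k\<close> vanish,
  against nonsingularity.\<close>

lemma le_trans:
  assumes ijk: "i \<in> {1..N}" "j \<in> {1..N}" "k \<in> {1..N}"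
    and c: "rep_le p i j" "rep_le p j k"
  shows "rep_le p i k"
proof (rule ccontr)
  assume n: "\<not> rep_le p i k"
  hence ik: "i \<noteq> k" "p i k = 0" by (auto simp: rep_le_def)
  have c': "p i j \<noteq> 0" "p j k \<noteq> 0" using c n by (auto simp: rep_le_def)
  have q: "q i k \<noteq> 0" "q k i \<noteq> 0" using pair_relations(4)[OF ijk(1,3) ik(1,2)] by auto
  have "conn (rep_le p) i k"
    by (rule conn_trans[OF ijk]) (use c in \<open>auto simp: conn_def\<close>)
  hence ki: "p k i \<noteq> 0" using ik by (auto simp: conn_def rep_le_def)
  have "q i j = 0" using relations(2)[OF ijk] ik c' by simp
  hence ij: "p j i \<noteq> 0" using pair_relations(4)[OF ijk(2,1)] c' by (cases "i = j") auto
  have e: "p i j = p j i" "p i j = p i i" using pair_relations(3)[OF ijk(1,2) c'(1) ij] by auto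
  have "p j i * p j k = p j k * p k i" using relations(3)[OF ijk(2,1,3)] ik q by simp
  hence "p k i = p i i" using c'(2) e by (simp add: mult.commute)
  moreover have "p i i * p i i = p k i * p i i + q k i * q i k"
    using pair_relations(2)[OF ijk(3,1) ki] .
  ultimately show False using q by simp
qed

lemma strict_chain:
  assumes ijk: "i \<in> {1..N}" "j \<in> {1..N}" "k \<in> {1..N}"
    and c: "strict (rep_le p) i j" "strict (rep_le p) j k"
  shows "p i j = p i k" "p i k = p j k"
proof -
  have c': "p i j \<noteq> 0" "p j i = 0" "p j k \<noteq> 0" "p k j = 0" "i \<noteq> j" "j \<noteq> k" using c by (auto simp: strict_def rep_le_def)
  have q: "q i j \<noteq> 0" "q j k \<noteq> 0"
    using pair_relations(4)[OF ijk(2,1)] pair_relations(4)[OF ijk(3,2)] c' by auto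
  have "p i j * p j k = p j k * p i k" "p i j * p i k = p j k * p i j"
    using relations(2,3)[OF ijk] c' q by auto
  thus "p i j = p i k" "p i k = p j k" using c' by (auto simp: mult.commute)
qed

text \<open>Two targets of one source are comparable by \<open>conn_trans\<close>. Unless they share
  a county, one of them lies on a chain to the other, where \<open>strict_chain\<close>
  applies.\<close>

lemma strict_source:
  assumes ijk: "i \<in> {1..N}" "j \<in> {1..N}" "k \<in> {1..N}"
    and c: "strict (rep_le p) i j" "strict (rep_le p) i k"
  shows "p i j = p i k"
proof -
  have "conn (rep_le p) j i" "conn (rep_le p) i k" using c by (auto simp: conn_def strict_def)
  hence "conn (rep_le p) j k" by (rule conn_trans[OF ijk(2,1,3)])
  then consider "strict (rep_le p) j k" | "strict (rep_le p) k j" | "j = k" | "p j k \<noteq> 0" "p k j \<noteq> 0"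
    by (auto simp: conn_def strict_def rep_le_def)
  thus ?thesis
  proof cases
    case 1 thus ?thesis using strict_chain[OF ijk c(1)] by blast
  next
    case 2 thus ?thesis using strict_chain[OF ijk(1,3,2) c(2)] by simp
  next
    case 3 thus ?thesis by simp
  next
    case 4
    have c': "p i j \<noteq> 0" "p j i = 0" "i \<noteq> j" using c by (auto simp: strict_def rep_le_def)
    have "q i j \<noteq> 0" using pair_relations(4)[OF ijk(2,1)] c' by auto
    hence "p i j * p j k = p j k * p i k" using relations(2)[OF ijk] c' by simp
    thus ?thesis using 4 by (simp add: mult.commute)
  qed
qed

lemma strict_target:
  assumes ijk: "i \<in> {1..N}" "j \<in> {1..N}" "k \<in> {1..N}"
    and c: "strict (rep_le p) i k" "strict (rep_le p) j k"
  shows "p i k = p j k"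
proof -
  have "conn (rep_le p) i k" "conn (rep_le p) k j" using c by (auto simp: conn_def strict_def)
  hence "conn (rep_le p) i j" by (rule conn_trans[OF ijk(1,3,2)])
  then consider "strict (rep_le p) i j" | "strict (rep_le p) j i" | "i = j" | "p i j \<noteq> 0" "p j i \<noteq> 0"
    by (auto simp: conn_def strict_def rep_le_def)
  thus ?thesis
  proof cases
    case 1 thus ?thesis using strict_chain[OF ijk] c by blast
  next
    case 2 thus ?thesis using strict_chain[OF ijk(2,1,3)] c by simp
  next
    case 3 thus ?thesis by simp
  next
    case 4
    have c': "p j k \<noteq> 0" "p k j = 0" "j \<noteq> k" using c by (auto simp: strict_def rep_le_def)
    have "q j k \<noteq> 0" using pair_relations(4)[OF ijk(3,2)] c' by auto
    hence "p i j * p i k = p j k * p i j" using relations(3)[OF ijk] c' by simp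
    thus ?thesis using 4 by (simp add: mult.commute)
  qed
qed

text \<open>If \<open>i\<close> does not come after \<open>k\<close>, then \<open>(i, l)\<close> is
  a strict pair as well; it has its source in common with \<open>(i, j)\<close> and its target with
  \<open>(k, l)\<close>. Otherwise \<open>(k, j)\<close> plays this role.\<close>

lemma strict_const:
  assumes ijkl: "i \<in> {1..N}" "j \<in> {1..N}" "k \<in> {1..N}" "l \<in> {1..N}"
    and c: "strict (rep_le p) i j" "strict (rep_le p) k l" "conn (rep_le p) i k"
  shows "p i j = p k l"
proof -
  note tr = le_trans
  from c(3) show ?thesis unfolding conn_def
  proof
    assume ik: "rep_le p i k"
    hence il: "strict (rep_le p) i l" using c(2) tr ijkl unfolding strict_def by blast
    show ?thesis
      using strict_source[OF ijkl(1,2,4) c(1) il] strict_target[OF ijkl(1,3,4) il c(2)] by simp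
  next
    assume ik: "rep_le p k i"
    hence kj: "strict (rep_le p) k j" using c(1) tr ijkl unfolding strict_def by blast
    show ?thesis
      using strict_target[OF ijkl(1,3,2) c(1) kj] strict_source[OF ijkl(3,2,4) kj c(2)] by simp
  qed
qed

text \<open>Vieta: both diagonal values are roots of one monic quadratic with linear coefficient
  \<open>- p i j\<close>, and distinct roots add up to \<open>p i j\<close>.\<close>

lemma eigenvalue_sum:
  assumes ij: "i \<in> {1..N}" "j \<in> {1..N}" and c: "p i j \<noteq> 0" "p i i \<noteq> p j j"
  shows "p i i + p j j = p i j"
proof -
  have "(p i i - p j j) * (p i i + p j j) = (p i i - p j j) * p i j"
    using pair_relations(1,2)[OF ij c(1)] by (simp add: algebra_simps)
  thus ?thesis using c(2) by simp
qed

lemma rep_nation_structure: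
  shows "nation_structure N (rep_le p) (rep_shade p)"
  unfolding nation_structure_def
proof (intro conjI ballI)
  fix i assume "i \<in> {1..N}"
  show "rep_le p i i" by (simp add: rep_le_def)
  thus "rep_shade p i i" by (simp add: rep_shade_def conn_def)
next
  fix i j assume ij: "i \<in> {1..N}" "j \<in> {1..N}"
  show "rep_shade p i j \<longrightarrow> conn (rep_le p) i j \<and> rep_shade p j i" by (auto simp: rep_shade_def conn_sym)
  show "rep_le p i j \<and> rep_le p j i \<longrightarrow> rep_shade p i j"
    using pair_relations(3)[OF ij] by (auto simp: rep_shade_def conn_def rep_le_def)
next
  fix i j k assume ijk: "i \<in> {1..N}" "j \<in> {1..N}" "k \<in> {1..N}"
  show "rep_le p i j \<and> rep_le p j k \<longrightarrow> rep_le p i k" using le_trans[OF ijk] by blast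
  show "conn (rep_le p) i j \<and> conn (rep_le p) j k \<longrightarrow> conn (rep_le p) i k"
    using conn_trans[OF ijk] by blast
  show "rep_shade p i j \<and> rep_shade p j k \<longrightarrow> rep_shade p i k"
    using conn_trans[OF ijk] by (auto simp: rep_shade_def)
  show "conn (rep_le p) i j \<and> conn (rep_le p) j k \<longrightarrow> rep_shade p i j \<or> rep_shade p j k \<or> rep_shade p i k"
  proof (rule impI, rule ccontr)
    assume c: "conn (rep_le p) i j \<and> conn (rep_le p) j k"
    have ik: "conn (rep_le p) i k" using conn_trans[OF ijk] c by blast
    assume "\<not> (rep_shade p i j \<or> rep_shade p j k \<or> rep_shade p i k)"
    hence ne: "p i i \<noteq> p j j" "p j j \<noteq> p k k" "p i i \<noteq> p k k" using c ik by (auto simp: rep_shade_def)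
    have strict: "strict (rep_le p) a b \<or> strict (rep_le p) b a"
      if "conn (rep_le p) a b" "p a a \<noteq> p b b" "a \<in> {1..N}" "b \<in> {1..N}" for a b
      using that pair_relations(3)[OF that(3,4)] by (auto simp: conn_def strict_def rep_le_def)
    \<comment> \<open>Three pairwise different diagonal values in one nation would make
      \<open>p i i + p j j\<close> and \<open>p j j + p k k\<close> both equal to the value of
      \<open>p\<close> on strict pairs of that nation, hence \<open>p i i = p k k\<close>. This
      bounds the number of shades by two.\<close>
    have "\<exists>a\<in>{1..N}. \<exists>b\<in>{1..N}. strict (rep_le p) a b \<and> conn (rep_le p) i a \<and> p i i + p j j = p a b"
      using strict[of i j] c ne ijk eigenvalue_sum[OF ijk(1,2)] eigenvalue_sum[OF ijk(2,1)]
      by (metis add.commute conn_def rep_le_def strict_def)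
    then obtain a b where ab: "a \<in> {1..N}" "b \<in> {1..N}" "strict (rep_le p) a b" "conn (rep_le p) i a" "p i i + p j j = p a b" by blast
    have "\<exists>a\<in>{1..N}. \<exists>b\<in>{1..N}. strict (rep_le p) a b \<and> conn (rep_le p) i a \<and> p j j + p k k = p a b"
      using strict[of j k] c ne ijk eigenvalue_sum[OF ijk(2,3)] eigenvalue_sum[OF ijk(3,2)] ik
      by (metis add.commute rep_le_def strict_def)
    then obtain a' b' where ab': "a' \<in> {1..N}" "b' \<in> {1..N}" "strict (rep_le p) a' b'" "conn (rep_le p) i a'" "p j j + p k k = p a' b'" by blast
    have "conn (rep_le p) a a'" using conn_trans[OF ab(1) ijk(1) ab'(1)] ab(4) ab'(4) conn_sym by blast
    hence "p a b = p a' b'" by (rule strict_const[OF ab(1,2) ab'(1,2) ab(3) ab'(3)])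
    hence "p i i = p k k" using ab(5) ab'(5) by (metis add.commute add_left_cancel)
    thus False using ne by simp
  qed
qed

lemma rep_realises:
  shows "realises N (rep_le p) (rep_shade p) p q"
  unfolding realises_def
proof (intro conjI ballI impI; (elim conjE)?)
  fix i assume i: "i \<in> {1..N}"
  show "p i i \<noteq> 0" by (rule pair_relations(5)[OF i i])
next
  fix i j assume ij: "i \<in> {1..N}" "j \<in> {1..N}"
  note P = pair_relations[OF ij] and P' = pair_relations[OF ij(2,1)]
  { assume "\<not> conn (rep_le p) i j"
    thus "p i j = 0" "q i j \<noteq> 0" using P by (auto simp: conn_def rep_le_def) }
  { assume "rep_le p i j" "rep_le p j i" "i \<noteq> j"
    thus "p i j = p i i" "q i j = 0" using P by (auto simp: rep_le_def) }
  { assume "strict (rep_le p) i j"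
    hence *: "i \<noteq> j" "p i j \<noteq> 0" "p j i = 0" by (auto simp: strict_def rep_le_def)
    show "p i j \<noteq> 0" "p j i = 0" using * by auto
    show "q i j \<noteq> 0" "q j i \<noteq> 0" using P'(4) * by auto
    show "p i i * p i i = p i j * p i i + q i j * q j i" "p j j * p j j = p i j * p j j + q i j * q j i"
      using P(1,2) * by blast+
    assume "\<not> rep_shade p i j"
    hence "p i i \<noteq> p j j" using * by (auto simp: rep_shade_def conn_def rep_le_def)
    thus "p i i + p j j = p i j" using eigenvalue_sum[OF ij *(2)] by simp }
  { assume "rep_shade p i j"
    thus "p i i = p j j" by (simp add: rep_shade_def) }
next
  fix i j k assume ijk: "i \<in> {1..N}" "j \<in> {1..N}" "k \<in> {1..N}"
  assume c: "conn (rep_le p) i j" "\<not> conn (rep_le p) i k"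
  have c': "\<not> conn (rep_le p) j k" using conn_trans[OF ijk] c by blast
  have 0: "p i k = 0" "p k i = 0" "p j k = 0" "p k j = 0" using c c' by (auto simp: conn_def rep_le_def)
  \<comment> \<open>With the foreign label \<open>k\<close> in the middle, the first braid relation
    reduces to \<open>p i j * (q i k * q k i) = p i j * (q k j * q j k)\<close>; the case
    \<open>p j i \<noteq> 0\<close> is symmetric.\<close>
  from c(1) consider "i = j" | "p i j \<noteq> 0" | "p j i \<noteq> 0" by (auto simp: conn_def rep_le_def)
  thus "q i k * q k i = q j k * q k j"
  proof cases
    case 2 thus ?thesis using relations(1)[OF ijk(1,3,2)] 0 by (simp add: mult.commute)
  next
    case 3 thus ?thesis using relations(1)[OF ijk(2,3,1)] 0 by (simp add: mult.commute)
  qed simp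
next
  fix i j k l assume "i \<in> {1..N}" "j \<in> {1..N}" "k \<in> {1..N}" "l \<in> {1..N}"
    "strict (rep_le p) i j" "strict (rep_le p) k l" "conn (rep_le p) i k"
  thus "p i j = p k l" by (rule strict_const)
qed

end

lemma braid_rep_iff:
  "braid_rep N R \<longleftrightarrow> (\<exists>p q. diag0 N q \<and> ybe N p q \<and> nonsingular N p q \<and> R = pq_op N p q)"
  unfolding braid_rep_def charge_conserving_iff nonsingular_def
  using braid_equation_iff_ybe pq_op_invertible by (safe; blast)

section \<open>Quadruples and germs\<close>

definition quad_le :: "quad \<Rightarrow> nat \<Rightarrow> nat \<Rightarrow> bool" where
  "quad_le = (\<lambda>(\<pi>, \<kappa>, \<rho>, \<sigma>) i j. block \<pi> i = block \<pi> j \<and> (block \<kappa> i, block \<kappa> j) \<in> \<rho> (block \<pi> i))"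

definition quad_shade :: "quad \<Rightarrow> nat \<Rightarrow> nat \<Rightarrow> bool" where
  "quad_shade = (\<lambda>(\<pi>, \<kappa>, \<rho>, \<sigma>) i j. block \<pi> i = block \<pi> j \<and>
     (\<exists>t\<in>\<sigma> (block \<pi> i). block \<kappa> i \<in> t \<and> block \<kappa> j \<in> t))"

lemma block_eqI:
  assumes "partition_on A P" "X \<in> P" "x \<in> X"
  shows "block P x = X"
  unfolding block_def
proof (rule the_equality)
  fix Y assume "Y \<in> P \<and> x \<in> Y"
  thus "Y = X" using assms by (auto simp: partition_on_def disjoint_def)
qed (use assms in simp)

lemma block_in:
  assumes "partition_on A P" "x \<in> A"
  shows "block P x \<in> P" "x \<in> block P x"
proof -
  obtain X where "X \<in> P" "x \<in> X" using assms by (auto simp: partition_on_def)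
  thus "block P x \<in> P" "x \<in> block P x" using block_eqI[OF assms(1)] by auto
qed

lemma first_elem_props:
  assumes "linear_order_on A r" "finite A" "A \<noteq> {}"
  shows "first_elem A r \<in> A" "\<And>d. d \<in> A \<Longrightarrow> (first_elem A r, d) \<in> r"
proof -
  have lin: "refl_on A r" "trans r" "antisym r" "total_on A r"
    using assms(1) by (auto simp: order_on_defs)
  note tr = lin(2) and an = lin(3)
  have refl: "(x, x) \<in> r" if "x \<in> A" for x
    using lin(1) that by (rule refl_onD)
  have tot: "(x, y) \<in> r \<or> (y, x) \<in> r" if "x \<in> A" "y \<in> A" for x y
    using lin(4) that refl unfolding total_on_def by (cases "x = y") auto
  have "\<exists>c\<in>B. \<forall>d\<in>B. (c, d) \<in> r" if "finite B" "B \<noteq> {}" "B \<subseteq> A" for B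
    using that
  proof (induction rule: finite_ne_induct)
    case (singleton x) thus ?case using refl by auto
  next
    case (insert x F)
    then obtain c where c: "c \<in> F" "\<forall>d\<in>F. (c, d) \<in> r" by auto
    have "(x, c) \<in> r \<or> (c, x) \<in> r" using tot c insert.prems by blast
    thus ?case
    proof
      assume "(x, c) \<in> r"
      hence "\<forall>d\<in>insert x F. (x, d) \<in> r" using c tr refl insert.prems by (auto dest: transD)
      thus ?thesis by blast
    qed (use c in blast)
  qed
  then obtain c where c: "c \<in> A" "\<forall>d\<in>A. (c, d) \<in> r" using assms by blast
  have "first_elem A r = c" unfolding first_elem_def
    by (rule the_equality) (use c an in \<open>auto dest: antisymD\<close>)
  thus "first_elem A r \<in> A" "\<And>d. d \<in> A \<Longrightarrow> (first_elem A r, d) \<in> r" using c by auto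
qed

locale quad_ctx =
  fixes N \<pi> \<kappa> \<rho> \<sigma>
  assumes quad: "(\<pi>, \<kappa>, \<rho>, \<sigma>) \<in> SS N"
begin

abbreviation le :: "nat \<Rightarrow> nat \<Rightarrow> bool" where "le \<equiv> quad_le (\<pi>, \<kappa>, \<rho>, \<sigma>)"
abbreviation shd :: "nat \<Rightarrow> nat \<Rightarrow> bool" where "shd \<equiv> quad_shade (\<pi>, \<kappa>, \<rho>, \<sigma>)"

lemma partitions: "partition_on {1..N} \<pi>" "partition_on {1..N} \<kappa>"
  and refine: "c \<in> \<kappa> \<Longrightarrow> \<exists>n\<in>\<pi>. c \<subseteq> n"
  using quad by (auto simp: SS_def refines_def)

lemma nation_order: "n \<in> \<pi> \<Longrightarrow> linear_order_on (counties \<kappa> n) (\<rho> n)"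
  and nation_shading: "n \<in> \<pi> \<Longrightarrow> partition_on (counties \<kappa> n) (\<sigma> n)" "n \<in> \<pi> \<Longrightarrow> card (\<sigma> n) \<le> 2"
  using quad by (auto simp: SS_def PiE_iff)

lemmas nation = block_in[OF partitions(1)] and county = block_in[OF partitions(2)]
lemmas nation_eqI = block_eqI[OF partitions(1)] and county_eqI = block_eqI[OF partitions(2)]

lemma county_in_nation:
  assumes "i \<in> {1..N}"
  shows "block \<kappa> i \<in> counties \<kappa> (block \<pi> i)"
proof -
  obtain n where n: "n \<in> \<pi>" "block \<kappa> i \<subseteq> n" using refine county(1)[OF assms] by blast
  hence "block \<pi> i = n" using county(2)[OF assms] nation_eqI by blast
  thus ?thesis using n county(1)[OF assms] by (simp add: counties_def)
qed

lemma county_member: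
  assumes "n \<in> \<pi>" "c \<in> counties \<kappa> n" "i \<in> c"
  shows "i \<in> {1..N}" "block \<kappa> i = c" "block \<pi> i = n"
proof -
  have c: "c \<in> \<kappa>" "c \<subseteq> n" using assms(2) by (auto simp: counties_def)
  show "block \<kappa> i = c" by (rule county_eqI[OF c(1) assms(3)])
  show "block \<pi> i = n" using nation_eqI[OF assms(1)] c assms(3) by blast
  show "i \<in> {1..N}" using partitions(2) c(1) assms(3) unfolding partition_on_def by blast
qed

text \<open>The witness is pinned down as \<open>Min c\<close> so that \<open>capital\<close> below
  can be a function of the nation.\<close>

lemma county_witness:
  assumes "n \<in> \<pi>" "c \<in> counties \<kappa> n"
  obtains i where "i \<in> {1..N}" "block \<kappa> i = c" "block \<pi> i = n" "i = Min c"
proof -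
  have c: "c \<in> \<kappa>" "c \<subseteq> {1..N}" "c \<noteq> {}"
    using assms(2) partitions(2) unfolding counties_def partition_on_def by blast+
  have "finite c" by (rule finite_subset[OF c(2)]) simp
  hence "Min c \<in> c" using c(3) by (rule Min_in)
  from county_member[OF assms this] show ?thesis by (rule that) simp
qed

lemma finite_counties: "finite (counties \<kappa> n)"
proof (rule finite_subset)
  show "counties \<kappa> n \<subseteq> \<kappa>" unfolding counties_def by (rule Collect_subset)
  show "finite \<kappa>" using finite_atLeastAtMost partitions(2) by (rule finite_elements)
qed

lemma counties_ne: "n \<in> \<pi> \<Longrightarrow> counties \<kappa> n \<noteq> {}"
proof -
  assume n: "n \<in> \<pi>"
  have "n \<noteq> {}" "n \<subseteq> {1..N}" using n partitions(1) unfolding partition_on_def by blast+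
  then obtain i where i: "i \<in> n" "i \<in> {1..N}" by blast
  show ?thesis using county_in_nation[OF i(2)] nation_eqI[OF n i(1)] by auto
qed

lemma le_iff: "le i j \<longleftrightarrow> block \<pi> i = block \<pi> j \<and> (block \<kappa> i, block \<kappa> j) \<in> \<rho> (block \<pi> i)"
  and shd_iff: "shd i j \<longleftrightarrow> block \<pi> i = block \<pi> j \<and> (\<exists>t\<in>\<sigma> (block \<pi> i). block \<kappa> i \<in> t \<and> block \<kappa> j \<in> t)"
  by (simp_all add: quad_le_def quad_shade_def)

lemma order_facts:
  assumes "n \<in> \<pi>" "c \<in> counties \<kappa> n" "d \<in> counties \<kappa> n" "e \<in> counties \<kappa> n"
  shows "(c, c) \<in> \<rho> n" "(c, d) \<in> \<rho> n \<or> (d, c) \<in> \<rho> n" "(c, d) \<in> \<rho> n \<Longrightarrow> (d, c) \<in> \<rho> n \<Longrightarrow> c = d"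
    "(c, d) \<in> \<rho> n \<Longrightarrow> (d, e) \<in> \<rho> n \<Longrightarrow> (c, e) \<in> \<rho> n"
proof -
  have lin: "refl_on (counties \<kappa> n) (\<rho> n)" "trans (\<rho> n)" "antisym (\<rho> n)" "total_on (counties \<kappa> n) (\<rho> n)"
    using nation_order[OF assms(1)] by (auto simp: order_on_defs)
  show refl: "(c, c) \<in> \<rho> n" by (rule refl_onD[OF lin(1) assms(2)])
  show "(c, d) \<in> \<rho> n \<or> (d, c) \<in> \<rho> n"
    using lin(4) assms(2,3) refl unfolding total_on_def by (cases "c = d") auto
  show "(c, d) \<in> \<rho> n \<Longrightarrow> (d, c) \<in> \<rho> n \<Longrightarrow> c = d" by (rule antisymD[OF lin(3)])
  show "(c, d) \<in> \<rho> n \<Longrightarrow> (d, e) \<in> \<rho> n \<Longrightarrow> (c, e) \<in> \<rho> n" by (rule transD[OF lin(2)])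
qed

lemma conn_iff:
  assumes "i \<in> {1..N}" "j \<in> {1..N}"
  shows "conn le i j \<longleftrightarrow> block \<pi> i = block \<pi> j"
  using order_facts(2)[OF nation(1)[OF assms(1)] county_in_nation[OF assms(1)] _ county_in_nation[OF assms(1)]]
    county_in_nation[OF assms(2)]
  unfolding conn_def le_iff by metis

lemma le_le_iff:
  assumes "i \<in> {1..N}" "j \<in> {1..N}"
  shows "le i j \<and> le j i \<longleftrightarrow> block \<kappa> i = block \<kappa> j"
proof
  assume *: "le i j \<and> le j i"
  hence b: "block \<pi> j = block \<pi> i" "(block \<kappa> i, block \<kappa> j) \<in> \<rho> (block \<pi> i)" "(block \<kappa> j, block \<kappa> i) \<in> \<rho> (block \<pi> i)"
    unfolding le_iff by metis+
  show "block \<kappa> i = block \<kappa> j"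
    by (rule order_facts(3)[OF nation(1)[OF assms(1)] county_in_nation[OF assms(1)] county_in_nation[OF assms(2), unfolded b(1)]
        county_in_nation[OF assms(1)] b(2,3)])
next
  assume *: "block \<kappa> i = block \<kappa> j"
  have "j \<in> block \<kappa> i" unfolding * by (rule county(2)[OF assms(2)])
  hence "block \<pi> j = block \<pi> i" by (rule county_member(3)[OF nation(1)[OF assms(1)] county_in_nation[OF assms(1)]])
  thus "le i j \<and> le j i"
    using order_facts(1)[OF nation(1)[OF assms(1)] county_in_nation[OF assms(1)] county_in_nation[OF assms(1)] county_in_nation[OF assms(1)]]
    unfolding le_iff *[symmetric] by simp
qed

text \<open>The last part is the pigeonhole principle: \<open>\<sigma> n\<close> has at most two
  parts, so among three counties two lie in the same part.\<close>

lemma shading_facts: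
  assumes "n \<in> \<pi>" "c \<in> counties \<kappa> n" "d \<in> counties \<kappa> n" "e \<in> counties \<kappa> n"
  defines "R \<equiv> \<lambda>c d. \<exists>t\<in>\<sigma> n. c \<in> t \<and> d \<in> t"
  shows "R c c" "R c d \<Longrightarrow> R d e \<Longrightarrow> R c e" "R c d \<or> R d e \<or> R c e"
proof -
  have un: "\<Union>(\<sigma> n) = counties \<kappa> n" and dj: "\<And>s t. s \<in> \<sigma> n \<Longrightarrow> t \<in> \<sigma> n \<Longrightarrow> s \<noteq> t \<Longrightarrow> s \<inter> t = {}"
    using nation_shading(1)[OF assms(1)] unfolding partition_on_def disjoint_def by blast+
  show "R c c" unfolding R_def using un assms(2) by blast
  show "R c d \<Longrightarrow> R d e \<Longrightarrow> R c e" unfolding R_def using dj by blast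
  have fin: "finite (\<sigma> n)" using finite_elements[OF finite_counties nation_shading(1)[OF assms(1)]] .
  show "R c d \<or> R d e \<or> R c e"
  proof (rule ccontr)
    assume n: "\<not> (R c d \<or> R d e \<or> R c e)"
    obtain x y z where xyz: "x \<in> \<sigma> n" "c \<in> x" "y \<in> \<sigma> n" "d \<in> y" "z \<in> \<sigma> n" "e \<in> z" using un assms(2-4) by blast
    hence "x \<noteq> y" "y \<noteq> z" "x \<noteq> z" using n unfolding R_def by blast+
    hence "card {x, y, z} = 3" by simp
    moreover have "card {x, y, z} \<le> card (\<sigma> n)" using fin xyz by (intro card_mono) auto
    ultimately show False using nation_shading(2)[OF assms(1)] by simp
  qed
qed

lemma quad_structure: "nation_structure N le shd"
  unfolding nation_structure_def
proof (intro conjI ballI impI)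
  fix i assume i: "i \<in> {1..N}"
  note f = nation(1)[OF i] county_in_nation[OF i] county_in_nation[OF i] county_in_nation[OF i]
  show "le i i" using order_facts(1)[OF f] by (simp add: le_iff)
  show "shd i i" using shading_facts(1)[OF f] by (simp add: shd_iff)
next
  fix i j assume ij: "i \<in> {1..N}" "j \<in> {1..N}"
  { assume "shd i j"
    thus "conn le i j" "shd j i" unfolding conn_iff[OF ij] shd_iff by metis+ }
  assume "le i j \<and> le j i"
  hence b: "block \<kappa> j = block \<kappa> i" "block \<pi> j = block \<pi> i" using le_le_iff[OF ij] unfolding le_iff by metis+
  show "shd i j"
    using shading_facts(1)[OF nation(1)[OF ij(1)] county_in_nation[OF ij(1)] county_in_nation[OF ij(1)] county_in_nation[OF ij(1)]]
    unfolding shd_iff b by blast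
next
  fix i j k assume ijk: "i \<in> {1..N}" "j \<in> {1..N}" "k \<in> {1..N}"
  have f: "block \<kappa> i \<in> counties \<kappa> (block \<pi> i)" "block \<kappa> j \<in> counties \<kappa> (block \<pi> j)" "block \<kappa> k \<in> counties \<kappa> (block \<pi> k)"
    using ijk by (blast intro: county_in_nation)+
  note n = nation(1)[OF ijk(1)]
  { assume "le i j \<and> le j k"
    thus "le i k" using order_facts(4)[OF n f(1), of "block \<kappa> j" "block \<kappa> k"] f unfolding le_iff by metis }
  { assume "conn le i j \<and> conn le j k"
    thus "conn le i k" using ijk by (simp add: conn_iff) }
  { assume "shd i j \<and> shd j k"
    thus "shd i k" using shading_facts(2)[OF n f(1), of "block \<kappa> j" "block \<kappa> k"] f unfolding shd_iff by metis }
  { assume "conn le i j \<and> conn le j k"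
    hence e: "block \<pi> j = block \<pi> i" "block \<pi> k = block \<pi> i" using ijk by (simp_all add: conn_iff)
    thus "shd i j \<or> shd j k \<or> shd i k"
      using shading_facts(3)[OF n f(1), of "block \<kappa> j" "block \<kappa> k"] f e unfolding shd_iff by metis }
qed

text \<open>A label in the \<open>\<rho>\<close>-first county: the diagonal value there is
  \<open>\<alpha> n\<close>, and the shade of any other label is measured against it.\<close>

definition capital :: "nat set \<Rightarrow> nat" where
  "capital n = Min (first_elem (counties \<kappa> n) (\<rho> n))"

lemma capital:
  assumes "n \<in> \<pi>"
  shows "capital n \<in> {1..N}" "block \<kappa> (capital n) = first_elem (counties \<kappa> n) (\<rho> n)" "block \<pi> (capital n) = n"
proof -
  have "first_elem (counties \<kappa> n) (\<rho> n) \<in> counties \<kappa> n"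
    by (rule first_elem_props(1)[OF nation_order[OF assms] finite_counties counties_ne[OF assms]])
  from county_witness[OF assms this] show "capital n \<in> {1..N}"
    "block \<kappa> (capital n) = first_elem (counties \<kappa> n) (\<rho> n)" "block \<pi> (capital n) = n"
    unfolding capital_def by metis+
qed

lemma le_capital:
  assumes "i \<in> {1..N}"
  shows "le (capital (block \<pi> i)) i"
  using first_elem_props(2)[OF nation_order finite_counties counties_ne] county_in_nation[OF assms]
    capital nation(1)[OF assms] by (auto simp: le_iff)

lemma many_counties_iff:
  \<comment> \<open>\<open>is_germ\<close> restricts \<open>\<beta> n\<close> by a cardinality,
    whereas \<open>realises\<close> speaks of strict pairs. This is the link between the two
    conditions.\<close>
  assumes n: "n \<in> \<pi>"
  shows "card (counties \<kappa> n) > 1 \<longleftrightarrow> (\<exists>j\<in>{1..N}. block \<pi> j = n \<and> strict le (capital n) j)"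
proof
  assume *: "card (counties \<kappa> n) > 1"
  have "\<not> counties \<kappa> n \<subseteq> {block \<kappa> (capital n)}"
  proof
    assume "counties \<kappa> n \<subseteq> {block \<kappa> (capital n)}"
    hence "card (counties \<kappa> n) \<le> card {block \<kappa> (capital n)}" by (intro card_mono) simp_all
    thus False using * by simp
  qed
  then obtain c where c: "c \<in> counties \<kappa> n" "c \<noteq> block \<kappa> (capital n)" by blast
  obtain j where j: "j \<in> {1..N}" "block \<kappa> j = c" "block \<pi> j = n" using county_witness[OF n c(1)] by metis
  have "strict le (capital n) j"
    using le_capital[OF j(1)] le_le_iff[OF capital(1)[OF n] j(1)] c j by (auto simp: strict_def)
  thus "\<exists>j\<in>{1..N}. block \<pi> j = n \<and> strict le (capital n) j" using j by blast
next
  assume "\<exists>j\<in>{1..N}. block \<pi> j = n \<and> strict le (capital n) j"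
  then obtain j where j: "j \<in> {1..N}" "block \<pi> j = n" "strict le (capital n) j" by blast
  have "block \<kappa> (capital n) \<noteq> block \<kappa> j" using j le_le_iff[OF capital(1)[OF n] j(1)] by (auto simp: strict_def)
  hence "card {block \<kappa> (capital n), block \<kappa> j} = 2" by simp
  moreover have "{block \<kappa> (capital n), block \<kappa> j} \<subseteq> counties \<kappa> n"
    using county_in_nation[OF j(1)] county_in_nation[OF capital(1)[OF n]] j capital[OF n] by auto
  ultimately have "2 \<le> card (counties \<kappa> n)" using card_mono[OF finite_counties] by metis
  thus "card (counties \<kappa> n) > 1" by simp
qed

section \<open>The recipe in coordinates, and the germ of a given solution\<close>

lemma recipe_a_eq:
  assumes "i \<in> {1..N}"
  shows "recipe_a (\<pi>, \<kappa>, \<rho>, \<sigma>) (\<alpha>, \<beta>, \<mu>) i =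
    (if shd i (capital (block \<pi> i)) then \<alpha> (block \<pi> i) else \<beta> (block \<pi> i))"
  using capital[OF nation(1)[OF assms]] by (simp add: recipe_a_def Let_def shd_iff)

definition recipe_p :: "germ \<Rightarrow> nat \<Rightarrow> nat \<Rightarrow> complex" where
  "recipe_p g = cc_p (recipe_a (\<pi>, \<kappa>, \<rho>, \<sigma>) g) (recipe_A (\<pi>, \<kappa>, \<rho>, \<sigma>) g)"

definition recipe_q :: "germ \<Rightarrow> nat \<Rightarrow> nat \<Rightarrow> complex" where
  "recipe_q g = cc_q (recipe_A (\<pi>, \<kappa>, \<rho>, \<sigma>) g)"

lemma recipe_pq_op: "recipe N (\<pi>, \<kappa>, \<rho>, \<sigma>) g = pq_op N (recipe_p g) (recipe_q g)"
  by (simp add: recipe_def recipe_p_def recipe_q_def cc_op_eq)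

lemma recipe_q_diag0: "diag0 N (recipe_q g)"
  unfolding recipe_q_def by (rule cc_q_diag0)

lemma recipe_p_diag: "recipe_p g i i = recipe_a (\<pi>, \<kappa>, \<rho>, \<sigma>) g i"
  by (simp add: recipe_p_def cc_p_def)

lemma recipe_foreign:
  assumes "block \<pi> i \<noteq> block \<pi> j" "\<mu> (block \<pi> i) (block \<pi> j) = \<mu> (block \<pi> j) (block \<pi> i)"
  shows "recipe_p (\<alpha>, \<beta>, \<mu>) i j = 0" "recipe_q (\<alpha>, \<beta>, \<mu>) i j = \<mu> (block \<pi> i) (block \<pi> j)"
proof -
  have "i \<noteq> j" using assms by auto
  thus "recipe_p (\<alpha>, \<beta>, \<mu>) i j = 0" "recipe_q (\<alpha>, \<beta>, \<mu>) i j = \<mu> (block \<pi> i) (block \<pi> j)"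
    using assms by (auto simp: recipe_p_def recipe_q_def cc_p_def cc_q_def recipe_A_def Let_def)
qed

lemma recipe_same_county:
  assumes "i \<noteq> j" "block \<pi> i = block \<pi> j" "block \<kappa> i = block \<kappa> j"
  shows "recipe_p (\<alpha>, \<beta>, \<mu>) i j = recipe_a (\<pi>, \<kappa>, \<rho>, \<sigma>) (\<alpha>, \<beta>, \<mu>) i" "recipe_q (\<alpha>, \<beta>, \<mu>) i j = 0"
  using assms by (auto simp: recipe_p_def recipe_q_def cc_p_def cc_q_def recipe_A_def recipe_a_def Let_def)

text \<open>The numerical order of \<open>i\<close> and \<open>j\<close> decides which of the two
  off-diagonal entries is 1 and which is \<open>- \<alpha> n * \<beta> n\<close> (for
  \<open>n = block \<pi> i\<close>); only their product does not depend on it.\<close>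

lemma recipe_strict:
  assumes ij: "i \<in> {1..N}" "j \<in> {1..N}" and s: "strict le i j"
  shows "recipe_p (\<alpha>, \<beta>, \<mu>) i j = \<alpha> (block \<pi> i) + \<beta> (block \<pi> i)" "recipe_p (\<alpha>, \<beta>, \<mu>) j i = 0"
    "recipe_q (\<alpha>, \<beta>, \<mu>) i j * recipe_q (\<alpha>, \<beta>, \<mu>) j i = - \<alpha> (block \<pi> i) * \<beta> (block \<pi> i)"
proof -
  have b: "block \<pi> i = block \<pi> j" "(block \<kappa> i, block \<kappa> j) \<in> \<rho> (block \<pi> j)" "(block \<kappa> j, block \<kappa> i) \<notin> \<rho> (block \<pi> j)"
    using s by (auto simp: strict_def le_iff)
  have c: "block \<kappa> i \<noteq> block \<kappa> j" "i \<noteq> j" using le_le_iff[OF ij] s by (auto simp: strict_def)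
  show "recipe_p (\<alpha>, \<beta>, \<mu>) i j = \<alpha> (block \<pi> i) + \<beta> (block \<pi> i)" "recipe_p (\<alpha>, \<beta>, \<mu>) j i = 0"
    "recipe_q (\<alpha>, \<beta>, \<mu>) i j * recipe_q (\<alpha>, \<beta>, \<mu>) j i = - \<alpha> (block \<pi> i) * \<beta> (block \<pi> i)"
    using b c c(1)[symmetric] by (auto simp: recipe_p_def recipe_q_def cc_p_def cc_q_def recipe_A_def Let_def)
qed

lemma recipe_realises:
  assumes g: "is_germ (\<pi>, \<kappa>, \<rho>, \<sigma>) g"
  shows "realises N le shd (recipe_p g) (recipe_q g)"
proof -
  obtain \<alpha> \<beta> \<mu> where g_eq: "g = (\<alpha>, \<beta>, \<mu>)" by (rule prod_cases3)
  have \<alpha>: "\<alpha> n \<noteq> 0" if "n \<in> \<pi>" for n using g that by (simp add: g_eq is_germ_def)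
  have \<beta>: "\<beta> n \<noteq> 0" "\<alpha> n + \<beta> n \<noteq> 0" if "n \<in> \<pi>" "card (counties \<kappa> n) > 1" for n using g that by (simp_all add: g_eq is_germ_def)
  have \<mu>: "\<mu> n n' = \<mu> n' n" "\<mu> n n' \<noteq> 0" if "n \<in> \<pi>" "n' \<in> \<pi>" "n \<noteq> n'" for n n' using g that unfolding g_eq is_germ_def by auto
  note st = nation_structureD[OF quad_structure]
  note cap = capital[OF nation(1)]
  have a: "recipe_p g i i = (if shd i (capital (block \<pi> i)) then \<alpha> (block \<pi> i) else \<beta> (block \<pi> i))" if "i \<in> {1..N}" for i
    unfolding g_eq recipe_p_diag recipe_a_eq[OF that] ..
  have many: "card (counties \<kappa> (block \<pi> i)) > 1" if ij: "i \<in> {1..N}" "j \<in> {1..N}" "strict le i j" for i j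
  proof -
    have b: "block \<pi> i = block \<pi> j" using ij by (auto simp: strict_def le_iff)
    have "strict le (capital (block \<pi> i)) j"
      using le_capital[OF ij(2)] le_capital[OF ij(1)] ij b st(6)[OF ij(2) cap(1)[OF ij(1)] ij(1)] by (auto simp: strict_def)
    thus ?thesis using many_counties_iff[OF nation(1)[OF ij(1)]] ij(2) b by auto
  qed
  have foreign: "recipe_p g i j = 0" "recipe_q g i j = \<mu> (block \<pi> i) (block \<pi> j)" "recipe_q g i j \<noteq> 0"
    if "i \<in> {1..N}" "j \<in> {1..N}" "\<not> conn le i j" for i j
    using recipe_foreign[of i j \<mu>] \<mu>[OF nation(1)[OF that(1)] nation(1)[OF that(2)]] that
    unfolding g_eq by (auto simp: conn_iff)
  show ?thesis
    unfolding realises_def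
  proof (intro conjI ballI impI; (elim conjE)?)
    fix i assume i: "i \<in> {1..N}"
    \<comment> \<open>The value \<open>\<beta>\<close> occurs on the diagonal only at labels shaded
      differently from the capital. These lie in another county, so \<open>is_germ\<close>
      guarantees that \<open>\<beta>\<close> is nonzero there.\<close>
    have "card (counties \<kappa> (block \<pi> i)) > 1" if "\<not> shd i (capital (block \<pi> i))"
    proof -
      have "\<not> le i (capital (block \<pi> i))" using that le_capital[OF i] st(5)[OF i cap(1)[OF i] i] by blast
      hence "strict le (capital (block \<pi> i)) i" using le_capital[OF i] by (auto simp: strict_def)
      thus ?thesis using many[OF cap(1)[OF i] i] cap(3)[OF i] by simp
    qed
    thus "recipe_p g i i \<noteq> 0" using a[OF i] \<alpha> \<beta> nation(1)[OF i] by auto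
  next
    fix i j assume ij: "i \<in> {1..N}" "j \<in> {1..N}"
    { assume "\<not> conn le i j"
      thus "recipe_p g i j = 0" "recipe_q g i j \<noteq> 0" using foreign ij by auto }
    { assume *: "le i j" "le j i" "i \<noteq> j"
      hence "block \<kappa> i = block \<kappa> j" "block \<pi> i = block \<pi> j" using le_le_iff[OF ij] by (auto simp: le_iff)
      thus "recipe_p g i j = recipe_p g i i" "recipe_q g i j = 0"
        using recipe_same_county[OF *(3)] unfolding g_eq recipe_p_diag by auto }
    { assume s: "shd i j"
      have b: "block \<pi> i = block \<pi> j" using s by (simp add: shd_iff)
      have "shd i (capital (block \<pi> i)) \<longleftrightarrow> shd j (capital (block \<pi> i))"
        using st(8)[OF ij cap(1)[OF ij(1)]] st(8)[OF ij(2,1) cap(1)[OF ij(1)]] st(4)[OF ij ij(1)] s by blast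
      thus "recipe_p g i i = recipe_p g j j" using a[OF ij(1)] a[OF ij(2)] b by simp }
    { assume s: "strict le i j"
      hence b: "block \<pi> i = block \<pi> j" by (auto simp: strict_def le_iff)
      note v = recipe_strict[OF ij s, of \<alpha> \<beta> \<mu>, folded g_eq]
      note nz = \<alpha>[OF nation(1)[OF ij(1)]] \<beta>[OF nation(1)[OF ij(1)] many[OF ij s]]
      show "recipe_p g i j \<noteq> 0" "recipe_p g j i = 0" using v nz by auto
      have "recipe_q g i j * recipe_q g j i \<noteq> 0" using v nz by simp
      thus "recipe_q g i j \<noteq> 0" "recipe_q g j i \<noteq> 0" by auto
      have ai: "recipe_p g i i = \<alpha> (block \<pi> i) \<or> recipe_p g i i = \<beta> (block \<pi> i)"
        and aj: "recipe_p g j j = \<alpha> (block \<pi> i) \<or> recipe_p g j j = \<beta> (block \<pi> i)"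
        using a[OF ij(1)] a[OF ij(2)] b by auto
      show "recipe_p g i i * recipe_p g i i = recipe_p g i j * recipe_p g i i + recipe_q g i j * recipe_q g j i"
        unfolding v using ai by (auto simp: algebra_simps)
      show "recipe_p g j j * recipe_p g j j = recipe_p g i j * recipe_p g j j + recipe_q g i j * recipe_q g j i"
        unfolding v using aj by (auto simp: algebra_simps)
      assume ns: "\<not> shd i j"
      \<comment> \<open>Exactly one of \<open>i\<close> and \<open>j\<close> is shaded like the
        capital, so their diagonal values are \<open>\<alpha>\<close> and \<open>\<beta>\<close> in
        some order.\<close>
      let ?m = "capital (block \<pi> i)"
      have "conn le i j" "conn le j ?m"
        using conn_iff[OF ij] conn_iff[OF ij(2) cap(1)[OF ij(1)]] b cap(3)[OF ij(1)] by auto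
      hence "shd j ?m \<or> shd i ?m" using st(9)[OF ij cap(1)[OF ij(1)]] ns by blast
      moreover have "\<not> (shd j ?m \<and> shd i ?m)"
        using ns st(8)[OF ij(1) cap(1)[OF ij(1)] ij(2)] st(4)[OF ij(2) cap(1)[OF ij(1)] ij(1)] by blast
      ultimately show "recipe_p g i i + recipe_p g j j = recipe_p g i j"
        unfolding v using a[OF ij(1)] a[OF ij(2)] b by auto }
  next
    fix i j k assume ijk: "i \<in> {1..N}" "j \<in> {1..N}" "k \<in> {1..N}" and c: "conn le i j" "\<not> conn le i k"
    have "\<not> conn le j k" "\<not> conn le k j" "\<not> conn le k i" using c ijk by (auto simp: conn_iff)
    thus "recipe_q g i k * recipe_q g k i = recipe_q g j k * recipe_q g k j"
      using foreign(2) c ijk by (simp add: conn_iff)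
  next
    fix i j k l assume *: "i \<in> {1..N}" "j \<in> {1..N}" "k \<in> {1..N}" "l \<in> {1..N}" "strict le i j" "strict le k l" "conn le i k"
    thus "recipe_p g i j = recipe_p g k l"
      using recipe_strict(1)[of i j \<alpha> \<beta> \<mu>] recipe_strict(1)[of k l \<alpha> \<beta> \<mu>] by (simp add: g_eq conn_iff)
  qed
qed

text \<open>\<open>\<alpha>\<close> is the diagonal value at the capital. The second root
  \<open>\<beta>\<close> is taken as the trace minus \<open>\<alpha>\<close>, which is correct also
  for a double root; the eigenvalue equation at the capital then says that the product of the
  off-diagonal entries is \<open>- \<alpha> n * \<beta> n\<close>.\<close>

lemma realises_germ:
  assumes r: "realises N le shd p q" and d: "diag0 N q"
  shows "\<exists>g. is_germ (\<pi>, \<kappa>, \<rho>, \<sigma>) g \<and> xeq N p q (recipe_p g) (recipe_q g)"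
proof -
  \<comment> \<open>In a nation with a single county no such label exists; \<open>far\<close> and
    \<open>\<beta>\<close> are arbitrary there, which a germ permits.\<close>
  define far where "far = (\<lambda>n. SOME j. j \<in> {1..N} \<and> block \<pi> j = n \<and> strict le (capital n) j)"
  define \<alpha> where "\<alpha> = (\<lambda>n. p (capital n) (capital n))"
  define \<beta> where "\<beta> = (\<lambda>n. p (capital n) (far n) - \<alpha> n)"
  \<comment> \<open>The recipe puts the same \<open>\<mu>\<close> in both off-diagonal places, so it
    has to be a square root of their product. The choice of sign is invisible up to X-equivalence,
    and the product is symmetric in the two nations.\<close>
  define \<mu> where "\<mu> = (\<lambda>n n'. csqrt (q (capital n) (capital n') * q (capital n') (capital n)))"
  define g where "g = (\<alpha>, \<beta>, \<mu>)"
  note R = realisesD[OF r]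
  note st = nation_structureD[OF quad_structure]
  note cap = capital[OF nation(1)]
  have far: "far n \<in> {1..N}" "block \<pi> (far n) = n" "strict le (capital n) (far n)"
    if "n \<in> \<pi>" "card (counties \<kappa> n) > 1" for n
  proof -
    have "\<exists>j. j \<in> {1..N} \<and> block \<pi> j = n \<and> strict le (capital n) j"
      using many_counties_iff[OF that(1)] that(2) by blast
    from someI_ex[OF this] show "far n \<in> {1..N}" "block \<pi> (far n) = n" "strict le (capital n) (far n)"
      unfolding far_def by simp_all
  qed
  have germ_strict: "\<alpha> n + \<beta> n = p (capital n) (far n)"
    "- \<alpha> n * \<beta> n = q (capital n) (far n) * q (far n) (capital n)" if "n \<in> \<pi>" "card (counties \<kappa> n) > 1" for n
  proof -
    show "\<alpha> n + \<beta> n = p (capital n) (far n)" by (simp add: \<beta>_def)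
    have "\<alpha> n * \<alpha> n = p (capital n) (far n) * \<alpha> n + q (capital n) (far n) * q (far n) (capital n)"
      using R(10)[OF capital(1)[OF that(1)] far(1)[OF that] far(3)[OF that]] by (simp add: \<alpha>_def)
    thus "- \<alpha> n * \<beta> n = q (capital n) (far n) * q (far n) (capital n)" by (simp add: \<beta>_def algebra_simps)
  qed
  have \<mu>_sq: "\<mu> (block \<pi> i) (block \<pi> j) * \<mu> (block \<pi> i) (block \<pi> j) = q i j * q j i"
    if ij: "i \<in> {1..N}" "j \<in> {1..N}" "block \<pi> i \<noteq> block \<pi> j" for i j
  proof -
    let ?a = "capital (block \<pi> i)" and ?b = "capital (block \<pi> j)"
    note a = cap(1)[OF ij(1)] and b = cap(1)[OF ij(2)]
    have c: "conn le ?a i" "conn le ?b j" "\<not> conn le ?a ?b" "\<not> conn le ?b i"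
      using ij cap(3)[OF ij(1)] cap(3)[OF ij(2)] by (auto simp: conn_iff[OF a ij(1)] conn_iff[OF b ij(2)] conn_iff[OF a b] conn_iff[OF b ij(1)])
    have "q ?a ?b * q ?b ?a = q i ?b * q ?b i" using realisesD3[OF r a ij(1) b c(1,3)] .
    also have "\<dots> = q i j * q j i" using realisesD3[OF r b ij(2,1) c(2,4)] by (simp add: mult.commute)
    finally show ?thesis unfolding \<mu>_def by (simp add: power2_csqrt flip: power2_eq_square)
  qed
  have germ: "is_germ (\<pi>, \<kappa>, \<rho>, \<sigma>) g"
    unfolding is_germ_def g_def prod.case
  proof (intro conjI ballI impI)
    fix n assume n: "n \<in> \<pi>"
    show "\<alpha> n \<noteq> 0" unfolding \<alpha>_def using R(1)[OF capital(1)[OF n] capital(1)[OF n]] .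
    assume many: "card (counties \<kappa> n) > 1"
    note nz = R(6,8,9)[OF capital(1)[OF n] far(1)[OF n many] far(3)[OF n many]]
    have "- \<alpha> n * \<beta> n \<noteq> 0" unfolding germ_strict(2)[OF n many] using nz by simp
    thus "\<beta> n \<noteq> 0" by auto
    show "\<alpha> n + \<beta> n \<noteq> 0" unfolding germ_strict(1)[OF n many] using nz by simp
  next
    fix n n' assume n: "n \<in> \<pi>" "n' \<in> \<pi>" "n \<noteq> n'"
    show "\<mu> n n' = \<mu> n' n" by (simp add: \<mu>_def mult.commute)
    have "\<not> conn le (capital n) (capital n')" "\<not> conn le (capital n') (capital n)" using conn_iff[OF capital(1)[OF n(1)] capital(1)[OF n(2)]] conn_iff[OF capital(1)[OF n(2)] capital(1)[OF n(1)]]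
        capital(3)[OF n(1)] capital(3)[OF n(2)] n(3) by auto
    thus "\<mu> n n' \<noteq> 0" using R(3) capital(1) n by (simp add: \<mu>_def)
  qed
  have strict_const: "card (counties \<kappa> (block \<pi> i)) > 1"
    "p i j = \<alpha> (block \<pi> i) + \<beta> (block \<pi> i)" "q i j * q j i = - \<alpha> (block \<pi> i) * \<beta> (block \<pi> i)"
    if ij: "i \<in> {1..N}" "j \<in> {1..N}" "strict le i j" for i j
  proof -
    let ?m = "capital (block \<pi> i)"
    note m = cap(1)[OF ij(1)]
    have b: "block \<pi> i = block \<pi> j" using ij by (auto simp: strict_def le_iff)
    have mj: "strict le ?m j"
      using le_capital[OF ij(2)] le_capital[OF ij(1)] ij b st(6)[OF ij(2) m ij(1)] by (auto simp: strict_def)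
    show many: "card (counties \<kappa> (block \<pi> i)) > 1"
      using many_counties_iff[OF nation(1)[OF ij(1)]] ij(2) b mj by auto
    note f = far[OF nation(1)[OF ij(1)] many]
    have im: "conn le i ?m" "conn le ?m ?m" using conn_iff[OF ij(1) m] conn_iff[OF m m] cap(3)[OF ij(1)] by auto
    have P: "p i j = p ?m (far (block \<pi> i))" using realisesD4[OF r ij(1,2) m f(1) ij(3) f(3) im(1)] .
    thus "p i j = \<alpha> (block \<pi> i) + \<beta> (block \<pi> i)" using germ_strict(1)[OF nation(1)[OF ij(1)] many] by simp
    have P': "p ?m j = p ?m (far (block \<pi> i))" using realisesD4[OF r m ij(2) m f(1) mj f(3) im(2)] .
    \<comment> \<open>The label \<open>j\<close> is a target of both \<open>i\<close> and the
      capital, and \<open>p\<close> agrees on these pairs. Its eigenvalue equation therefore moves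
      the product from \<open>(i, j)\<close> to the pair of the capital and \<open>j\<close>, and
      that of the capital moves it on to \<open>far\<close>.\<close>
    have "q i j * q j i = p j j * p j j - p i j * p j j" using R(11)[OF ij] by simp
    also have "\<dots> = p j j * p j j - p ?m j * p j j" unfolding P P' ..
    also have "\<dots> = p ?m ?m * p ?m ?m - p ?m j * p ?m ?m" using R(10,11)[OF m ij(2) mj] by (simp add: algebra_simps)
    also have "\<dots> = q ?m (far (block \<pi> i)) * q (far (block \<pi> i)) ?m" using R(10)[OF m f(1,3)] unfolding P' by simp
    finally show "q i j * q j i = - \<alpha> (block \<pi> i) * \<beta> (block \<pi> i)"
      using germ_strict(2)[OF nation(1)[OF ij(1)] many] by simp
  qed
  note R' = realisesD[OF recipe_realises[OF germ]]
  have diag: "recipe_p g i i = p i i" if i: "i \<in> {1..N}" for i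
  proof -
    let ?m = "capital (block \<pi> i)"
    note m = cap(1)[OF i]
    have "p i i = (if shd i ?m then \<alpha> (block \<pi> i) else \<beta> (block \<pi> i))"
    proof (cases "shd i ?m")
      case True
      thus ?thesis using R(12)[OF i m True] by (simp add: \<alpha>_def)
    next
      case False
      hence "\<not> le i ?m" using le_capital[OF i] st(5)[OF i m i] by blast
      hence s: "strict le ?m i" using le_capital[OF i] by (auto simp: strict_def)
      have "\<not> shd ?m i" using False st(4)[OF m i i] by blast
      hence "p ?m ?m + p i i = p ?m i" using R(13)[OF m i s] by blast
      also have "\<dots> = \<alpha> (block \<pi> i) + \<beta> (block \<pi> i)" using strict_const(2)[OF m i s] cap(3)[OF i] by simp
      finally show ?thesis using False by (simp add: \<alpha>_def)
    qed
    thus ?thesis unfolding g_def recipe_p_diag recipe_a_eq[OF i] by simp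
  qed
  have "xeq N p q (recipe_p g) (recipe_q g)"
    unfolding xeq_def
  proof (intro ballI)
    fix i j assume ij: "i \<in> {1..N}" "j \<in> {1..N}"
    note A = R[OF ij] R[OF ij(2,1)] and B = R'[OF ij] R'[OF ij(2,1)]
    consider "\<not> conn le i j" | "i = j" | "i \<noteq> j" "le i j" "le j i" | "strict le i j" | "strict le j i"
      by (auto simp: conn_def strict_def)
    thus "recipe_p g i j = p i j \<and> recipe_q g i j * recipe_q g j i = q i j * q j i \<and> (recipe_q g i j = 0 \<longleftrightarrow> q i j = 0)"
    proof cases
      case 1
      hence b: "block \<pi> i \<noteq> block \<pi> j" by (simp add: conn_iff[OF ij])
      have sym: "\<mu> (block \<pi> i) (block \<pi> j) = \<mu> (block \<pi> j) (block \<pi> i)" by (simp add: \<mu>_def mult.commute)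
      have "recipe_q g i j * recipe_q g j i = q i j * q j i"
        using recipe_foreign(2)[OF b sym] recipe_foreign(2)[OF b[symmetric] sym[symmetric]] \<mu>_sq[OF ij b] sym
        unfolding g_def by simp
      thus ?thesis using A(2,3)[OF 1] B(2,3)[OF 1] by simp
    next
      case 2
      thus ?thesis using diag[OF ij(1)] d recipe_q_diag0 ij by (auto simp: diag0_def)
    next
      case 3
      thus ?thesis using A(4,5) B(4,5) diag[OF ij(1)] by simp
    next
      case 4
      note v = recipe_strict[OF ij 4, of \<alpha> \<beta> \<mu>, folded g_def]
      show ?thesis using v strict_const(2,3)[OF ij 4] A(8)[OF 4] B(8)[OF 4] by simp
    next
      case 5
      note v = recipe_strict[OF ij(2,1) 5, of \<alpha> \<beta> \<mu>, folded g_def]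
      show ?thesis using v strict_const(2,3)[OF ij(2,1) 5] R(7,9)[OF ij(2,1) 5] R'(7,9)[OF ij(2,1) 5] by (simp add: mult.commute)
    qed
  qed
  thus ?thesis using germ by blast
qed

end

section \<open>Nation structures as filled diagrams\<close>

text \<open>Insertion sort for a relation that is transitive and total on the members of the list
  only: \<open>diagram_le\<close> is shown to be total just on two-coloured compositions.\<close>

lemma ex_sorted_wrt:
  assumes "\<And>x y z. x \<in> set xs \<Longrightarrow> y \<in> set xs \<Longrightarrow> z \<in> set xs \<Longrightarrow> r x y \<Longrightarrow> r y z \<Longrightarrow> r x z"
    and "\<And>x y. x \<in> set xs \<Longrightarrow> y \<in> set xs \<Longrightarrow> r x y \<or> r y x"
  shows "\<exists>ys. mset ys = mset xs \<and> sorted_wrt r ys"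
  using assms
proof (induction xs)
  case (Cons x xs)
  have "\<exists>ys. mset ys = mset xs \<and> sorted_wrt r ys"
  proof (rule Cons.IH)
    show "r a c" if "a \<in> set xs" "b \<in> set xs" "c \<in> set xs" "r a b" "r b c" for a b c
      using Cons.prems(1)[of a b c] that by simp
    show "r a b \<or> r b a" if "a \<in> set xs" "b \<in> set xs" for a b
      using Cons.prems(2)[of a b] that by simp
  qed
  then obtain ys where ys: "mset ys = mset xs" "sorted_wrt r ys" by blast
  have set_ys: "set ys = set xs" using ys(1) by (rule mset_eq_setD)
  have tot: "r x y" if "y \<in> set ys" "\<not> r y x" for y using Cons.prems(2)[of x y] that set_ys by auto
  have tr: "r a c" if "a \<in> set ys" "c \<in> set ys" "r a x" "r x c" for a c
    using Cons.prems(1)[of a x c] that set_ys by simp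
  let ?zs = "filter (\<lambda>y. r y x) ys @ [x] @ filter (\<lambda>y. \<not> r y x) ys"
  have "mset ?zs = mset (x # xs)" using ys(1) multiset_partition[of "mset ys" "\<lambda>y. r y x"] by simp
  moreover have "sorted_wrt r ?zs"
    unfolding sorted_wrt_append using ys(2) tot tr by (auto intro: sorted_wrt_filter)
  ultimately show ?case by blast
qed simp

lemma sorted_wrt_unique:
  assumes "sorted_wrt r xs" "sorted_wrt r ys" "mset xs = mset ys"
    and "\<And>x y. x \<in> set xs \<Longrightarrow> y \<in> set xs \<Longrightarrow> r x y \<Longrightarrow> r y x \<Longrightarrow> x = y"
  shows "xs = ys"
  using assms
proof (induction xs arbitrary: ys)
  case (Cons x xs)
  then obtain y zs where ys: "ys = y # zs" by (cases ys) auto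
  have set_eq: "set (x # xs) = set (y # zs)" using Cons.prems(3) unfolding ys by (rule mset_eq_setD)
  have "x = y"
  proof (rule ccontr)
    assume ne: "x \<noteq> y"
    hence "x \<in> set zs" "y \<in> set xs" using set_eq by auto
    hence "r x y" "r y x" using Cons.prems(1,2) unfolding ys by auto
    thus False using Cons.prems(4)[of x y] \<open>y \<in> set xs\<close> ne by simp
  qed
  moreover have "xs = zs"
  proof (rule Cons.IH)
    show "sorted_wrt r xs" "sorted_wrt r zs" using Cons.prems(1,2) unfolding ys by auto
    show "mset xs = mset zs" using Cons.prems(3) \<open>x = y\<close> unfolding ys by simp
    show "a = b" if "a \<in> set xs" "b \<in> set xs" "r a b" "r b a" for a b
      using Cons.prems(4)[of a b] that by simp
  qed
  ultimately show ?case using ys by simp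
qed simp

section \<open>Filled diagrams and the relations that they represent\<close>

definition shape :: "filled \<Rightarrow> diagram" where
  "shape F = map (\<lambda>(c, x). (card c, x)) F"

text \<open>Abstracts from consecutive numbering, so that it covers the fillings behind
  \<open>TT\<close> as well as diagrams cut out of an arbitrary nation structure. Equal diagrams of
  a multiset still have different fillings; \<open>distinct\<close> excludes a repeated filling,
  which the clause on different \<open>F\<close> and \<open>G\<close> would not notice.\<close>

definition filled_ok :: "nat \<Rightarrow> filled list \<Rightarrow> bool" where
  "filled_ok N Fs \<longleftrightarrow> distinct Fs \<and>
     (\<forall>F\<in>set Fs. F \<noteq> [] \<and> snd (hd F) = Unshaded \<and> distinct (map fst F) \<and> disjoint (row_sets F) \<and> {} \<notin> row_sets F) \<and>
     (\<forall>F\<in>set Fs. \<forall>G\<in>set Fs. F \<noteq> G \<longrightarrow> \<Union>(row_sets F) \<inter> \<Union>(row_sets G) = {}) \<and>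
     (\<Union>F\<in>set Fs. \<Union>(row_sets F)) = {1..N}"

definition in_row :: "filled list \<Rightarrow> nat \<Rightarrow> nat \<Rightarrow> nat \<Rightarrow> bool" where
  "in_row Fs a i x \<longleftrightarrow> a < length Fs \<and> i < length (Fs ! a) \<and> x \<in> fst (Fs ! a ! i)"

definition represents :: "filled list \<Rightarrow> (nat \<Rightarrow> nat \<Rightarrow> bool) \<Rightarrow> (nat \<Rightarrow> nat \<Rightarrow> bool) \<Rightarrow> bool" where
  "represents Fs L S \<longleftrightarrow> (\<forall>x y a i b j. in_row Fs a i x \<longrightarrow> in_row Fs b j y \<longrightarrow>
     (L x y \<longleftrightarrow> a = b \<and> i \<le> j) \<and> (S x y \<longleftrightarrow> a = b \<and> snd (Fs ! a ! i) = snd (Fs ! b ! j)))"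

lemma row_sets_nth: "i < length F \<Longrightarrow> fst (F ! i) \<in> row_sets F"
  by (simp add: row_sets_def)

lemma Union_row_sets_iff: "x \<in> \<Union>(row_sets F) \<longleftrightarrow> (\<exists>i<length F. x \<in> fst (F ! i))"
  by (auto simp: row_sets_def in_set_conv_nth) (metis fst_conv nth_mem)+

lemma filled_ok_in_row:
  assumes ok: "filled_ok N Fs"
  shows "in_row Fs a i x \<Longrightarrow> x \<in> {1..N}"
    "x \<in> {1..N} \<Longrightarrow> \<exists>a i. in_row Fs a i x"
    "in_row Fs a i x \<Longrightarrow> in_row Fs b j x \<Longrightarrow> a = b \<and> i = j"
proof -
  have un: "(\<Union>F\<in>set Fs. \<Union>(row_sets F)) = {1..N}" using ok by (simp add: filled_ok_def)
  show "x \<in> {1..N}" if "in_row Fs a i x"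
    using that row_sets_nth[of i "Fs ! a"] unfolding un[symmetric] in_row_def by (meson UN_I UnionI nth_mem)
  show "\<exists>a i. in_row Fs a i x" if "x \<in> {1..N}"
  proof -
    have "x \<in> (\<Union>F\<in>set Fs. \<Union>(row_sets F))" using that unfolding un .
    then obtain F where "F \<in> set Fs" "x \<in> \<Union>(row_sets F)" by (rule UN_E)
    thus ?thesis unfolding in_row_def Union_row_sets_iff in_set_conv_nth by blast
  qed
  show "a = b \<and> i = j" if ab: "in_row Fs a i x" "in_row Fs b j x"
  proof -
    have m: "Fs ! a \<in> set Fs" "Fs ! b \<in> set Fs" using ab by (auto simp: in_row_def)
    have "x \<in> \<Union>(row_sets (Fs ! a))" "x \<in> \<Union>(row_sets (Fs ! b))"
      using ab unfolding in_row_def Union_row_sets_iff by blast+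
    hence e: "Fs ! a = Fs ! b" using ok m unfolding filled_ok_def by blast
    hence a: "a = b" using ok ab by (simp add: filled_ok_def in_row_def nth_eq_iff_index_eq)
    have dj: "disjoint (row_sets (Fs ! a))" "distinct (map fst (Fs ! a))" using ok m unfolding filled_ok_def by blast+
    have ij: "i < length (Fs ! a)" "j < length (Fs ! a)" using ab a by (auto simp: in_row_def)
    have "fst (Fs ! a ! i) = fst (Fs ! a ! j)"
      using dj(1) row_sets_nth[OF ij(1)] row_sets_nth[OF ij(2)] ab a unfolding in_row_def disjoint_def by blast
    hence "i = j" using dj(2) ij nth_eq_iff_index_eq[of "map fst (Fs ! a)" i j] by simp
    thus ?thesis using a by simp
  qed
qed

lemma finite_set_sorted_list:
  assumes "finite A"
    and "\<And>x y z. x \<in> A \<Longrightarrow> y \<in> A \<Longrightarrow> z \<in> A \<Longrightarrow> r x y \<Longrightarrow> r y z \<Longrightarrow> r x z"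
    and "\<And>x y. x \<in> A \<Longrightarrow> y \<in> A \<Longrightarrow> r x y \<or> r y x"
  obtains xs where "distinct xs" "set xs = A" "sorted_wrt r xs"
proof -
  obtain ys where ys: "set ys = A" "distinct ys" using finite_distinct_list[OF assms(1)] by blast
  have "\<exists>xs. mset xs = mset ys \<and> sorted_wrt r xs"
  proof (rule ex_sorted_wrt)
    show "r x z" if "x \<in> set ys" "y \<in> set ys" "z \<in> set ys" "r x y" "r y z" for x y z
      using assms(2)[of x y z] that ys by simp
    show "r x y \<or> r y x" if "x \<in> set ys" "y \<in> set ys" for x y
      using assms(3)[of x y] that ys by simp
  qed
  then obtain xs where "mset xs = mset ys" "sorted_wrt r xs" by blast
  thus ?thesis using that[of xs] ys mset_eq_setD[of xs ys] mset_eq_imp_distinct_iff[of xs ys] by simp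
qed

text \<open>The rows are the classes of mutual \<open>L\<close>, sorted by \<open>L\<close>, and a
  row is unshaded iff \<open>S\<close> relates it to the top row. This recovers \<open>S\<close>
  because it has at most two classes in a nation.\<close>

lemma structure_filled_nation:
  assumes s: "nation_structure N L S" and a: "a \<in> {1..N}"
  defines "cty \<equiv> \<lambda>x. {y \<in> {1..N}. L x y \<and> L y x}" and "nt \<equiv> {y \<in> {1..N}. conn L a y}"
  shows "\<exists>F. F \<noteq> [] \<and> snd (hd F) = Unshaded \<and> distinct (map fst F) \<and> row_sets F = cty ` nt \<and>
     (\<forall>i<length F. \<forall>j<length F. \<forall>x\<in>fst (F ! i). \<forall>y\<in>fst (F ! j).
        (L x y \<longleftrightarrow> i \<le> j) \<and> (S x y \<longleftrightarrow> snd (F ! i) = snd (F ! j)))"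
proof -
  note st = nation_structureD[OF s]
  have cty_self: "x \<in> cty x" if "x \<in> {1..N}" for x using that st(1)[OF that that that] by (simp add: cty_def)
  have nat_in: "x \<in> {1..N}" if "x \<in> nt" for x using that by (simp add: nt_def)
  have cty_sub: "y \<in> nt \<and> y \<in> {1..N} \<and> L x y \<and> L y x" if "x \<in> nt" "y \<in> cty x" for x y
    using that st(7)[of a x y] a by (auto simp: cty_def nt_def conn_def)
  have conn: "conn L x y" if "x \<in> nt" "y \<in> nt" for x y
    using that st(7)[of x a y] a conn_sym[of L] by (auto simp: nt_def)
  \<comment> \<open>The order induced on classes. The existential form avoids choosing
    representatives, and \<open>r_iff\<close> shows that every choice gives the same answer.\<close>
  define r where "r = (\<lambda>c d. \<exists>x\<in>c. \<exists>y\<in>d. L x y)"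
  have r_iff: "r (cty x) (cty y) \<longleftrightarrow> L x y" if xy: "x \<in> nt" "y \<in> nt" for x y
  proof
    assume "r (cty x) (cty y)"
    then obtain u v where uv: "u \<in> cty x" "v \<in> cty y" "L u v" by (auto simp: r_def)
    have "L x u" "L v y" "u \<in> {1..N}" "v \<in> {1..N}" using cty_sub[OF xy(1) uv(1)] cty_sub[OF xy(2) uv(2)] by auto
    thus "L x y" using st(6)[of x u v] st(6)[of x v y] uv(3) nat_in[OF xy(1)] nat_in[OF xy(2)] by blast
  next
    assume "L x y"
    thus "r (cty x) (cty y)" using cty_self nat_in xy unfolding r_def by blast
  qed
  have L_tr: "L x z" if "x \<in> nt" "y \<in> nt" "z \<in> nt" "L x y" "L y z" for x y z
    using st(6)[of x y z] nat_in that by blast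
  have cty_eq: "cty x = cty y" if "x \<in> nt" "y \<in> nt" "L x y" "L y x" for x y
  proof -
    have "L x z \<and> L z x \<longleftrightarrow> L y z \<and> L z y" if "z \<in> {1..N}" for z
      using st(6)[of x y z] st(6)[of z y x] st(6)[of y x z] st(6)[of z x y] nat_in \<open>x \<in> nt\<close> \<open>y \<in> nt\<close> \<open>L x y\<close> \<open>L y x\<close> that by blast
    thus ?thesis by (auto simp: cty_def)
  qed
  have fin: "finite (cty ` nt)" by (simp add: nt_def)
  have r_tr: "r c e" if cde: "c \<in> cty ` nt" "d \<in> cty ` nt" "e \<in> cty ` nt" "r c d" "r d e" for c d e
  proof -
    obtain x y z where "x \<in> nt" "c = cty x" "y \<in> nt" "d = cty y" "z \<in> nt" "e = cty z" using cde by blast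
    thus ?thesis using cde r_iff L_tr by metis
  qed
  have r_tot: "r c d \<or> r d c" if cd: "c \<in> cty ` nt" "d \<in> cty ` nt" for c d
  proof -
    obtain x y where "x \<in> nt" "c = cty x" "y \<in> nt" "d = cty y" using cd by blast
    thus ?thesis using r_iff conn unfolding conn_def by metis
  qed
  obtain cs where cs: "distinct cs" "set cs = cty ` nt" "sorted_wrt r cs"
    by (rule finite_set_sorted_list[OF fin r_tr r_tot])
  have "a \<in> nt" using a st(1)[OF a a a] by (simp add: nt_def conn_def)
  hence ne: "cs \<noteq> []" using cs(2) by auto
  define sh where "sh = (\<lambda>c. if \<exists>x\<in>hd cs. \<exists>y\<in>c. S x y then Unshaded else Shaded)"
  define F where "F = map (\<lambda>c. (c, sh c)) cs"
  have S_tr: "S x z" if "x \<in> nt" "y \<in> nt" "z \<in> nt" "S x y" "S y z" for x y z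
    using st(8)[of x y z] nat_in that by blast
  have S_sym: "S y x" if "x \<in> nt" "y \<in> nt" "S x y" for x y
    using st(4)[of x y x] nat_in that by blast
  have S_cty: "S x y" if "x \<in> cty z" "y \<in> cty z" "z \<in> nt" for x y z
    using st(5)[of x y z] st(6)[of x z y] st(6)[of y z x] cty_sub[OF that(3,1)] cty_sub[OF that(3,2)] nat_in[OF that(3)] by blast
  have S_two: "S x y \<or> S y z \<or> S x z" if "x \<in> nt" "y \<in> nt" "z \<in> nt" for x y z
    using st(9)[of x y z] nat_in conn that by blast
  have "hd cs \<in> cty ` nt" using hd_in_set[OF ne] unfolding cs(2) .
  then obtain u where u: "hd cs = cty u" "u \<in> nt" by (rule imageE)
  note u = u(2,1)
  have uu: "u \<in> hd cs" unfolding u(2) by (rule cty_self[OF nat_in[OF u(1)]])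
  have mem: "x \<in> nt \<and> cty x = cs ! i" if "i < length cs" "x \<in> cs ! i" for i x
  proof -
    have "cs ! i \<in> cty ` nt" using nth_mem[OF that(1)] unfolding cs(2) .
    then obtain z where z: "cs ! i = cty z" "z \<in> nt" by (rule imageE)
    thus ?thesis using cty_sub[of z x] cty_eq[of z x] that by auto
  qed
  have sh_iff: "sh (cs ! i) = Unshaded \<longleftrightarrow> S u x" if ix: "i < length cs" "x \<in> cs ! i" for i x
  proof -
    have "(\<exists>x\<in>hd cs. \<exists>y\<in>cs ! i. S x y) \<longleftrightarrow> S u x"
    proof
      assume "\<exists>x\<in>hd cs. \<exists>y\<in>cs ! i. S x y"
      then obtain v y where vy: "v \<in> cty u" "y \<in> cs ! i" "S v y" unfolding u(2) by blast
      have "S u v" using S_cty[OF cty_self vy(1)] u nat_in by blast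
      moreover have "S y x" using S_cty[of y x x] mem[OF ix] mem[OF ix(1) vy(2)] vy(2) ix(2) by simp
      moreover have "v \<in> nt" "y \<in> nt" "x \<in> nt" using cty_sub[OF u(1) vy(1)] mem[OF ix(1) vy(2)] mem[OF ix] by auto
      ultimately show "S u x" using S_tr[OF u(1), of v y] S_tr[OF u(1), of y x] vy(3) by blast
    qed (use uu ix in blast)
    thus ?thesis by (simp add: sh_def)
  qed
  have F1: "F \<noteq> []" using ne by (simp add: F_def)
  have F2: "snd (hd F) = Unshaded"
  proof -
    have "S u u" using st(2) nat_in[OF u(1)] by blast
    hence "sh (hd cs) = Unshaded" using uu unfolding sh_def by auto
    thus ?thesis using ne by (simp add: F_def hd_map)
  qed
  have F3: "distinct (map fst F)" using cs(1) by (simp add: F_def comp_def)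
  have F4: "row_sets F = cty ` nt" using cs(2) by (simp add: F_def row_sets_def image_image)
  have F5: "(L x y \<longleftrightarrow> i \<le> j) \<and> (S x y \<longleftrightarrow> snd (F ! i) = snd (F ! j))"
    if ij: "i < length F" "j < length F" "x \<in> fst (F ! i)" "y \<in> fst (F ! j)" for i j x y
  proof -
    have l: "i < length cs" "j < length cs" and xy: "x \<in> cs ! i" "y \<in> cs ! j" using ij by (simp_all add: F_def)
    note x = mem[OF l(1) xy(1)] and y = mem[OF l(2) xy(2)]
    have le: "r (cs ! i) (cs ! j)" if "i < j" "j < length cs" for i j
      using sorted_wrt_nth_less[OF cs(3) that] .
    have "L x y \<longleftrightarrow> i \<le> j"
    proof
      assume "i \<le> j"
      hence "r (cs ! i) (cs ! j) \<or> i = j" using le l by (cases "i = j") auto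
      thus "L x y" using r_iff[of x y] x y cty_sub[of x y] xy by auto
    next
      assume *: "L x y"
      show "i \<le> j"
      proof (rule ccontr)
        assume "\<not> i \<le> j"
        hence "L y x" using le[of j i] l r_iff[of y x] x y by simp
        hence "cs ! i = cs ! j" using cty_eq[of x y] x y * by simp
        thus False using cs(1) l \<open>\<not> i \<le> j\<close> by (simp add: nth_eq_iff_index_eq)
      qed
    qed
    moreover have "S x y \<longleftrightarrow> snd (F ! i) = snd (F ! j)"
    proof -
      have "snd (F ! i) = snd (F ! j) \<longleftrightarrow> (sh (cs ! i) = Unshaded \<longleftrightarrow> sh (cs ! j) = Unshaded)"
        using l by (cases "sh (cs ! i)"; cases "sh (cs ! j)") (simp_all add: F_def)
      also have "\<dots> \<longleftrightarrow> (S u x \<longleftrightarrow> S u y)" using sh_iff l xy by simp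
      \<comment> \<open>If \<open>u\<close> is related to neither \<open>x\<close> nor
        \<open>y\<close>, then \<open>S_two\<close> relates \<open>x\<close> to
        \<open>y\<close>.\<close>
      also have "\<dots> \<longleftrightarrow> S x y" using S_tr S_sym S_two x y u(1) by metis
      finally show ?thesis by blast
    qed
    ultimately show ?thesis by blast
  qed
  show ?thesis
    by (rule exI[of _ F], intro conjI allI ballI impI) (fact F1 F2 F3 F4 F5[THEN conjunct1] F5[THEN conjunct2])+
qed

section \<open>The order on diagrams, and the diagrams of an arbitrary nation structure\<close>

lemma word_of_diagram:
  assumes "two_coloured_composition D"
  shows "word_of_diagram D \<in> words" "diagram_of_word (word_of_diagram D) = D"
proof -
  have bij: "bij_betw diagram_of_word {w \<in> words. length w + 1 = boxes D} {E. two_coloured_composition E \<and> boxes E = boxes D}"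
    by (rule bij_words)
  have "D \<in> diagram_of_word ` {w \<in> words. length w + 1 = boxes D}"
    using assms unfolding bij_betw_imp_surj_on[OF bij] by simp
  then obtain w where w: "w \<in> words" "diagram_of_word w = D" by blast
  have "word_of_diagram D = w"
    unfolding word_of_diagram_def
  proof (rule the_equality)
    fix v assume v: "v \<in> words \<and> diagram_of_word v = D"
    have "length v + 1 = boxes D" "length w + 1 = boxes D" using dow_tcc[of v] dow_tcc[of w] v w by simp_all
    thus "v = w" using inj_onD[OF bij_betw_imp_inj_on[OF bij], of v w] v w by simp
  qed (use w in simp)
  thus "word_of_diagram D \<in> words" "diagram_of_word (word_of_diagram D) = D" using w by simp_all
qed

text \<open>Precedence in both directions forces equal lengths, where the dictionary order is
  well-founded and hence asymmetric.\<close>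

lemma diagram_le_antisym:
  assumes "two_coloured_composition D" "two_coloured_composition E" "diagram_le D E" "diagram_le E D"
  shows "D = E"
proof (rule ccontr)
  assume "D \<noteq> E"
  hence *: "(word_of_diagram D, word_of_diagram E) \<in> lex less_than" "(word_of_diagram E, word_of_diagram D) \<in> lex less_than"
    using assms(3,4) by (auto simp: diagram_le_def word_before_def)
  have "wf (lex less_than)" by (intro wf_lex wf_less_than)
  thus False using * wf_not_sym by metis
qed

lemma diagram_le_total:
  assumes "two_coloured_composition D" "two_coloured_composition E"
  shows "diagram_le D E \<or> diagram_le E D"
proof (cases "D = E")
  case False
  hence ne: "word_of_diagram D \<noteq> word_of_diagram E" using word_of_diagram(2) assms by metis
  show ?thesis
  proof (cases "length (word_of_diagram D) = length (word_of_diagram E)")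
    case True
    have "total less_than" by (simp add: total_on_def) arith
    \<comment> \<open>On words of equal length \<open>lenlex\<close> coincides with
      \<open>lex\<close>, so its totality yields that of the dictionary order.\<close>
    hence "(word_of_diagram D, word_of_diagram E) \<in> lenlex less_than \<or> (word_of_diagram E, word_of_diagram D) \<in> lenlex less_than"
      using total_lenlex[of less_than] ne unfolding total_on_def by blast
    thus ?thesis using True by (auto simp: diagram_le_def word_before_def lenlex_conv)
  qed (auto simp: diagram_le_def word_before_def)
qed (simp add: diagram_le_def)

lemma diagram_le_trans:
  assumes "diagram_le D E" "diagram_le E F"
  shows "diagram_le D F"
proof -
  have "trans (lex less_than)" by (rule lex_transI) simp
  thus ?thesis using assms by (auto simp: diagram_le_def word_before_def dest: transD)
qed

lemma two_coloured_shape: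
  assumes "F \<noteq> []" "snd (hd F) = Unshaded" "{} \<notin> row_sets F" "\<Union>(row_sets F) \<subseteq> {1..N::nat}"
  shows "two_coloured_composition (shape F)"
proof -
  have "card c \<ge> 1" if "(c, x) \<in> set F" for c x
  proof -
    have c: "c \<in> row_sets F" using that unfolding row_sets_def by force
    hence "c \<subseteq> {1..N}" using assms(4) by blast
    hence "finite c" by (rule finite_subset) simp
    moreover have "c \<noteq> {}" using c assms(3) by blast
    ultimately show ?thesis by (simp add: Suc_le_eq card_gt_0_iff)
  qed
  thus ?thesis using assms(1,2) by (auto simp: two_coloured_composition_def shape_def hd_map split: prod.splits)
qed

lemma shape_two_coloured:
  assumes "filled_ok N Fs" "F \<in> set Fs"
  shows "two_coloured_composition (shape F)"
proof (rule two_coloured_shape)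
  have "(\<Union>F\<in>set Fs. \<Union>(row_sets F)) = {1..N}" using assms(1) by (simp add: filled_ok_def)
  thus "\<Union>(row_sets F) \<subseteq> {1..N}" using assms(2) by blast
qed (use assms in \<open>simp_all add: filled_ok_def\<close>)

text \<open>One diagram is chosen for each nation, and the nations are sorted by the shapes of their
  diagrams. Nations of equal shape may come in any order, since \<open>diagram_le\<close> is
  reflexive.\<close>

lemma structure_filled:
  assumes s: "nation_structure N L S"
  shows "\<exists>Fs. filled_ok N Fs \<and> represents Fs L S \<and> sorted_wrt diagram_le (map shape Fs)"
proof -
  note st = nation_structureD[OF s]
  define nt where "nt = (\<lambda>a. {y \<in> {1..N}. conn L a y})"
  define cty where "cty = (\<lambda>x. {y \<in> {1..N}. L x y \<and> L y x})"
  define ok where "ok = (\<lambda>n F. F \<noteq> [] \<and> snd (hd F) = Unshaded \<and> distinct (map fst F) \<and> row_sets F = cty ` n \<and>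
     (\<forall>i<length F. \<forall>j<length F. \<forall>x\<in>fst (F ! i). \<forall>y\<in>fst (F ! j).
        (L x y \<longleftrightarrow> i \<le> j) \<and> (S x y \<longleftrightarrow> snd (F ! i) = snd (F ! j))))"
  have ex: "\<forall>n\<in>nt ` {1..N}. \<exists>F. ok n F"
    using structure_filled_nation[OF s] unfolding ok_def nt_def cty_def by blast
  then obtain fl where fl: "\<forall>n\<in>nt ` {1..N}. ok n (fl n)" by (rule bchoice[THEN exE])
  have cty_nt: "\<Union>(cty ` nt a) = nt a" if a: "a \<in> {1..N}" for a
  proof
    show "nt a \<subseteq> \<Union>(cty ` nt a)"
    proof
      fix x assume x: "x \<in> nt a"
      hence "x \<in> {1..N}" by (simp add: nt_def)
      hence "x \<in> cty x" using st(1)[of x x x] by (simp add: cty_def)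
      thus "x \<in> \<Union>(cty ` nt a)" using x by blast
    qed
    show "\<Union>(cty ` nt a) \<subseteq> nt a"
    proof
      fix y assume "y \<in> \<Union>(cty ` nt a)"
      then obtain x where x: "x \<in> nt a" "y \<in> cty x" by blast
      hence "x \<in> {1..N}" "y \<in> {1..N}" "conn L a x" "conn L x y" by (auto simp: nt_def cty_def conn_def)
      thus "y \<in> nt a" using st(7)[of a x y] a by (simp add: nt_def)
    qed
  qed
  have nt_self: "a \<in> nt a" if "a \<in> {1..N}" for a using that st(1)[OF that that that] by (simp add: nt_def conn_def)
  have nt_eq: "nt a = nt b" if "a \<in> {1..N}" "b \<in> {1..N}" "x \<in> nt a" "x \<in> nt b" for a b x
  proof -
    have x: "x \<in> {1..N}" "conn L a x" "conn L b x" using that by (auto simp: nt_def)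
    have "conn L a b" "conn L b a"
      using st(7)[OF that(1) x(1) that(2)] st(7)[OF that(2) x(1) that(1)] x conn_sym[of L] by blast+
    thus ?thesis using st(7)[OF that(1,2)] st(7)[OF that(2,1)] by (auto simp: nt_def)
  qed
  have cty_eq: "cty x = cty y" if "x \<in> {1..N}" "y \<in> {1..N}" "z \<in> cty x" "z \<in> cty y" for x y z
  proof -
    have z: "z \<in> {1..N}" "L x z" "L z x" "L y z" "L z y" using that by (auto simp: cty_def)
    have xy: "L x y" "L y x" using st(6)[OF that(1) z(1) that(2)] st(6)[OF that(2) z(1) that(1)] z by blast+
    have "L x u \<and> L u x \<longleftrightarrow> L y u \<and> L u y" if u: "u \<in> {1..N}" for u
      using st(6)[OF \<open>x \<in> {1..N}\<close> \<open>y \<in> {1..N}\<close> u] st(6)[OF u \<open>y \<in> {1..N}\<close> \<open>x \<in> {1..N}\<close>]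
        st(6)[OF \<open>y \<in> {1..N}\<close> \<open>x \<in> {1..N}\<close> u] st(6)[OF u \<open>x \<in> {1..N}\<close> \<open>y \<in> {1..N}\<close>] xy by blast
    thus ?thesis by (auto simp: cty_def)
  qed
  have nations: "(\<Union>n\<in>nt ` {1..N}. n) = {1..N}" using nt_self by (auto simp: nt_def)
  have fl_un: "\<Union>(row_sets (fl n)) = n" if n: "n \<in> nt ` {1..N}" for n
  proof -
    obtain a where a: "n = nt a" "a \<in> {1..N}" using n by (rule imageE)
    have "row_sets (fl n) = cty ` n" using fl n unfolding ok_def by blast
    thus ?thesis unfolding a(1) by (simp only: cty_nt[OF a(2)])
  qed
  have fl_props: "fl n \<noteq> [] \<and> snd (hd (fl n)) = Unshaded \<and> distinct (map fst (fl n)) \<and> disjoint (row_sets (fl n)) \<and> {} \<notin> row_sets (fl n)"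
    if n: "n \<in> nt ` {1..N}" for n
  proof -
    have o: "fl n \<noteq> []" "snd (hd (fl n)) = Unshaded" "distinct (map fst (fl n))" "row_sets (fl n) = cty ` n"
      using fl n unfolding ok_def by blast+
    have sub: "n \<subseteq> {1..N}" using n nations by blast
    have "disjoint (cty ` n)"
      unfolding disjoint_def
    proof (intro ballI impI)
      fix c d assume "c \<in> cty ` n" "d \<in> cty ` n" "c \<noteq> d"
      then obtain x y where xy: "x \<in> n" "c = cty x" "y \<in> n" "d = cty y" "cty x \<noteq> cty y" by blast
      show "c \<inter> d = {}" using cty_eq[of x y] sub xy by blast
    qed
    moreover have "{} \<notin> cty ` n"
    proof
      assume "{} \<in> cty ` n"
      then obtain x where x: "x \<in> n" "cty x = {}" by auto
      have xI: "x \<in> {1..N}" using x(1) sub by blast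
      hence "x \<in> cty x" using st(1)[OF xI xI xI] by (simp add: cty_def)
      thus False using x(2) by simp
    qed
    ultimately show ?thesis using o by simp
  qed
  have tcc: "two_coloured_composition (shape (fl n))" if n: "n \<in> nt ` {1..N}" for n
  proof (rule two_coloured_shape)
    show "\<Union>(row_sets (fl n)) \<subseteq> {1..N}" unfolding fl_un[OF n] using n nations by blast
  qed (use fl_props[OF n] in simp_all)
  have fin: "finite (nt ` {1..N})" by simp
  define r where "r = (\<lambda>m n. diagram_le (shape (fl m)) (shape (fl n)))"
  have r_tr: "r x z" if "x \<in> nt ` {1..N}" "y \<in> nt ` {1..N}" "z \<in> nt ` {1..N}" "r x y" "r y z" for x y z
    using that(4,5) unfolding r_def by (rule diagram_le_trans)
  have r_tot: "r x y \<or> r y x" if "x \<in> nt ` {1..N}" "y \<in> nt ` {1..N}" for x y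
    unfolding r_def by (rule diagram_le_total[OF tcc[OF that(1)] tcc[OF that(2)]])
  obtain ns where ns: "distinct ns" "set ns = nt ` {1..N}" "sorted_wrt r ns"
    by (rule finite_set_sorted_list[OF fin r_tr r_tot])
  define Fs where "Fs = map fl ns"
  have nations_disjoint: "m \<inter> n = {}" if "m \<in> nt ` {1..N}" "n \<in> nt ` {1..N}" "m \<noteq> n" for m n
    using that nt_eq by blast
  have valid: "filled_ok N Fs"
    unfolding filled_ok_def
  proof (intro conjI)
    have "inj_on fl (set ns)" using fl_un unfolding ns(2) by (metis inj_onI)
    thus "distinct Fs" using ns(1) by (simp add: Fs_def distinct_map)
    show "\<forall>F\<in>set Fs. F \<noteq> [] \<and> snd (hd F) = Unshaded \<and> distinct (map fst F) \<and> disjoint (row_sets F) \<and> {} \<notin> row_sets F"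
    proof
      fix F assume "F \<in> set Fs"
      then obtain n where "n \<in> nt ` {1..N}" "F = fl n" using ns(2) by (auto simp: Fs_def)
      thus "F \<noteq> [] \<and> snd (hd F) = Unshaded \<and> distinct (map fst F) \<and> disjoint (row_sets F) \<and> {} \<notin> row_sets F"
        using fl_props by simp
    qed
    show "\<forall>F\<in>set Fs. \<forall>G\<in>set Fs. F \<noteq> G \<longrightarrow> \<Union>(row_sets F) \<inter> \<Union>(row_sets G) = {}"
    proof (intro ballI impI)
      fix F G assume FG: "F \<in> set Fs" "G \<in> set Fs" "F \<noteq> G"
      have set_Fs: "set Fs = fl ` nt ` {1..N}" using ns(2) by (simp add: Fs_def)
      obtain m where m: "F = fl m" "m \<in> nt ` {1..N}" using FG(1)[unfolded set_Fs] by (rule imageE)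
      obtain n where n: "G = fl n" "n \<in> nt ` {1..N}" using FG(2)[unfolded set_Fs] by (rule imageE)
      have "m \<noteq> n" using FG(3) m n by blast
      note mn = m(2,1) n(2,1) this
      show "\<Union>(row_sets F) \<inter> \<Union>(row_sets G) = {}"
        unfolding mn(2,4) fl_un[OF mn(1)] fl_un[OF mn(3)] using nations_disjoint[OF mn(1,3,5)] .
    qed
    have "(\<Union>F\<in>set Fs. \<Union>(row_sets F)) = (\<Union>n\<in>nt ` {1..N}. \<Union>(row_sets (fl n)))"
      using ns(2) by (simp add: Fs_def)
    also have "\<dots> = (\<Union>n\<in>nt ` {1..N}. n)" by (rule SUP_cong) (simp_all only: fl_un)
    finally show "(\<Union>F\<in>set Fs. \<Union>(row_sets F)) = {1..N}" unfolding nations .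
  qed
  have rep: "represents Fs L S"
    unfolding represents_def
  proof (intro allI impI)
    fix x y a i b j assume x: "in_row Fs a i x" and y: "in_row Fs b j y"
    have ab: "a < length ns" "b < length ns" using x y unfolding in_row_def Fs_def by simp_all
    have n: "ns ! a \<in> nt ` {1..N}" "ns ! b \<in> nt ` {1..N}" using nth_mem[OF ab(1)] nth_mem[OF ab(2)] unfolding ns(2) .
    have x': "i < length (fl (ns ! a))" "x \<in> fst (fl (ns ! a) ! i)" and y': "j < length (fl (ns ! b))" "y \<in> fst (fl (ns ! b) ! j)"
      using x y ab unfolding in_row_def Fs_def by simp_all
    show "(L x y \<longleftrightarrow> a = b \<and> i \<le> j) \<and> (S x y \<longleftrightarrow> a = b \<and> snd (Fs ! a ! i) = snd (Fs ! b ! j))"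
    proof (cases "a = b")
      case True
      have "(L x y \<longleftrightarrow> i \<le> j) \<and> (S x y \<longleftrightarrow> snd (fl (ns ! a) ! i) = snd (fl (ns ! a) ! j))"
        using bspec[OF fl n(1)] x' y' unfolding True[symmetric] ok_def by metis
      thus ?thesis using True ab by (simp add: Fs_def)
    next
      case False
      have xn: "x \<in> ns ! a" using x' fl_un[OF n(1)] Union_row_sets_iff by blast
      have yn: "y \<in> ns ! b" using y' fl_un[OF n(2)] Union_row_sets_iff by blast
      have ne: "ns ! a \<noteq> ns ! b" using False ab ns(1) by (simp add: nth_eq_iff_index_eq)
      obtain u where u: "ns ! a = nt u" "u \<in> {1..N}" using n(1) by blast
      have I: "x \<in> {1..N}" "y \<in> {1..N}" using xn yn n nations by blast+
      have "\<not> conn L x y"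
      proof
        assume "conn L x y"
        hence "conn L u y" using st(7)[OF u(2) I] xn unfolding u(1) nt_def by blast
        hence "y \<in> ns ! a" using I unfolding u(1) nt_def by blast
        thus False using nations_disjoint[OF n ne] yn by blast
      qed
      thus ?thesis using False st(3)[OF I I(1)] by (auto simp: conn_def)
    qed
  qed
  have "sorted_wrt diagram_le (map shape Fs)" using ns(3) by (simp add: Fs_def sorted_wrt_map r_def)
  thus ?thesis using valid rep by blast
qed

section \<open>Sizes of filled diagrams, and the consecutive fillings\<close>

lemma filled_ok_finite:
  assumes "filled_ok N Fs" "F \<in> set Fs" "c \<in> row_sets F"
  shows "finite c" "c \<noteq> {}" "c \<subseteq> {1..N}"
proof -
  have un: "(\<Union>F\<in>set Fs. \<Union>(row_sets F)) = {1..N}" using assms(1) by (simp add: filled_ok_def)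
  show "c \<subseteq> {1..N}" using assms(2,3) unfolding un[symmetric] by blast
  thus "finite c" by (rule finite_subset) simp
  show "c \<noteq> {}" using assms unfolding filled_ok_def by blast
qed

lemma shape_nth: "i < length F \<Longrightarrow> shape F ! i = (card (fst (F ! i)), snd (F ! i))" "length (shape F) = length F"
  by (simp_all add: shape_def split: prod.splits)

lemma card_Union_row_sets:
  assumes "filled_ok N Fs" "F \<in> set Fs"
  shows "card (\<Union>(row_sets F)) = boxes (shape F)"
proof -
  have F: "distinct (map fst F)" "disjoint (row_sets F)" using assms unfolding filled_ok_def by blast+
  have "card (\<Union>(row_sets F)) = (\<Sum>c\<in>row_sets F. card c)"
    by (rule card_Union_disjoint) (use F(2) filled_ok_finite(1)[OF assms] in \<open>auto simp: disjoint_def pairwise_def disjnt_def\<close>)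
  also have "\<dots> = sum_list (map card (map fst F))"
    unfolding row_sets_def set_map[symmetric] by (rule sum_list_distinct_conv_sum_set[OF F(1), symmetric])
  also have "\<dots> = boxes (shape F)" by (simp add: boxes_def shape_def comp_def case_prod_unfold)
  finally show ?thesis .
qed

lemma sum_list_shape:
  assumes "filled_ok N Fs"
  shows "sum_list (map boxes (map shape Fs)) = N"
proof -
  have un: "(\<Union>F\<in>set Fs. \<Union>(row_sets F)) = {1..N}" and d: "distinct Fs"
    and dj: "\<forall>F\<in>set Fs. \<forall>G\<in>set Fs. F \<noteq> G \<longrightarrow> \<Union>(row_sets F) \<inter> \<Union>(row_sets G) = {}"
    using assms by (simp_all add: filled_ok_def)
  have fin: "\<forall>F\<in>set Fs. finite (\<Union>(row_sets F))"
  proof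
    fix F assume "F \<in> set Fs"
    hence "\<Union>(row_sets F) \<subseteq> {1..N}" unfolding un[symmetric] by blast
    thus "finite (\<Union>(row_sets F))" by (rule finite_subset) simp
  qed
  have "N = card (\<Union>F\<in>set Fs. \<Union>(row_sets F))" unfolding un by simp
  also have "\<dots> = (\<Sum>F\<in>set Fs. card (\<Union>(row_sets F)))" by (rule card_UN_disjoint[OF finite_set fin dj])
  also have "\<dots> = (\<Sum>F\<in>set Fs. boxes (shape F))" using card_Union_row_sets[OF assms] by (intro sum.cong) simp_all
  also have "\<dots> = sum_list (map (\<lambda>F. boxes (shape F)) Fs)" by (rule sum_list_distinct_conv_sum_set[OF d, symmetric])
  finally show ?thesis by (simp add: comp_def)
qed

lemma boxes_pos: "two_coloured_composition D \<Longrightarrow> boxes D \<ge> 1"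
  by (cases D) (auto simp: two_coloured_composition_def boxes_def)

lemma shape_fill_rows: "shape (fill_rows k D) = D"
  by (induction k D rule: fill_rows.induct) (auto simp: shape_def)

lemma shape_fill_diagrams: "map shape (fill_diagrams k Ds) = Ds"
  by (induction k Ds rule: fill_diagrams.induct) (auto simp: shape_fill_rows)

text \<open>The entry \<open>k + 1\<close> belongs to the first diagram, which has at least one box,
  and all entries of the later diagrams are larger.\<close>

lemma distinct_fill_diagrams:
  assumes "\<forall>D\<in>set Ds. two_coloured_composition D"
  shows "distinct (fill_diagrams k Ds)"
  using assms
proof (induction k Ds rule: fill_diagrams.induct)
  case (2 k D Ds)
  have "fill_rows k D \<notin> set (fill_diagrams (k + boxes D) Ds)"
  proof
    assume F: "fill_rows k D \<in> set (fill_diagrams (k + boxes D) Ds)"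
    have "\<Union>(row_sets (fill_rows k D)) \<subseteq> {k + boxes D + 1..k + boxes D + sum_list (map boxes Ds)}"
      using fill_diagrams_props[of Ds "k + boxes D"] 2(2) F by auto
    moreover have "k + 1 \<in> \<Union>(row_sets (fill_rows k D))"
      unfolding fill_rows_Union using boxes_pos[of D] 2(2) by simp
    ultimately have "k + 1 \<in> {k + boxes D + 1..k + boxes D + sum_list (map boxes Ds)}" by (rule subsetD)
    thus False using boxes_pos[of D] 2(2) by simp
  qed
  thus ?case using 2 by simp
qed simp

lemma fill_diagrams_ok:
  assumes "\<forall>D\<in>set Ds. two_coloured_composition D" "sum_list (map boxes Ds) = N"
  shows "filled_ok N (fill_diagrams 0 Ds)"
proof -
  note fp = fill_diagrams_props[OF assms(1), of 0]
  have rows: "F \<noteq> [] \<and> snd (hd F) = Unshaded \<and> distinct (map fst F) \<and> disjoint (row_sets F) \<and> {} \<notin> row_sets F"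
    if F: "F \<in> set (fill_diagrams 0 Ds)" for F
  proof -
    obtain k D where D: "two_coloured_composition D" "F = fill_rows k D" using fp F by blast
    obtain r x E where E: "D = (r, x) # E" using D(1) unfolding two_coloured_composition_def by (metis neq_Nil_conv surj_pair)
    have "x = Unshaded" using D(1) unfolding E two_coloured_composition_def by simp
    hence "F \<noteq> [] \<and> snd (hd F) = Unshaded" unfolding D(2) E by simp
    moreover have "\<forall>(r, x)\<in>set D. r \<ge> 1" using D(1) unfolding two_coloured_composition_def by blast
    ultimately show ?thesis using fill_rows_props[of D k] D(2) by blast
  qed
  show ?thesis
    unfolding filled_ok_def
  proof (intro conjI)
    show "distinct (fill_diagrams 0 Ds)" by (rule distinct_fill_diagrams[OF assms(1)])
    show "\<forall>F\<in>set (fill_diagrams 0 Ds). F \<noteq> [] \<and> snd (hd F) = Unshaded \<and> distinct (map fst F) \<and> disjoint (row_sets F) \<and> {} \<notin> row_sets F"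
      using rows by blast
    show "\<forall>F\<in>set (fill_diagrams 0 Ds). \<forall>G\<in>set (fill_diagrams 0 Ds). F \<noteq> G \<longrightarrow> \<Union>(row_sets F) \<inter> \<Union>(row_sets G) = {}"
      using fp by blast
    have "(\<Union>F\<in>set (fill_diagrams 0 Ds). \<Union>(row_sets F)) = {0 + 1..0 + sum_list (map boxes Ds)}"
      using fp by (rule conjunct1)
    thus "(\<Union>F\<in>set (fill_diagrams 0 Ds). \<Union>(row_sets F)) = {1..N}" using assms(2) by simp
  qed
qed

lemma row_order_nth:
  assumes "distinct (map fst F)" "i < length F" "j < length F"
  shows "(fst (F ! i), fst (F ! j)) \<in> row_order F \<longleftrightarrow> i \<le> j"
proof
  assume "(fst (F ! i), fst (F ! j)) \<in> row_order F"
  then obtain i' j' where *: "fst (F ! i) = fst (F ! i')" "fst (F ! j) = fst (F ! j')" "i' \<le> j'" "j' < length F"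
    unfolding row_order_def by blast
  have "i = i'" "j = j'"
    using * assms nth_eq_iff_index_eq[OF assms(1), of i i'] nth_eq_iff_index_eq[OF assms(1), of j j'] by simp_all
  thus "i \<le> j" using *(3) by simp
qed (use assms in \<open>auto simp: row_order_def\<close>)

lemma shade_parts_nth:
  assumes "distinct (map fst F)" "i < length F" "j < length F"
  shows "(\<exists>t\<in>shade_parts F. fst (F ! i) \<in> t \<and> fst (F ! j) \<in> t) \<longleftrightarrow> snd (F ! i) = snd (F ! j)"
proof -
  have mem: "(fst (F ! i), s) \<in> set F \<longleftrightarrow> s = snd (F ! i)" if "i < length F" for i s
  proof
    assume "(fst (F ! i), s) \<in> set F"
    then obtain j where j: "j < length F" "F ! j = (fst (F ! i), s)" by (auto simp: in_set_conv_nth)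
    hence "j = i" using nth_eq_iff_index_eq[OF assms(1), of j i] that by simp
    thus "s = snd (F ! i)" using arg_cong[OF j(2), of snd] by simp
  next
    assume "s = snd (F ! i)"
    thus "(fst (F ! i), s) \<in> set F" using nth_mem[OF that] by simp
  qed
  have "(\<exists>t\<in>shade_parts F. fst (F ! i) \<in> t \<and> fst (F ! j) \<in> t) \<longleftrightarrow>
    (\<exists>s. (fst (F ! i), s) \<in> set F \<and> (fst (F ! j), s) \<in> set F)"
  proof
    assume "\<exists>t\<in>shade_parts F. fst (F ! i) \<in> t \<and> fst (F ! j) \<in> t"
    then obtain t where t: "t \<in> shade_parts F" "fst (F ! i) \<in> t" "fst (F ! j) \<in> t" by blast
    have "t = {c. (c, Unshaded) \<in> set F} \<or> t = {c. (c, Shaded) \<in> set F}"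
      using t(1) unfolding shade_parts_def by blast
    thus "\<exists>s. (fst (F ! i), s) \<in> set F \<and> (fst (F ! j), s) \<in> set F" using t(2,3) by blast
  next
    assume "\<exists>s. (fst (F ! i), s) \<in> set F \<and> (fst (F ! j), s) \<in> set F"
    then obtain s where s: "(fst (F ! i), s) \<in> set F" "(fst (F ! j), s) \<in> set F" by blast
    have A: "{c. (c, s) \<in> set F} \<in> {{c. (c, Unshaded) \<in> set F}, {c. (c, Shaded) \<in> set F}}"
      by (cases s) (simp_all only: insert_iff simp_thms)
    have B: "{c. (c, s) \<in> set F} \<notin> {{}}" using s(1) by blast
    show "\<exists>t\<in>shade_parts F. fst (F ! i) \<in> t \<and> fst (F ! j) \<in> t"
      unfolding shade_parts_def by (rule bexI[OF _ DiffI[OF A B]]) (use s in simp)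
  qed
  also have "\<dots> \<longleftrightarrow> snd (F ! i) = snd (F ! j)"
    unfolding mem[OF assms(2)] mem[OF assms(3)] by blast
  finally show ?thesis .
qed

text \<open>Evaluates the definite descriptions in \<open>quad_of_filled\<close> and
  \<open>block\<close>: the county of a label is its row and the nation is the union of its diagram.
  The order and the shading thereby become comparisons of positions and shades.\<close>

lemma quad_of_filled_represents:
  assumes ok: "filled_ok N Fs" and SS: "quad_of_filled Fs \<in> SS N"
  shows "represents Fs (quad_le (quad_of_filled Fs)) (quad_shade (quad_of_filled Fs))"
proof -
  define p where "p = (\<lambda>F. \<Union>(row_sets F)) ` set Fs"
  define q where "q = (\<Union>F\<in>set Fs. row_sets F)"
  define diag where "diag = (\<lambda>n. THE F. F \<in> set Fs \<and> \<Union>(row_sets F) = n)"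
  have qf: "quad_of_filled Fs = (p, q, \<lambda>n\<in>p. row_order (diag n), \<lambda>n\<in>p. shade_parts (diag n))"
    unfolding quad_of_filled_def Let_def p_def q_def diag_def ..
  interpret quad_ctx N p q "\<lambda>n\<in>p. row_order (diag n)" "\<lambda>n\<in>p. shade_parts (diag n)"
    by (rule quad_ctx.intro) (use SS qf in simp)
  have ne: "\<Union>(row_sets F) \<noteq> {}" if F: "F \<in> set Fs" for F
  proof -
    have "F \<noteq> []" using ok F unfolding filled_ok_def by blast
    hence "fst (hd F) \<in> row_sets F" by (simp add: row_sets_def)
    thus ?thesis using filled_ok_finite(2)[OF ok F] by blast
  qed
  have diag: "diag (\<Union>(row_sets F)) = F" if F: "F \<in> set Fs" for F
    unfolding diag_def
  proof (rule the_equality)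
    fix G assume G: "G \<in> set Fs \<and> \<Union>(row_sets G) = \<Union>(row_sets F)"
    show "G = F"
    proof (rule ccontr)
      assume "G \<noteq> F"
      hence "\<Union>(row_sets G) \<inter> \<Union>(row_sets F) = {}" using ok F G unfolding filled_ok_def by blast
      thus False using G ne[OF F] by simp
    qed
  qed (use F in simp)
  have blocks: "block q x = fst (Fs ! a ! i)" "block p x = \<Union>(row_sets (Fs ! a))" if x: "in_row Fs a i x" for a i x
  proof -
    have a: "a < length Fs" "i < length (Fs ! a)" "x \<in> fst (Fs ! a ! i)" using x by (auto simp: in_row_def)
    have "fst (Fs ! a ! i) \<in> q" unfolding q_def using a row_sets_nth by (meson UN_I nth_mem)
    thus "block q x = fst (Fs ! a ! i)" using a(3) by (rule county_eqI)
    have "\<Union>(row_sets (Fs ! a)) \<in> p" unfolding p_def using a(1) by simp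
    moreover have "x \<in> \<Union>(row_sets (Fs ! a))" unfolding Union_row_sets_iff using a(2,3) by blast
    ultimately show "block p x = \<Union>(row_sets (Fs ! a))" by (rule nation_eqI)
  qed
  show ?thesis
    unfolding represents_def
  proof (intro allI impI)
    fix x y a i b j assume x: "in_row Fs a i x" and y: "in_row Fs b j y"
    have l: "a < length Fs" "b < length Fs" "i < length (Fs ! a)" "j < length (Fs ! b)" using x y by (auto simp: in_row_def)
    have m: "Fs ! a \<in> set Fs" "Fs ! b \<in> set Fs" using l by simp_all
    have pm: "\<Union>(row_sets (Fs ! a)) \<in> p" using m by (simp add: p_def)
    have d: "distinct (map fst (Fs ! a))" using ok m unfolding filled_ok_def by blast
    have same: "block p x = block p y \<longleftrightarrow> a = b"
    proof
      assume e: "block p x = block p y"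
      have "diag (block p x) = Fs ! a" "diag (block p y) = Fs ! b"
        using diag m blocks(2)[OF x] blocks(2)[OF y] by simp_all
      hence "Fs ! a = Fs ! b" using e by simp
      thus "a = b" using ok l by (simp add: filled_ok_def nth_eq_iff_index_eq)
    next
      assume "a = b"
      thus "block p x = block p y" unfolding blocks(2)[OF x] blocks(2)[OF y] by simp
    qed
    show "(quad_le (quad_of_filled Fs) x y \<longleftrightarrow> a = b \<and> i \<le> j) \<and>
      (quad_shade (quad_of_filled Fs) x y \<longleftrightarrow> a = b \<and> snd (Fs ! a ! i) = snd (Fs ! b ! j))"
    proof (cases "a = b")
      case True
      have j: "j < length (Fs ! a)" using l True by simp
      have "(quad_le (quad_of_filled Fs) x y \<longleftrightarrow> (fst (Fs ! a ! i), fst (Fs ! a ! j)) \<in> row_order (Fs ! a))"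
        unfolding qf le_iff blocks(1)[OF x] blocks(1)[OF y] blocks(2)[OF x] blocks(2)[OF y] using True pm diag[OF m(1)] by simp
      moreover have "quad_shade (quad_of_filled Fs) x y \<longleftrightarrow>
          (\<exists>t\<in>shade_parts (Fs ! a). fst (Fs ! a ! i) \<in> t \<and> fst (Fs ! a ! j) \<in> t)"
        unfolding qf shd_iff blocks(1)[OF x] blocks(1)[OF y] blocks(2)[OF x] blocks(2)[OF y] using True pm diag[OF m(1)] by simp
      ultimately show ?thesis
        unfolding row_order_nth[OF d l(3) j] shade_parts_nth[OF d l(3) j] using True by simp
    next
      case False
      thus ?thesis unfolding qf le_iff shd_iff same by simp
    qed
  qed
qed

text \<open>Rows at the same position have the same length. Bijections from the rows of
  \<open>Gs\<close> to those of \<open>Fs\<close> are glued to \<open>w\<close>, which keeps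
  positions and shades, and the represented relations depend on nothing else.\<close>

lemma same_shape_isomorphic:
  assumes F: "filled_ok N Fs" "represents Fs L S" and G: "filled_ok N Gs" "represents Gs L' S'"
    and sh: "map shape Fs = map shape Gs"
  shows "\<exists>w. w permutes {1..N} \<and> (\<forall>x\<in>{1..N}. \<forall>y\<in>{1..N}. (L (w x) (w y) \<longleftrightarrow> L' x y) \<and> (S (w x) (w y) \<longleftrightarrow> S' x y))"
proof -
  have len: "length Fs = length Gs" using arg_cong[OF sh, of length] by simp
  have sh_a: "shape (Fs ! a) = shape (Gs ! a)" if "a < length Gs" for a
    using arg_cong[OF sh, of "\<lambda>xs. xs ! a"] that len by simp
  have len_a: "length (Fs ! a) = length (Gs ! a)" if "a < length Gs" for a
    using arg_cong[OF sh_a[OF that], of length] by (simp add: shape_nth)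
  have row: "card (fst (Fs ! a ! i)) = card (fst (Gs ! a ! i))" "snd (Fs ! a ! i) = snd (Gs ! a ! i)"
    if "a < length Gs" "i < length (Gs ! a)" for a i
    using arg_cong[OF sh_a[OF that(1)], of "\<lambda>D. D ! i"] that len_a[OF that(1)] by (simp_all add: shape_nth)
  have "\<exists>f. bij_betw f (fst (Gs ! a ! i)) (fst (Fs ! a ! i))" if ai: "a < length Gs" "i < length (Gs ! a)" for a i
  proof -
    have "finite (fst (Gs ! a ! i))" "finite (fst (Fs ! a ! i))"
      using filled_ok_finite(1)[OF G(1) nth_mem[OF ai(1)] row_sets_nth[OF ai(2)]]
        filled_ok_finite(1)[OF F(1) nth_mem row_sets_nth] ai len len_a by auto
    thus ?thesis using row(1)[OF ai] by (intro finite_same_card_bij) simp_all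
  qed
  then obtain f where f: "bij_betw (f a i) (fst (Gs ! a ! i)) (fst (Fs ! a ! i))" if "a < length Gs" "i < length (Gs ! a)" for a i
    by metis
  have "\<forall>x\<in>{1..N}. \<exists>c. in_row Gs (fst c) (snd c) x" using filled_ok_in_row(2)[OF G(1)] by simp
  then obtain cell where cell: "\<forall>x\<in>{1..N}. in_row Gs (fst (cell x)) (snd (cell x)) x" by (rule bchoice[THEN exE])
  \<comment> \<open>The identity outside the interval is what \<open>permutes\<close>
    demands.\<close>
  define w where "w = (\<lambda>x. if x \<in> {1..N} then f (fst (cell x)) (snd (cell x)) x else x)"
  have w_row: "in_row Fs (fst (cell x)) (snd (cell x)) (w x)" if x: "x \<in> {1..N}" for x
  proof -
    have c: "fst (cell x) < length Gs" "snd (cell x) < length (Gs ! fst (cell x))" "x \<in> fst (Gs ! fst (cell x) ! snd (cell x))"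
      using cell x unfolding in_row_def by blast+
    show ?thesis using bij_betwE[OF f[OF c(1,2)]] c x len len_a[OF c(1)] by (simp add: in_row_def w_def)
  qed
  have into: "w ` {1..N} \<subseteq> {1..N}" using filled_ok_in_row(1)[OF F(1) w_row] by blast
  have inj: "inj_on w {1..N}"
  proof (rule inj_onI)
    fix x y assume xy: "x \<in> {1..N}" "y \<in> {1..N}" "w x = w y"
    have e: "cell x = cell y"
      using filled_ok_in_row(3)[OF F(1) w_row[OF xy(1)] w_row[OF xy(2), folded xy(3)]] by (simp add: prod_eq_iff)
    have cx: "fst (cell x) < length Gs" "snd (cell x) < length (Gs ! fst (cell x))" "x \<in> fst (Gs ! fst (cell x) ! snd (cell x))"
      using cell xy(1) unfolding in_row_def by blast+
    have cy: "y \<in> fst (Gs ! fst (cell x) ! snd (cell x))" using cell xy(2) unfolding in_row_def e by blast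
    have "f (fst (cell x)) (snd (cell x)) x = f (fst (cell x)) (snd (cell x)) y" using xy e by (simp add: w_def)
    thus "x = y" using bij_betw_imp_inj_on[OF f[OF cx(1,2)]] cx(3) cy by (auto dest: inj_onD)
  qed
  have "w ` {1..N} = {1..N}" by (rule endo_inj_surj[OF finite_atLeastAtMost into inj])
  hence "bij_betw w {1..N} {1..N}" using inj by (simp add: bij_betw_def)
  moreover have "w x = x" if "x \<notin> {1..N}" for x using that unfolding w_def by (rule if_not_P)
  ultimately have perm: "w permutes {1..N}" by (rule bij_imp_permutes)
  have "(L (w x) (w y) \<longleftrightarrow> L' x y) \<and> (S (w x) (w y) \<longleftrightarrow> S' x y)" if xy: "x \<in> {1..N}" "y \<in> {1..N}" for x y
  proof -
    have c: "in_row Gs (fst (cell x)) (snd (cell x)) x" "in_row Gs (fst (cell y)) (snd (cell y)) y" using cell xy by blast+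
    have r: "snd (Fs ! fst (cell x) ! snd (cell x)) = snd (Gs ! fst (cell x) ! snd (cell x))"
      "snd (Fs ! fst (cell y) ! snd (cell y)) = snd (Gs ! fst (cell y) ! snd (cell y))"
      using row(2) c unfolding in_row_def by blast+
    note a = F(2)[unfolded represents_def, rule_format, OF w_row[OF xy(1)] w_row[OF xy(2)]]
    note b = G(2)[unfolded represents_def, rule_format, OF c]
    show ?thesis using a b r by metis
  qed
  thus ?thesis using perm by blast
qed

section \<open>Recovering the diagrams from a nation structure\<close>

text \<open>
  A row of a diagram is determined by the number of boxes above it, its length and its shade,
  all of which can be expressed by the relations alone.
\<close>

definition le_before :: "nat \<Rightarrow> (nat \<Rightarrow> nat \<Rightarrow> bool) \<Rightarrow> nat \<Rightarrow> nat" where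
  "le_before N L y = card {z \<in> {1..N}. strict L z y}"

definition county_size :: "nat \<Rightarrow> (nat \<Rightarrow> nat \<Rightarrow> bool) \<Rightarrow> nat \<Rightarrow> nat" where
  "county_size N L y = card {z \<in> {1..N}. L z y \<and> L y z}"

text \<open>The condition on \<open>u\<close> says that \<open>z\<close> lies in the first county of
  its nation, the one drawn as the unshaded top row; \<open>S z y\<close> makes this the nation of
  \<open>y\<close>.\<close>

definition shade_of :: "nat \<Rightarrow> (nat \<Rightarrow> nat \<Rightarrow> bool) \<Rightarrow> (nat \<Rightarrow> nat \<Rightarrow> bool) \<Rightarrow> nat \<Rightarrow> shade" where
  "shade_of N L S y =
     (if \<exists>z\<in>{1..N}. (\<forall>u\<in>{1..N}. conn L z u \<longrightarrow> L z u) \<and> S z y then Unshaded else Shaded)"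

text \<open>A set is enough: all labels of a row give the same triple, and different rows of a
  nation differ in the first component because rows are not empty.\<close>

definition nation_profile :: "nat \<Rightarrow> (nat \<Rightarrow> nat \<Rightarrow> bool) \<Rightarrow> (nat \<Rightarrow> nat \<Rightarrow> bool) \<Rightarrow> nat \<Rightarrow> (nat \<times> nat \<times> shade) set" where
  "nation_profile N L S x = (\<lambda>y. (le_before N L y, county_size N L y, shade_of N L S y)) ` {y \<in> {1..N}. conn L x y}"

fun offsets :: "nat \<Rightarrow> diagram \<Rightarrow> (nat \<times> nat \<times> shade) set" where
  "offsets k [] = {}"
| "offsets k ((r, s) # D) = insert (k, r, s) (offsets (k + r) D)"

lemma offsets_ge: "(m, r, s) \<in> offsets k D \<Longrightarrow> k \<le> m"
  by (induction k D rule: offsets.induct) auto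

text \<open>Rows have positive length, so the first row is the only one at offset \<open>k\<close>.
  It can be read off and removed from both sets.\<close>

lemma offsets_inj:
  assumes "\<forall>(r, x)\<in>set D. r \<ge> 1" "\<forall>(r, x)\<in>set E. r \<ge> 1" "offsets k D = offsets k E"
  shows "D = E"
  using assms
proof (induction k D arbitrary: E rule: offsets.induct)
  case (1 k)
  thus ?case by (cases E) auto
next
  case (2 k r s D)
  have "E \<noteq> []" using 2(4) by auto
  then obtain r' s' E' where E: "E = (r', s') # E'" by (metis neq_Nil_conv surj_pair)
  have pos: "r \<ge> 1" "r' \<ge> 1" using 2(2,3) unfolding E by auto
  have eq: "insert (k, r, s) (offsets (k + r) D) = insert (k, r', s') (offsets (k + r') E')" using 2(4) unfolding E by simp
  have no: "(k, u) \<notin> offsets (k + r) D" "(k, u) \<notin> offsets (k + r') E'" for u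
    using offsets_ge[of k "fst u" "snd u"] pos by fastforce+
  have "(k, r, s) \<in> insert (k, r', s') (offsets (k + r') E')" unfolding eq[symmetric] by simp
  hence rs: "r' = r" "s' = s" using no(2) by auto
  have "offsets (k + r) D = offsets (k + r) E'"
    using eq no unfolding rs by (metis insert_ident)
  hence "D = E'" using 2(1)[of E'] 2(2,3) unfolding E by auto
  thus ?case unfolding E rs by simp
qed

lemma offsets_nth: "offsets k D = (\<lambda>i. (k + (\<Sum>j<i. fst (D ! j)), D ! i)) ` {..<length D}"
proof (induction k D rule: offsets.induct)
  case (2 k r s D)
  have "offsets k ((r, s) # D) = insert (k, r, s) ((\<lambda>i. (k + r + (\<Sum>j<i. fst (D ! j)), D ! i)) ` {..<length D})"
    by (simp add: 2)
  also have "\<dots> = (\<lambda>i. (k + (\<Sum>j<i. fst (((r, s) # D) ! j)), ((r, s) # D) ! i)) ` insert 0 (Suc ` {..<length D})"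
    by (simp add: image_image sum.lessThan_Suc_shift add.assoc del: sum.lessThan_Suc)
  also have "insert 0 (Suc ` {..<length D}) = {..<length ((r, s) # D)}"
    by (simp add: lessThan_Suc_eq_insert_0)
  finally show ?case .
qed simp

lemma representsD:
  assumes "represents Fs L S" "in_row Fs a i x" "in_row Fs b j y"
  shows "L x y \<longleftrightarrow> a = b \<and> i \<le> j" "S x y \<longleftrightarrow> a = b \<and> snd (Fs ! a ! i) = snd (Fs ! b ! j)"
    "conn L x y \<longleftrightarrow> a = b" "strict L x y \<longleftrightarrow> a = b \<and> i < j"
proof -
  note r = assms(1)[unfolded represents_def, rule_format]
  show 1: "L x y \<longleftrightarrow> a = b \<and> i \<le> j" using r[OF assms(2,3)] by blast
  show "S x y \<longleftrightarrow> a = b \<and> snd (Fs ! a ! i) = snd (Fs ! b ! j)" using r[OF assms(2,3)] by blast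
  have 2: "L y x \<longleftrightarrow> b = a \<and> j \<le> i" using r[OF assms(3,2)] by blast
  show "conn L x y \<longleftrightarrow> a = b" unfolding conn_def 1 2 by auto
  show "strict L x y \<longleftrightarrow> a = b \<and> i < j" unfolding strict_def 1 2 by auto
qed

lemma filled_row_witness:
  assumes "filled_ok N Fs" "a < length Fs" "i < length (Fs ! a)"
  obtains x where "in_row Fs a i x" "x \<in> {1..N}"
proof -
  have "fst (Fs ! a ! i) \<noteq> {}" using filled_ok_finite(2)[OF assms(1) nth_mem[OF assms(2)] row_sets_nth[OF assms(3)]] .
  then obtain x where "x \<in> fst (Fs ! a ! i)" by blast
  hence "in_row Fs a i x" using assms(2,3) by (simp add: in_row_def)
  thus ?thesis using that filled_ok_in_row(1)[OF assms(1)] by blast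
qed

lemma row_statistics:
  assumes ok: "filled_ok N Fs" and rep: "represents Fs L S" and y: "in_row Fs a i y"
  shows "(le_before N L y, county_size N L y, shade_of N L S y) =
    (0 + (\<Sum>j<i. fst (shape (Fs ! a) ! j)), shape (Fs ! a) ! i)"
proof -
  have a: "a < length Fs" "i < length (Fs ! a)" "Fs ! a \<in> set Fs" using y by (auto simp: in_row_def)
  have rowN: "in_row Fs a j z \<longleftrightarrow> z \<in> fst (Fs ! a ! j)" if "j < length (Fs ! a)" for j z
    using that a by (simp add: in_row_def)
  have loc: "\<exists>b j. in_row Fs b j z" if "z \<in> {1..N}" for z using filled_ok_in_row(2)[OF ok that] .
  have "{z \<in> {1..N}. strict L z y} = (\<Union>j<i. fst (Fs ! a ! j))"
  proof (rule Set.set_eqI)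
    fix z
    show "z \<in> {z \<in> {1..N}. strict L z y} \<longleftrightarrow> z \<in> (\<Union>j<i. fst (Fs ! a ! j))"
    proof
      assume "z \<in> {z \<in> {1..N}. strict L z y}"
      hence z: "z \<in> {1..N}" "strict L z y" by blast+
      obtain b j where bj: "in_row Fs b j z" using loc[OF z(1)] by blast
      have "b = a" "j < i" using representsD(4)[OF rep bj y] z(2) by blast+
      thus "z \<in> (\<Union>j<i. fst (Fs ! a ! j))" using bj unfolding in_row_def by blast
    next
      assume "z \<in> (\<Union>j<i. fst (Fs ! a ! j))"
      then obtain j where j: "j < i" "z \<in> fst (Fs ! a ! j)" by blast
      hence bj: "in_row Fs a j z" using rowN[of j z] a by simp
      show "z \<in> {z \<in> {1..N}. strict L z y}"
        using representsD(4)[OF rep bj y] j(1) filled_ok_in_row(1)[OF ok bj] by blast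
    qed
  qed
  moreover have "card (\<Union>j<i. fst (Fs ! a ! j)) = (\<Sum>j<i. card (fst (Fs ! a ! j)))"
  proof (rule card_UN_disjoint)
    show "\<forall>j\<in>{..<i}. finite (fst (Fs ! a ! j))"
      using filled_ok_finite(1)[OF ok a(3) row_sets_nth] a(2) by simp
    show "\<forall>j\<in>{..<i}. \<forall>k\<in>{..<i}. j \<noteq> k \<longrightarrow> fst (Fs ! a ! j) \<inter> fst (Fs ! a ! k) = {}"
    proof (intro ballI impI equals0I)
      fix j k z assume jk: "j \<in> {..<i}" "k \<in> {..<i}" "j \<noteq> k" and z: "z \<in> fst (Fs ! a ! j) \<inter> fst (Fs ! a ! k)"
      have "in_row Fs a j z" "in_row Fs a k z" using rowN[of j z] rowN[of k z] jk z a(2) by simp_all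
      thus False using filled_ok_in_row(3)[OF ok] jk(3) by blast
    qed
  qed simp
  moreover have "(\<Sum>j<i. card (fst (Fs ! a ! j))) = (\<Sum>j<i. fst (shape (Fs ! a) ! j))"
    using a(2) by (intro sum.cong) (simp_all add: shape_nth)
  ultimately have 1: "le_before N L y = (\<Sum>j<i. fst (shape (Fs ! a) ! j))" by (simp add: le_before_def)
  have "{z \<in> {1..N}. L z y \<and> L y z} = fst (Fs ! a ! i)"
  proof (rule Set.set_eqI)
    fix z
    show "z \<in> {z \<in> {1..N}. L z y \<and> L y z} \<longleftrightarrow> z \<in> fst (Fs ! a ! i)"
    proof
      assume "z \<in> {z \<in> {1..N}. L z y \<and> L y z}"
      hence z: "z \<in> {1..N}" "L z y" "L y z" by blast+
      obtain b j where bj: "in_row Fs b j z" using loc[OF z(1)] by blast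
      have "b = a" "j = i" using representsD(1)[OF rep bj y] representsD(1)[OF rep y bj] z(2,3) by auto
      thus "z \<in> fst (Fs ! a ! i)" using bj unfolding in_row_def by blast
    next
      assume "z \<in> fst (Fs ! a ! i)"
      hence bj: "in_row Fs a i z" using rowN[OF a(2)] by simp
      show "z \<in> {z \<in> {1..N}. L z y \<and> L y z}"
        using representsD(1)[OF rep bj y] representsD(1)[OF rep y bj] filled_ok_in_row(1)[OF ok bj] by blast
    qed
  qed
  hence 2: "county_size N L y = fst (shape (Fs ! a) ! i)" using a(2) by (simp add: county_size_def shape_nth)
  have ne: "Fs ! a \<noteq> []" "snd (Fs ! a ! 0) = Unshaded"
    using ok a(3) unfolding filled_ok_def by (metis hd_conv_nth)+
  have "(\<exists>z\<in>{1..N}. (\<forall>u\<in>{1..N}. conn L z u \<longrightarrow> L z u) \<and> S z y) \<longleftrightarrow> snd (Fs ! a ! i) = Unshaded"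
  proof
    assume "\<exists>z\<in>{1..N}. (\<forall>u\<in>{1..N}. conn L z u \<longrightarrow> L z u) \<and> S z y"
    then obtain z where z: "z \<in> {1..N}" "\<forall>u\<in>{1..N}. conn L z u \<longrightarrow> L z u" "S z y" by blast
    obtain b j where bj: "in_row Fs b j z" using loc[OF z(1)] by blast
    have b: "b = a" "snd (Fs ! b ! j) = snd (Fs ! a ! i)" using representsD(2)[OF rep bj y] z(3) by blast+
    obtain u where u: "in_row Fs a 0 u" "u \<in> {1..N}"
      by (rule filled_row_witness[OF ok a(1), of 0]) (use ne in auto)
    \<comment> \<open>\<open>z\<close> precedes everything in its nation, in particular a label of
      the top row; hence its own row is the top row, which is unshaded.\<close>
    have "L z u" using z(2) u(2) representsD(3)[OF rep bj u(1)] b(1) by blast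
    hence "j = 0" using representsD(1)[OF rep bj u(1)] by simp
    thus "snd (Fs ! a ! i) = Unshaded" using b ne(2) by simp
  next
    assume s: "snd (Fs ! a ! i) = Unshaded"
    obtain z where z: "in_row Fs a 0 z" "z \<in> {1..N}"
      by (rule filled_row_witness[OF ok a(1), of 0]) (use ne in auto)
    have "L z u" if u: "u \<in> {1..N}" "conn L z u" for u
    proof -
      obtain b j where bj: "in_row Fs b j u" using loc[OF u(1)] by blast
      show ?thesis using representsD(3)[OF rep z(1) bj] representsD(1)[OF rep z(1) bj] u(2) by simp
    qed
    moreover have "S z y" using representsD(2)[OF rep z(1) y] s ne(2) by simp
    ultimately show "\<exists>z\<in>{1..N}. (\<forall>u\<in>{1..N}. conn L z u \<longrightarrow> L z u) \<and> S z y" using z(2) by blast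
  qed
  hence 3: "shade_of N L S y = snd (shape (Fs ! a) ! i)"
    using a(2) by (cases "snd (Fs ! a ! i)") (simp_all add: shade_of_def shape_nth)
  show ?thesis using 1 2 3 by (simp add: prod_eq_iff)
qed

lemma nation_profile_represents:
  assumes ok: "filled_ok N Fs" and rep: "represents Fs L S" and x: "in_row Fs a k x"
  shows "nation_profile N L S x = offsets 0 (shape (Fs ! a))"
proof -
  have a: "a < length Fs" using x by (simp add: in_row_def)
  show ?thesis
    unfolding nation_profile_def offsets_nth
  proof (intro equalityI subsetI)
    fix t assume "t \<in> (\<lambda>y. (le_before N L y, county_size N L y, shade_of N L S y)) ` {y \<in> {1..N}. conn L x y}"
    then obtain y where y: "y \<in> {1..N}" "conn L x y" "t = (le_before N L y, county_size N L y, shade_of N L S y)" by blast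
    obtain b i where bi: "in_row Fs b i y" using filled_ok_in_row(2)[OF ok y(1)] by blast
    have "b = a" using representsD(3)[OF rep x bi] y(2) by simp
    hence bi: "in_row Fs a i y" using bi by simp
    hence "i \<in> {..<length (shape (Fs ! a))}" by (simp add: in_row_def shape_nth)
    thus "t \<in> (\<lambda>i. (0 + (\<Sum>j<i. fst (shape (Fs ! a) ! j)), shape (Fs ! a) ! i)) ` {..<length (shape (Fs ! a))}"
      unfolding y(3) row_statistics[OF ok rep bi] by (rule imageI)
  next
    fix t assume "t \<in> (\<lambda>i. (0 + (\<Sum>j<i. fst (shape (Fs ! a) ! j)), shape (Fs ! a) ! i)) ` {..<length (shape (Fs ! a))}"
    then obtain i where i: "i < length (Fs ! a)" "t = (0 + (\<Sum>j<i. fst (shape (Fs ! a) ! j)), shape (Fs ! a) ! i)"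
      by (auto simp: shape_nth)
    obtain y where y: "in_row Fs a i y" "y \<in> {1..N}" by (rule filled_row_witness[OF ok a i(1)])
    have "y \<in> {y \<in> {1..N}. conn L x y}" using y(2) representsD(3)[OF rep x y(1)] by blast
    thus "t \<in> (\<lambda>y. (le_before N L y, county_size N L y, shade_of N L S y)) ` {y \<in> {1..N}. conn L x y}"
      unfolding i(2) row_statistics[OF ok rep y(1), symmetric] by (rule imageI)
  qed
qed

text \<open>A nation of shape \<open>E\<close> contributes all of its labels, \<open>boxes E\<close>
  in number, and other nations contribute none, since \<open>offsets\<close> is injective. Counting
  labels instead of nations makes the invariance under permutations immediate.\<close>

lemma count_shapes:
  assumes ok: "filled_ok N Fs" and rep: "represents Fs L S" and E: "two_coloured_composition E"
  shows "card {x \<in> {1..N}. nation_profile N L S x = offsets 0 E} = count (mset (map shape Fs)) E * boxes E"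
proof -
  have d: "distinct Fs" and dj: "\<forall>F\<in>set Fs. \<forall>G\<in>set Fs. F \<noteq> G \<longrightarrow> \<Union>(row_sets F) \<inter> \<Union>(row_sets G) = {}"
    using ok by (simp_all add: filled_ok_def)
  define A where "A = {F \<in> set Fs. shape F = E}"
  have "{x \<in> {1..N}. nation_profile N L S x = offsets 0 E} = (\<Union>F\<in>A. \<Union>(row_sets F))"
  proof (rule Set.set_eqI)
    fix x
    have shape_iff: "nation_profile N L S x = offsets 0 E \<longleftrightarrow> shape (Fs ! a) = E" if x: "in_row Fs a k x" for a k
    proof -
      have "two_coloured_composition (shape (Fs ! a))"
        using shape_two_coloured[OF ok] x by (simp add: in_row_def)
      hence "offsets 0 (shape (Fs ! a)) = offsets 0 E \<longleftrightarrow> shape (Fs ! a) = E"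
        using offsets_inj[of "shape (Fs ! a)" E 0] E unfolding two_coloured_composition_def by blast
      thus ?thesis unfolding nation_profile_represents[OF ok rep x] .
    qed
    show "x \<in> {x \<in> {1..N}. nation_profile N L S x = offsets 0 E} \<longleftrightarrow> x \<in> (\<Union>F\<in>A. \<Union>(row_sets F))"
    proof
      assume "x \<in> {x \<in> {1..N}. nation_profile N L S x = offsets 0 E}"
      hence x: "x \<in> {1..N}" "nation_profile N L S x = offsets 0 E" by blast+
      obtain a k where ak: "in_row Fs a k x" using filled_ok_in_row(2)[OF ok x(1)] by blast
      have "Fs ! a \<in> A" using shape_iff[OF ak] x(2) ak by (simp add: A_def in_row_def)
      moreover have "x \<in> \<Union>(row_sets (Fs ! a))" unfolding Union_row_sets_iff using ak unfolding in_row_def by blast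
      ultimately show "x \<in> (\<Union>F\<in>A. \<Union>(row_sets F))" by (rule UN_I)
    next
      assume "x \<in> (\<Union>F\<in>A. \<Union>(row_sets F))"
      then obtain F where F: "F \<in> A" "x \<in> \<Union>(row_sets F)" by (rule UN_E)
      obtain a where a: "a < length Fs" "F = Fs ! a" using F(1) unfolding A_def in_set_conv_nth by blast
      obtain k where "k < length F" "x \<in> fst (F ! k)" using F(2) unfolding Union_row_sets_iff by blast
      hence ak: "in_row Fs a k x" using a by (simp add: in_row_def)
      have "shape (Fs ! a) = E" using F(1) a(2) by (simp add: A_def)
      thus "x \<in> {x \<in> {1..N}. nation_profile N L S x = offsets 0 E}"
        using shape_iff[OF ak] filled_ok_in_row(1)[OF ok ak] by blast
    qed
  qed
  moreover have "card (\<Union>F\<in>A. \<Union>(row_sets F)) = (\<Sum>F\<in>A. card (\<Union>(row_sets F)))"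
  proof (rule card_UN_disjoint)
    show "finite A" by (simp add: A_def)
    show "\<forall>F\<in>A. finite (\<Union>(row_sets F))"
    proof
      fix F assume "F \<in> A"
      hence "\<Union>(row_sets F) \<subseteq> {1..N}" using filled_ok_finite(3)[OF ok] unfolding A_def by blast
      thus "finite (\<Union>(row_sets F))" by (rule finite_subset) simp
    qed
    show "\<forall>F\<in>A. \<forall>G\<in>A. F \<noteq> G \<longrightarrow> \<Union>(row_sets F) \<inter> \<Union>(row_sets G) = {}" using dj unfolding A_def by blast
  qed
  moreover have "(\<Sum>F\<in>A. card (\<Union>(row_sets F))) = card A * boxes E"
  proof -
    have "(\<Sum>F\<in>A. card (\<Union>(row_sets F))) = (\<Sum>F\<in>A. boxes E)"
      using card_Union_row_sets[OF ok] by (intro sum.cong) (auto simp: A_def)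
    thus ?thesis by simp
  qed
  moreover have "card A = count (mset (map shape Fs)) E"
  proof -
    have "A = set (filter (\<lambda>F. shape F = E) Fs)" by (auto simp: A_def)
    moreover have "card (set (filter (\<lambda>F. shape F = E) Fs)) = length (filter (\<lambda>F. shape F = E) Fs)"
      by (rule distinct_card) (rule distinct_filter[OF d])
    ultimately have "card A = length (filter (\<lambda>F. shape F = E) Fs)" by (simp only:)
    also have "\<dots> = count (mset (map shape Fs)) E" by (induction Fs) auto
    finally show ?thesis .
  qed
  ultimately show ?thesis by simp
qed

lemma permutes_Collect_image:
  assumes "w permutes A"
  shows "{z \<in> A. P z} = w ` {z \<in> A. P (w z)}"
proof (intro equalityI subsetI)
  fix z assume z: "z \<in> {z \<in> A. P z}"
  hence "z \<in> w ` A" unfolding permutes_image[OF assms] by blast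
  then obtain u where "z = w u" "u \<in> A" by (rule imageE)
  thus "z \<in> w ` {z \<in> A. P (w z)}" using z by blast
next
  fix z assume "z \<in> w ` {z \<in> A. P (w z)}"
  then obtain u where "z = w u" "u \<in> A" "P (w u)" by blast
  thus "z \<in> {z \<in> A. P z}" using permutes_in_image[OF assms, of u] by simp
qed

lemma nation_profile_invariant:
  assumes w: "w permutes {1..N}" and x: "x \<in> {1..N}"
    and iso: "\<And>x y. x \<in> {1..N} \<Longrightarrow> y \<in> {1..N} \<Longrightarrow> (L (w x) (w y) \<longleftrightarrow> L' x y) \<and> (S (w x) (w y) \<longleftrightarrow> S' x y)"
  shows "nation_profile N L S (w x) = nation_profile N L' S' x"
proof -
  have inj: "inj w" using w by (rule permutes_inj)
  have wI: "w z \<in> {1..N}" if "z \<in> {1..N}" for z using that permutes_in_image[OF w] by blast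
  have pre: "\<exists>u\<in>{1..N}. z = w u" if "z \<in> {1..N}" for z
  proof -
    have "z \<in> w ` {1..N}" using that unfolding permutes_image[OF w] .
    thus ?thesis by (rule imageE) (rule bexI)
  qed
  note set_w = permutes_Collect_image[OF w]
  have card_w: "card {z \<in> {1..N}. P z} = card {z \<in> {1..N}. P (w z)}" for P
    unfolding set_w[of P] by (rule card_image) (rule inj_on_subset[OF inj subset_UNIV])
  have bex_w: "(\<exists>z\<in>{1..N}. P z) \<longleftrightarrow> (\<exists>z\<in>{1..N}. P (w z))" for P using pre wI by metis
  have ball_w: "(\<forall>z\<in>{1..N}. P z) \<longleftrightarrow> (\<forall>z\<in>{1..N}. P (w z))" for P using pre wI by metis
  have rel: "L (w x) (w y) \<longleftrightarrow> L' x y" "S (w x) (w y) \<longleftrightarrow> S' x y" "conn L (w x) (w y) \<longleftrightarrow> conn L' x y"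
    "strict L (w x) (w y) \<longleftrightarrow> strict L' x y" if "x \<in> {1..N}" "y \<in> {1..N}" for x y
    using iso[OF that] iso[OF that(2,1)] by (simp_all add: conn_def strict_def)
  have stat: "le_before N L (w y) = le_before N L' y" "county_size N L (w y) = county_size N L' y"
    "shade_of N L S (w y) = shade_of N L' S' y" if y: "y \<in> {1..N}" for y
  proof -
    have "{z \<in> {1..N}. strict L (w z) (w y)} = {z \<in> {1..N}. strict L' z y}"
      by (rule Collect_cong, rule conj_cong[OF refl]) (rule rel(4)[OF _ y])
    thus "le_before N L (w y) = le_before N L' y" unfolding le_before_def card_w[of "\<lambda>z. strict L z (w y)"] by simp
    have "{z \<in> {1..N}. L (w z) (w y) \<and> L (w y) (w z)} = {z \<in> {1..N}. L' z y \<and> L' y z}"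
      by (rule Collect_cong, rule conj_cong[OF refl]) (simp only: rel(1)[OF _ y] rel(1)[OF y])
    thus "county_size N L (w y) = county_size N L' y" unfolding county_size_def card_w[of "\<lambda>z. L z (w y) \<and> L (w y) z"] by simp
    have "(\<exists>z\<in>{1..N}. (\<forall>u\<in>{1..N}. conn L z u \<longrightarrow> L z u) \<and> S z (w y)) \<longleftrightarrow>
      (\<exists>z\<in>{1..N}. (\<forall>u\<in>{1..N}. conn L (w z) u \<longrightarrow> L (w z) u) \<and> S (w z) (w y))"
      by (rule bex_w)
    also have "\<dots> \<longleftrightarrow> (\<exists>z\<in>{1..N}. (\<forall>u\<in>{1..N}. conn L (w z) (w u) \<longrightarrow> L (w z) (w u)) \<and> S (w z) (w y))"
      by (subst ball_w) (rule refl)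
    also have "\<dots> \<longleftrightarrow> (\<exists>z\<in>{1..N}. (\<forall>u\<in>{1..N}. conn L' z u \<longrightarrow> L' z u) \<and> S' z y)"
      using rel(1,3) rel(2)[OF _ y] by (intro bex_cong refl conj_cong ball_cong) simp_all
    finally show "shade_of N L S (w y) = shade_of N L' S' y" unfolding shade_of_def by simp
  qed
  have dom: "{y \<in> {1..N}. conn L (w x) y} = w ` {y \<in> {1..N}. conn L' x y}"
    unfolding set_w[of "conn L (w x)"]
    by (rule arg_cong[of _ _ "image w"], rule Collect_cong, rule conj_cong[OF refl]) (rule rel(3)[OF x])
  show ?thesis
    unfolding nation_profile_def dom image_image by (rule image_cong) (use stat in simp_all)
qed

text \<open>By \<open>count_shapes\<close> both multiplicities of \<open>E\<close>, multiplied by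
  \<open>boxes E\<close>, are the number of labels with profile \<open>offsets 0 E\<close>, which
  \<open>w\<close> preserves; \<open>boxes E\<close> is positive and cancels.\<close>

lemma isomorphic_same_shapes:
  assumes F: "filled_ok N Fs" "represents Fs L S" and G: "filled_ok N Gs" "represents Gs L' S'"
    and w: "w permutes {1..N}"
    and iso: "\<And>x y. x \<in> {1..N} \<Longrightarrow> y \<in> {1..N} \<Longrightarrow> (L (w x) (w y) \<longleftrightarrow> L' x y) \<and> (S (w x) (w y) \<longleftrightarrow> S' x y)"
  shows "mset (map shape Fs) = mset (map shape Gs)"
proof (rule multiset_eqI)
  fix E
  show "count (mset (map shape Fs)) E = count (mset (map shape Gs)) E"
  proof (cases "two_coloured_composition E")
    case True
    have "{x \<in> {1..N}. nation_profile N L S x = offsets 0 E} = w ` {x \<in> {1..N}. nation_profile N L S (w x) = offsets 0 E}"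
      by (rule permutes_Collect_image[OF w])
    also have "{x \<in> {1..N}. nation_profile N L S (w x) = offsets 0 E} = {x \<in> {1..N}. nation_profile N L' S' x = offsets 0 E}"
    proof (rule Collect_cong, rule conj_cong[OF refl])
      fix x assume x: "x \<in> {1..N}"
      have "nation_profile N L S (w x) = nation_profile N L' S' x"
        by (rule nation_profile_invariant[OF w x]) (rule iso)
      thus "nation_profile N L S (w x) = offsets 0 E \<longleftrightarrow> nation_profile N L' S' x = offsets 0 E" by simp
    qed
    finally have "card {x \<in> {1..N}. nation_profile N L S x = offsets 0 E} = card {x \<in> {1..N}. nation_profile N L' S' x = offsets 0 E}"
      using card_image[OF inj_on_subset[OF permutes_inj[OF w] subset_UNIV]] by simp
    hence "count (mset (map shape Fs)) E * boxes E = count (mset (map shape Gs)) E * boxes E"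
      unfolding count_shapes[OF F True] count_shapes[OF G True] .
    thus ?thesis using boxes_pos[OF True] by simp
  next
    case False
    hence "E \<notin> set (map shape Fs)" "E \<notin> set (map shape Gs)"
      using shape_two_coloured[OF F(1)] shape_two_coloured[OF G(1)] by auto
    hence "count (mset (map shape Fs)) E = 0" "count (mset (map shape Gs)) E = 0"
      by (simp_all only: count_eq_zero_iff set_mset_mset not_False_eq_True)
    thus ?thesis by simp
  qed
qed

section \<open>Varieties and their classes\<close>

definition relabel :: "(nat \<Rightarrow> nat) \<Rightarrow> (nat \<Rightarrow> nat \<Rightarrow> 'a) \<Rightarrow> nat \<Rightarrow> nat \<Rightarrow> 'a" where
  "relabel w p = (\<lambda>i j. p (w i) (w j))"

text \<open>\<open>w\<close> carries the primed structure to the unprimed one, the direction in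
  which it acts from the variety of the representative to the given variety.\<close>

definition isomorphic_by :: "nat \<Rightarrow> (nat \<Rightarrow> nat) \<Rightarrow> (nat \<Rightarrow> nat \<Rightarrow> bool) \<Rightarrow> (nat \<Rightarrow> nat \<Rightarrow> bool) \<Rightarrow>
    (nat \<Rightarrow> nat \<Rightarrow> bool) \<Rightarrow> (nat \<Rightarrow> nat \<Rightarrow> bool) \<Rightarrow> bool" where
  "isomorphic_by N w L S L' S' \<longleftrightarrow>
     (\<forall>x\<in>{1..N}. \<forall>y\<in>{1..N}. (L (w x) (w y) \<longleftrightarrow> L' x y) \<and> (S (w x) (w y) \<longleftrightarrow> S' x y))"

lemma relabel_inverse:
  assumes "w permutes A"
  shows "relabel (inv_into UNIV w) (relabel w p) = p" "relabel w (relabel (inv_into UNIV w) p) = p"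
  using permutes_inverses[OF assms] by (simp_all add: relabel_def)

lemma permutes_interval:
  assumes "w permutes {1..N}" "i \<in> {1..N}"
  shows "w i \<in> {1..N}" "inv_into UNIV w i \<in> {1..N}"
  using assms(2) permutes_in_image[OF assms(1)] permutes_in_image[OF permutes_inv[OF assms(1)]] by blast+

lemma isomorphic_by_inverse:
  assumes w: "w permutes {1..N}" and iso: "isomorphic_by N w L S L' S'"
  shows "isomorphic_by N (inv_into UNIV w) L' S' L S"
  unfolding isomorphic_by_def
proof (intro ballI)
  fix x y assume xy: "x \<in> {1..N}" "y \<in> {1..N}"
  show "(L' (inv_into UNIV w x) (inv_into UNIV w y) \<longleftrightarrow> L x y) \<and> (S' (inv_into UNIV w x) (inv_into UNIV w y) \<longleftrightarrow> S x y)"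
    using iso[unfolded isomorphic_by_def, rule_format, OF permutes_interval(2)[OF w xy(1)] permutes_interval(2)[OF w xy(2)]]
    by (simp only: permutes_inverses[OF w])
qed

lemma diag0_relabel:
  assumes "w permutes {1..N}" "diag0 N q"
  shows "diag0 N (relabel w q)"
  using assms permutes_interval(1)[OF assms(1)] unfolding diag0_def relabel_def by blast

lemma xeq_relabel:
  assumes "w permutes {1..N}" "xeq N p q p' q'"
  shows "xeq N (relabel w p) (relabel w q) (relabel w p') (relabel w q')"
  using assms permutes_interval(1)[OF assms(1)] unfolding xeq_def relabel_def by blast

lemma realises_relabel:
  assumes w: "w permutes {1..N}" and iso: "isomorphic_by N w L S L' S'" and r: "realises N L S p q"
  shows "realises N L' S' (relabel w p) (relabel w q)"
proof -
  have rel: "L' x y \<longleftrightarrow> L (w x) (w y)" "S' x y \<longleftrightarrow> S (w x) (w y)" "conn L' x y \<longleftrightarrow> conn L (w x) (w y)"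
    "strict L' x y \<longleftrightarrow> strict L (w x) (w y)" if "x \<in> {1..N}" "y \<in> {1..N}" for x y
    using iso[unfolded isomorphic_by_def, rule_format, OF that] iso[unfolded isomorphic_by_def, rule_format, OF that(2,1)]
    by (simp_all add: conn_def strict_def)
  note wI = permutes_interval(1)[OF w]
  have winj: "w i = w j \<longleftrightarrow> i = j" for i j using permutes_inj[OF w] by (simp add: inj_eq)
  show ?thesis
    unfolding realises_def relabel_def
  proof (intro conjI ballI impI; (elim conjE)?)
    fix i assume i: "i \<in> {1..N}"
    show "p (w i) (w i) \<noteq> 0" by (rule realisesD(1)[OF r wI[OF i] wI[OF i]])
  next
    fix i j assume ij: "i \<in> {1..N}" "j \<in> {1..N}"
    note R = realisesD[OF r wI[OF ij(1)] wI[OF ij(2)], folded rel[OF ij] rel[OF ij(2,1)], unfolded winj]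
    show "p (w i) (w j) = 0" if "\<not> conn L' i j" by (rule R(2)[OF that])
    show "q (w i) (w j) \<noteq> 0" if "\<not> conn L' i j" by (rule R(3)[OF that])
    show "p (w i) (w j) = p (w i) (w i)" if "L' i j" "L' j i" "i \<noteq> j" by (rule R(4)[OF that])
    show "q (w i) (w j) = 0" if "L' i j" "L' j i" "i \<noteq> j" by (rule R(5)[OF that])
    show "p (w i) (w j) \<noteq> 0" "p (w j) (w i) = 0" "q (w i) (w j) \<noteq> 0" "q (w j) (w i) \<noteq> 0"
      "p (w i) (w i) * p (w i) (w i) = p (w i) (w j) * p (w i) (w i) + q (w i) (w j) * q (w j) (w i)"
      "p (w j) (w j) * p (w j) (w j) = p (w i) (w j) * p (w j) (w j) + q (w i) (w j) * q (w j) (w i)"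
      if "strict L' i j" by (rule R(6-11)[OF that])+
    show "p (w i) (w i) = p (w j) (w j)" if "S' i j" by (rule R(12)[OF that])
    show "p (w i) (w i) + p (w j) (w j) = p (w i) (w j)" if "strict L' i j" "\<not> S' i j" by (rule R(13)[OF that])
  next
    fix i j k assume ijk: "i \<in> {1..N}" "j \<in> {1..N}" "k \<in> {1..N}" and c: "conn L' i j" "\<not> conn L' i k"
    show "q (w i) (w k) * q (w k) (w i) = q (w j) (w k) * q (w k) (w j)"
      by (rule realisesD3[OF r wI[OF ijk(1)] wI[OF ijk(2)] wI[OF ijk(3)]]) (use c rel(3) ijk in simp_all)
  next
    fix i j k l assume ijkl: "i \<in> {1..N}" "j \<in> {1..N}" "k \<in> {1..N}" "l \<in> {1..N}"
      and c: "strict L' i j" "strict L' k l" "conn L' i k"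
    show "p (w i) (w j) = p (w k) (w l)"
      by (rule realisesD4[OF r wI[OF ijkl(1)] wI[OF ijkl(2)] wI[OF ijkl(3)] wI[OF ijkl(4)]])
         (use c rel(3,4) ijkl in simp_all)
  qed
qed

text \<open>Every clause of \<open>realises\<close> sees \<open>q\<close> only through its zero
  pattern and the products of opposite entries.\<close>

lemma realises_xeq:
  assumes r: "realises N L S p q" and x: "xeq N p q p' q'"
  shows "realises N L S p' q'"
proof -
  have P: "p' i j = p i j" and Q: "q' i j * q' j i = q i j * q j i" and Z: "q' i j = 0 \<longleftrightarrow> q i j = 0"
    if "i \<in> {1..N}" "j \<in> {1..N}" for i j using x that unfolding xeq_def by blast+
  have "realises N L S p' q' \<longleftrightarrow> realises N L S p q"
    unfolding realises_def
    by (intro arg_cong2[of _ _ _ _ "(\<and>)"] ball_cong refl) (simp_all only: P Q Z)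
  thus ?thesis using r by simp
qed

lemma class_set_eq:
  assumes "l \<in> SS N"
  shows "variety_classes N l = {cls N p q | p q. diag0 N q \<and> realises N (quad_le l) (quad_shade l) p q}"
proof -
  obtain \<pi> \<kappa> \<rho> \<sigma> where l: "l = (\<pi>, \<kappa>, \<rho>, \<sigma>)" by (rule prod_cases4)
  interpret quad_ctx N \<pi> \<kappa> \<rho> \<sigma> by (rule quad_ctx.intro) (use assms l in simp)
  show ?thesis
  proof (intro equalityI subsetI)
    fix C assume "C \<in> variety_classes N l"
    then obtain g where g: "is_germ l g" "C = X_rel N `` {recipe N l g}"
      unfolding variety_classes_def quotient_def variety_def by blast
    have "C = cls N (recipe_p g) (recipe_q g)"
      unfolding g(2) l recipe_pq_op by (rule X_rel_class[OF recipe_q_diag0])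
    thus "C \<in> {cls N p q | p q. diag0 N q \<and> realises N (quad_le l) (quad_shade l) p q}"
      using recipe_q_diag0 recipe_realises[OF g(1)[unfolded l]] unfolding l by blast
  next
    fix C assume "C \<in> {cls N p q | p q. diag0 N q \<and> realises N (quad_le l) (quad_shade l) p q}"
    then obtain p q where pq: "C = cls N p q" "diag0 N q" "realises N le shd p q" unfolding l by blast
    obtain g where g: "is_germ (\<pi>, \<kappa>, \<rho>, \<sigma>) g" "xeq N p q (recipe_p g) (recipe_q g)"
      using realises_germ[OF pq(3,2)] by blast
    have "C = X_rel N `` {recipe N l g}"
      unfolding pq(1) cls_eqI[OF g(2)] l recipe_pq_op by (rule X_rel_class[OF recipe_q_diag0, symmetric])
    thus "C \<in> variety_classes N l"
      using g(1) unfolding variety_classes_def quotient_def variety_def l by blast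
  qed
qed

lemma perm_act_cls:
  assumes w: "w permutes {1..N}"
  shows "perm_act N w ` cls N p q = cls N (relabel (inv_into UNIV w) p) (relabel (inv_into UNIV w) q)"
proof -
  have w': "inv_into UNIV w permutes {1..N}" using w by (rule permutes_inv)
  have act: "perm_act N w (pq_op N p q) = pq_op N (relabel (inv_into UNIV w) p) (relabel (inv_into UNIV w) q)" for p q
    unfolding relabel_def by (rule perm_act_pq_op[OF w])
  show ?thesis
  proof (intro equalityI subsetI)
    fix R assume "R \<in> perm_act N w ` cls N p q"
    then obtain p' q' where R: "R = perm_act N w (pq_op N p' q')" "diag0 N q'" "xeq N p q p' q'"
      unfolding cls_def by blast
    show "R \<in> cls N (relabel (inv_into UNIV w) p) (relabel (inv_into UNIV w) q)"
      unfolding R(1) act cls_def using diag0_relabel[OF w' R(2)] xeq_relabel[OF w' R(3)] by blast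
  next
    fix R assume "R \<in> cls N (relabel (inv_into UNIV w) p) (relabel (inv_into UNIV w) q)"
    then obtain p' q' where R: "R = pq_op N p' q'" "diag0 N q'"
      "xeq N (relabel (inv_into UNIV w) p) (relabel (inv_into UNIV w) q) p' q'" unfolding cls_def by blast
    have "R = perm_act N w (pq_op N (relabel w p') (relabel w q'))" unfolding act relabel_inverse[OF w] R(1) ..
    moreover have "diag0 N (relabel w q')" by (rule diag0_relabel[OF w R(2)])
    moreover have "xeq N p q (relabel w p') (relabel w q')" using xeq_relabel[OF w R(3)] unfolding relabel_inverse[OF w] .
    ultimately show "R \<in> perm_act N w ` cls N p q" unfolding cls_def by blast
  qed
qed

lemma SS_structure:
  assumes "l \<in> SS N"
  shows "nation_structure N (quad_le l) (quad_shade l)"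
proof -
  obtain \<pi> \<kappa> \<rho> \<sigma> where l: "l = (\<pi>, \<kappa>, \<rho>, \<sigma>)" by (rule prod_cases4)
  interpret quad_ctx N \<pi> \<kappa> \<rho> \<sigma> by (rule quad_ctx.intro) (use assms l in simp)
  show ?thesis unfolding l by (rule quad_structure)
qed

text \<open>
  The order relation of a nation structure can be read off any operator realising it, the shading
  only when the two eigenvalues of every nation with several counties are different.
\<close>

definition generic :: "nat \<Rightarrow> (nat \<Rightarrow> nat \<Rightarrow> complex) \<Rightarrow> bool" where
  "generic N p \<longleftrightarrow> (\<forall>i\<in>{1..N}. \<forall>j\<in>{1..N}. strict (rep_le p) i j \<longrightarrow> p i i + p i i \<noteq> p i j)"

lemma realises_le:
  assumes s: "nation_structure N L S" and r: "realises N L S p q" and ij: "i \<in> {1..N}" "j \<in> {1..N}"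
  shows "L i j \<longleftrightarrow> rep_le p i j"
proof -
  note R = realisesD[OF r ij] realisesD[OF r ij(2,1)]
  consider "i = j" | "\<not> conn L i j" "i \<noteq> j" | "strict L i j" "i \<noteq> j" | "strict L j i" "i \<noteq> j" | "L i j" "L j i" "i \<noteq> j"
    by (auto simp: conn_def strict_def)
  thus ?thesis
  proof cases
    case 1
    thus ?thesis using nation_structureD(1)[OF s ij(1) ij(1) ij(1)] by (simp add: rep_le_def)
  next
    case 2
    thus ?thesis using R(2) by (simp add: rep_le_def conn_def)
  next
    case 3
    thus ?thesis using R(6) by (simp add: rep_le_def strict_def)
  next
    case 4
    thus ?thesis using realisesD(7)[OF r ij(2,1) 4(1)] by (simp add: rep_le_def strict_def)
  next
    case 5
    thus ?thesis using R(1,4) by (simp add: rep_le_def)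
  qed
qed

text \<open>Two connected labels with equal diagonal values but different shade would lie in
  different counties and satisfy \<open>p i i + p i i = p i j\<close> in the direction of the order,
  which \<open>generic\<close> forbids.\<close>

lemma realises_shade:
  assumes s: "nation_structure N L S" and r: "realises N L S p q" and g: "generic N p" and ij: "i \<in> {1..N}" "j \<in> {1..N}"
  shows "S i j \<longleftrightarrow> rep_shade p i j"
proof -
  have le: "L x y \<longleftrightarrow> rep_le p x y" if "x \<in> {1..N}" "y \<in> {1..N}" for x y using realises_le[OF s r that] .
  have conn: "conn L i j \<longleftrightarrow> conn (rep_le p) i j" using le ij by (simp add: conn_def)
  show ?thesis
  proof
    assume "S i j"
    thus "rep_shade p i j"
      using nation_structureD(3)[OF s ij ij(1)] realisesD(12)[OF r ij] conn by (simp add: rep_shade_def)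
  next
    assume *: "rep_shade p i j"
    hence c: "conn L i j" "p i i = p j j" using conn by (simp_all add: rep_shade_def)
    show "S i j"
    proof (rule ccontr)
      assume n: "\<not> S i j"
      hence n': "\<not> S j i" using nation_structureD(4)[OF s ij(2,1) ij(1)] by blast
      have "strict L i j \<or> strict L j i"
        using c(1) n nation_structureD(5)[OF s ij ij(1)] by (auto simp: conn_def strict_def)
      thus False
      proof
        assume st: "strict L i j"
        hence "strict (rep_le p) i j" using le ij by (simp add: strict_def)
        hence "p i i + p i i \<noteq> p i j" using g ij unfolding generic_def by blast
        thus False using realisesD(13)[OF r ij st n] c(2) by simp
      next
        assume st: "strict L j i"
        hence "strict (rep_le p) j i" using le ij by (simp add: strict_def)
        hence "p j j + p j j \<noteq> p j i" using g ij unfolding generic_def by blast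
        thus False using realisesD(13)[OF r ij(2,1) st n'] c(2) by simp
      qed
    qed
  qed
qed

lemma ex_generic:
  assumes "l \<in> SS N"
  shows "\<exists>p q. diag0 N q \<and> realises N (quad_le l) (quad_shade l) p q \<and> generic N p"
proof -
  obtain \<pi> \<kappa> \<rho> \<sigma> where l: "l = (\<pi>, \<kappa>, \<rho>, \<sigma>)" by (rule prod_cases4)
  interpret quad_ctx N \<pi> \<kappa> \<rho> \<sigma> by (rule quad_ctx.intro) (use assms l in simp)
  \<comment> \<open>Nonzero values with nonzero sum, as a germ needs, and \<alpha> different from
    \<beta>: the trace 3 is the double of neither 1 nor 2.\<close>
  define g :: germ where "g = (\<lambda>_. 1, \<lambda>_. 2, \<lambda>_ _. 1)"
  have "is_germ (\<pi>, \<kappa>, \<rho>, \<sigma>) g" by (simp add: is_germ_def g_def)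
  hence r: "realises N le shd (recipe_p g) (recipe_q g)" by (rule recipe_realises)
  have "generic N (recipe_p g)"
    unfolding generic_def
  proof (intro ballI impI)
    fix i j assume ij: "i \<in> {1..N}" "j \<in> {1..N}" "strict (rep_le (recipe_p g)) i j"
    have "strict le i j"
      using ij(3) realises_le[OF quad_structure r ij(1,2)] realises_le[OF quad_structure r ij(2,1)] by (simp add: strict_def)
    hence "recipe_p g i j = 3" using recipe_strict(1)[OF ij(1,2)] by (simp add: g_def)
    moreover have "recipe_p g i i = 1 \<or> recipe_p g i i = 2"
      unfolding g_def recipe_p_diag recipe_a_eq[OF ij(1)] by simp
    ultimately show "recipe_p g i i + recipe_p g i i \<noteq> recipe_p g i j" by auto
  qed
  thus ?thesis using r recipe_q_diag0 unfolding l by blast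
qed

text \<open>From right to left, relabelling matches the solutions of both structures. From left to
  right, one generic class is enough: it occurs in both sets, hence realises both structures up to
  \<open>w\<close>, and a generic operator determines its structure.\<close>

lemma variety_classes_eq_iff:
  assumes l: "l \<in> SS N" and t: "t \<in> SS N" and w: "w permutes {1..N}"
  shows "variety_classes N l = perm_act_classes N w (variety_classes N t) \<longleftrightarrow>
    isomorphic_by N w (quad_le l) (quad_shade l) (quad_le t) (quad_shade t)"
proof -
  let ?w = "inv_into UNIV w"
  have w': "?w permutes {1..N}" using w by (rule permutes_inv)
  have img: "perm_act_classes N w (variety_classes N t) =
      {cls N (relabel ?w p) (relabel ?w q) | p q. diag0 N q \<and> realises N (quad_le t) (quad_shade t) p q}"
  proof -
    have "perm_act_classes N w (variety_classes N t) =
      {perm_act N w ` cls N p q | p q. diag0 N q \<and> realises N (quad_le t) (quad_shade t) p q}"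
      unfolding perm_act_classes_def class_set_eq[OF t] by blast
    thus ?thesis unfolding perm_act_cls[OF w] .
  qed
  show ?thesis
  proof
    assume iso: "isomorphic_by N w (quad_le l) (quad_shade l) (quad_le t) (quad_shade t)"
    note iso' = isomorphic_by_inverse[OF w iso]
    show "variety_classes N l = perm_act_classes N w (variety_classes N t)"
      unfolding img class_set_eq[OF l]
    proof (intro equalityI subsetI)
      fix C assume "C \<in> {cls N p q | p q. diag0 N q \<and> realises N (quad_le l) (quad_shade l) p q}"
      then obtain p q where pq: "C = cls N p q" "diag0 N q" "realises N (quad_le l) (quad_shade l) p q" by blast
      have "C = cls N (relabel ?w (relabel w p)) (relabel ?w (relabel w q))" unfolding relabel_inverse[OF w] by (rule pq(1))
      thus "C \<in> {cls N (relabel ?w p) (relabel ?w q) | p q. diag0 N q \<and> realises N (quad_le t) (quad_shade t) p q}"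
        using diag0_relabel[OF w pq(2)] realises_relabel[OF w iso pq(3)] by blast
    next
      fix C assume "C \<in> {cls N (relabel ?w p) (relabel ?w q) | p q. diag0 N q \<and> realises N (quad_le t) (quad_shade t) p q}"
      then obtain p q where pq: "C = cls N (relabel ?w p) (relabel ?w q)" "diag0 N q" "realises N (quad_le t) (quad_shade t) p q" by blast
      show "C \<in> {cls N p q | p q. diag0 N q \<and> realises N (quad_le l) (quad_shade l) p q}"
        unfolding pq(1) using diag0_relabel[OF w' pq(2)] realises_relabel[OF w' iso' pq(3)] by blast
    qed
  next
    assume eq: "variety_classes N l = perm_act_classes N w (variety_classes N t)"
    obtain p q where pq: "diag0 N q" "realises N (quad_le t) (quad_shade t) p q" "generic N p" using ex_generic[OF t] by blast
    have "cls N (relabel ?w p) (relabel ?w q) \<in> variety_classes N l" unfolding eq img using pq(1,2) by blast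
    then obtain p' q' where p': "cls N (relabel ?w p) (relabel ?w q) = cls N p' q'"
      "realises N (quad_le l) (quad_shade l) p' q'" unfolding class_set_eq[OF l] by blast
    have "xeq N (relabel ?w p) (relabel ?w q) p' q'" by (rule cls_eqD[OF p'(1) diag0_relabel[OF w' pq(1)]])
    hence r: "realises N (quad_le l) (quad_shade l) (relabel ?w p) (relabel ?w q)"
      by (rule realises_xeq[OF p'(2) xeq_sym])
    have le_w: "rep_le (relabel ?w p) (w x) (w y) \<longleftrightarrow> rep_le p x y" for x y
      unfolding rep_le_def relabel_def permutes_inverses[OF w] using permutes_inj[OF w] by (simp add: inj_eq)
    have shade_w: "rep_shade (relabel ?w p) (w x) (w y) \<longleftrightarrow> rep_shade p x y" for x y
      unfolding rep_shade_def conn_def le_w by (simp add: relabel_def permutes_inverses[OF w])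
    have gen: "generic N (relabel ?w p)"
      unfolding generic_def
    proof (intro ballI impI)
      fix i j assume ij: "i \<in> {1..N}" "j \<in> {1..N}" "strict (rep_le (relabel ?w p)) i j"
      have "strict (rep_le p) (?w i) (?w j)"
        using ij(3) le_w[of "?w i" "?w j"] le_w[of "?w j" "?w i"] by (simp add: strict_def permutes_inverses[OF w])
      thus "relabel ?w p i i + relabel ?w p i i \<noteq> relabel ?w p i j"
        using pq(3) permutes_interval(2)[OF w ij(1)] permutes_interval(2)[OF w ij(2)] unfolding generic_def relabel_def by blast
    qed
    show "isomorphic_by N w (quad_le l) (quad_shade l) (quad_le t) (quad_shade t)"
      unfolding isomorphic_by_def
    proof (intro ballI)
      fix x y assume xy: "x \<in> {1..N}" "y \<in> {1..N}"
      note wxy = permutes_interval(1)[OF w xy(1)] permutes_interval(1)[OF w xy(2)]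
      show "(quad_le l (w x) (w y) \<longleftrightarrow> quad_le t x y) \<and> (quad_shade l (w x) (w y) \<longleftrightarrow> quad_shade t x y)"
        unfolding realises_le[OF SS_structure[OF l] r wxy] realises_le[OF SS_structure[OF t] pq(2) xy]
          realises_shade[OF SS_structure[OF l] r gen wxy] realises_shade[OF SS_structure[OF t] pq(2,3) xy] le_w shade_w
        by simp
    qed
  qed
qed

section \<open>The transversal: existence and uniqueness of representatives\<close>

lemma TT_filled:
  assumes "t \<in> TT N"
  obtains Ds where "t = quad_of_filled (fill_diagrams 0 Ds)" "\<forall>D\<in>set Ds. two_coloured_composition D"
    "sorted_wrt diagram_le Ds" "filled_ok N (fill_diagrams 0 Ds)"
    "represents (fill_diagrams 0 Ds) (quad_le t) (quad_shade t)"
proof -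
  obtain Ds where Ds: "t = quad_of_filled (fill_diagrams 0 Ds)" "\<forall>D\<in>set Ds. two_coloured_composition D"
    "sum_list (map boxes Ds) = N" "sorted_wrt diagram_le Ds"
    using assms by (auto simp: TT_def sum_mset_sum_list simp flip: mset_map)
  have ok: "filled_ok N (fill_diagrams 0 Ds)" by (rule fill_diagrams_ok[OF Ds(2,3)])
  have "t \<in> SS N" using assms TT_SS by blast
  hence "represents (fill_diagrams 0 Ds) (quad_le t) (quad_shade t)"
    unfolding Ds(1) by (rule quad_of_filled_represents[OF ok])
  thus ?thesis using that Ds ok by blast
qed

lemma ex_TT_isomorphic:
  assumes "nation_structure N L S"
  shows "\<exists>t\<in>TT N. \<exists>w. w permutes {1..N} \<and> isomorphic_by N w L S (quad_le t) (quad_shade t)"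
proof -
  obtain Fs where Fs: "filled_ok N Fs" "represents Fs L S" "sorted_wrt diagram_le (map shape Fs)"
    using structure_filled[OF assms] by blast
  define Ds where "Ds = map shape Fs"
  define t where "t = quad_of_filled (fill_diagrams 0 Ds)"
  have Ds: "\<forall>D\<in>set Ds. two_coloured_composition D" "sum_list (map boxes Ds) = N"
    using shape_two_coloured[OF Fs(1)] sum_list_shape[OF Fs(1)] by (auto simp: Ds_def)
  have "t \<in> TT N"
    unfolding TT_def t_def using Ds Fs(3) by (auto simp: Ds_def[symmetric] sum_mset_sum_list simp flip: mset_map)
  moreover have "\<exists>w. w permutes {1..N} \<and> isomorphic_by N w L S (quad_le t) (quad_shade t)"
    unfolding isomorphic_by_def
  proof (rule same_shape_isomorphic[OF Fs(1,2)])
    show ok: "filled_ok N (fill_diagrams 0 Ds)" by (rule fill_diagrams_ok[OF Ds])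
    have "t \<in> SS N" using \<open>t \<in> TT N\<close> TT_SS by blast
    thus "represents (fill_diagrams 0 Ds) (quad_le t) (quad_shade t)"
      unfolding t_def by (rule quad_of_filled_represents[OF ok])
    show "map shape Fs = map shape (fill_diagrams 0 Ds)" unfolding shape_fill_diagrams Ds_def ..
  qed
  ultimately show ?thesis by blast
qed

text \<open>Isomorphic structures have the same multiset of shapes, and antisymmetry of the order on
  diagrams leaves only one way to list it.\<close>

lemma TT_isomorphic_eq:
  assumes t: "t \<in> TT N" "t' \<in> TT N" and w: "w permutes {1..N}"
    and iso: "isomorphic_by N w (quad_le t) (quad_shade t) (quad_le t') (quad_shade t')"
  shows "t = t'"
proof -
  obtain Ds where Ds: "t = quad_of_filled (fill_diagrams 0 Ds)" "\<forall>D\<in>set Ds. two_coloured_composition D"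
    "sorted_wrt diagram_le Ds" "filled_ok N (fill_diagrams 0 Ds)"
    "represents (fill_diagrams 0 Ds) (quad_le t) (quad_shade t)" by (rule TT_filled[OF t(1)])
  obtain Es where Es: "t' = quad_of_filled (fill_diagrams 0 Es)" "\<forall>D\<in>set Es. two_coloured_composition D"
    "sorted_wrt diagram_le Es" "filled_ok N (fill_diagrams 0 Es)"
    "represents (fill_diagrams 0 Es) (quad_le t') (quad_shade t')" by (rule TT_filled[OF t(2)])
  have "mset (map shape (fill_diagrams 0 Ds)) = mset (map shape (fill_diagrams 0 Es))"
    by (rule isomorphic_same_shapes[OF Ds(4,5) Es(4,5) w]) (use iso in \<open>simp add: isomorphic_by_def\<close>)
  hence "mset Ds = mset Es" unfolding shape_fill_diagrams .
  hence "Ds = Es"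
    by (rule sorted_wrt_unique[OF Ds(3) Es(3)]) (use Ds(2) diagram_le_antisym in blast)
  thus ?thesis using Ds(1) Es(1) by simp
qed

lemma isomorphic_by_compose:
  assumes w: "w permutes {1..N}" and v: "v permutes {1..N}"
    and "isomorphic_by N w L S L1 S1" "isomorphic_by N v L S L2 S2"
  shows "isomorphic_by N (inv_into UNIV v \<circ> w) L2 S2 L1 S1"
  unfolding isomorphic_by_def comp_apply
proof (intro ballI)
  fix x y assume xy: "x \<in> {1..N}" "y \<in> {1..N}"
  note wxy = permutes_interval(1)[OF w xy(1)] permutes_interval(1)[OF w xy(2)]
  show "(L2 (inv_into UNIV v (w x)) (inv_into UNIV v (w y)) \<longleftrightarrow> L1 x y) \<and>
    (S2 (inv_into UNIV v (w x)) (inv_into UNIV v (w y)) \<longleftrightarrow> S1 x y)"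
    using isomorphic_by_inverse[OF v assms(4), unfolded isomorphic_by_def, rule_format, OF wxy]
      assms(3)[unfolded isomorphic_by_def, rule_format, OF xy] by simp
qed

lemma recipe_braid_rep:
  assumes "l \<in> SS N" "is_germ l g"
  shows "braid_rep N (recipe N l g)"
proof -
  obtain \<pi> \<kappa> \<rho> \<sigma> where l: "l = (\<pi>, \<kappa>, \<rho>, \<sigma>)" by (rule prod_cases4)
  interpret quad_ctx N \<pi> \<kappa> \<rho> \<sigma> by (rule quad_ctx.intro) (use assms l in simp)
  note r = recipe_realises[OF assms(2)[unfolded l]]
  show ?thesis
    unfolding braid_rep_iff l recipe_pq_op
    using realises_ybe[OF quad_structure r recipe_q_diag0] realises_nonsingular[OF quad_structure r] recipe_q_diag0 by blast
qed

text \<open>The germ is found for the solution relabelled along \<open>w\<close>, whose structure is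
  that of the representative \<open>t\<close>.\<close>

lemma braid_rep_from_recipe:
  assumes "braid_rep N R"
  shows "\<exists>t\<in>TT N. \<exists>g w. is_germ t g \<and> w permutes {1..N} \<and> X_equiv N R (perm_act N w (recipe N t g))"
proof -
  obtain p q where pq: "diag0 N q" "ybe N p q" "nonsingular N p q" "R = pq_op N p q"
    using assms unfolding braid_rep_iff by blast
  interpret sol: ybe_solution N p q by (rule ybe_solution.intro[OF pq(2,3,1)])
  obtain t w where tw: "t \<in> TT N" "w permutes {1..N}"
    "isomorphic_by N w (rep_le p) (rep_shade p) (quad_le t) (quad_shade t)"
    using ex_TT_isomorphic[OF sol.rep_nation_structure] by blast
  have r: "realises N (quad_le t) (quad_shade t) (relabel w p) (relabel w q)"
    by (rule realises_relabel[OF tw(2,3) sol.rep_realises])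
  obtain \<pi> \<kappa> \<rho> \<sigma> where t: "t = (\<pi>, \<kappa>, \<rho>, \<sigma>)" by (rule prod_cases4)
  interpret quad_ctx N \<pi> \<kappa> \<rho> \<sigma> by (rule quad_ctx.intro) (use tw(1) TT_SS t in blast)
  obtain g where g: "is_germ t g" "xeq N (relabel w p) (relabel w q) (recipe_p g) (recipe_q g)"
    using realises_germ[OF r[unfolded t] diag0_relabel[OF tw(2) pq(1)]] unfolding t by blast
  let ?w = "inv_into UNIV w"
  have w': "?w permutes {1..N}" using tw(2) by (rule permutes_inv)
  \<comment> \<open>Relabelling along the inverse returns to the given solution, and this is how
    \<open>w\<close> acts on the recipe operator.\<close>
  have "xeq N p q (relabel ?w (recipe_p g)) (relabel ?w (recipe_q g))"
    using xeq_relabel[OF w' g(2)] unfolding relabel_inverse[OF tw(2)] .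
  moreover have "diag0 N (relabel ?w (recipe_q g))" by (rule diag0_relabel[OF w' recipe_q_diag0])
  moreover have "perm_act N w (recipe N t g) = pq_op N (relabel ?w (recipe_p g)) (relabel ?w (recipe_q g))"
    unfolding t recipe_pq_op relabel_def by (rule perm_act_pq_op[OF tw(2)])
  ultimately have "X_equiv N R (perm_act N w (recipe N t g))"
    unfolding pq(4) X_equiv_iff_xeq[OF pq(1)] by blast
  thus ?thesis using tw g(1) by blast
qed

theorem theorem4p13:
  fixes N :: nat
  assumes "N \<ge> 1"
  shows "(\<forall>l\<in>SS N. \<exists>!t. t \<in> TT N \<and>
            (\<exists>w. w permutes {1..N} \<and>
                 variety_classes N l = perm_act_classes N w (variety_classes N t)))
       \<and> (\<forall>t\<in>TT N. \<forall>g. is_germ t g \<longrightarrow> braid_rep N (recipe N t g))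
       \<and> (\<forall>R. braid_rep N R \<longrightarrow>
            (\<exists>t\<in>TT N. \<exists>g w. is_germ t g \<and> w permutes {1..N} \<and>
                 X_equiv N R (perm_act N w (recipe N t g))))"
proof (intro conjI ballI allI impI)
  fix l assume l: "l \<in> SS N"
  have SS: "t \<in> SS N" if "t \<in> TT N" for t using that TT_SS by blast
  obtain t w where tw: "t \<in> TT N" "w permutes {1..N}"
    "isomorphic_by N w (quad_le l) (quad_shade l) (quad_le t) (quad_shade t)"
    using ex_TT_isomorphic[OF SS_structure[OF l]] by blast
  show "\<exists>!t. t \<in> TT N \<and> (\<exists>w. w permutes {1..N} \<and>
    variety_classes N l = perm_act_classes N w (variety_classes N t))"
  proof (rule ex1I[of _ t])
    show "t \<in> TT N \<and> (\<exists>w. w permutes {1..N} \<and> variety_classes N l = perm_act_classes N w (variety_classes N t))"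
      using tw variety_classes_eq_iff[OF l SS[OF tw(1)] tw(2)] by blast
    fix t' assume "t' \<in> TT N \<and> (\<exists>w. w permutes {1..N} \<and> variety_classes N l = perm_act_classes N w (variety_classes N t'))"
    then obtain v where v: "t' \<in> TT N" "v permutes {1..N}"
      "variety_classes N l = perm_act_classes N v (variety_classes N t')" by blast
    have iso: "isomorphic_by N v (quad_le l) (quad_shade l) (quad_le t') (quad_shade t')"
      using variety_classes_eq_iff[OF l SS[OF v(1)] v(2)] v(3) by blast
    \<comment> \<open>Both representatives are isomorphic to \<open>l\<close>; composing one
      isomorphism with the inverse of the other compares them directly.\<close>
    show "t' = t"
      by (rule TT_isomorphic_eq[OF v(1) tw(1) permutes_compose[OF tw(2) permutes_inv[OF v(2)]]
          isomorphic_by_compose[OF tw(2) v(2) tw(3) iso]])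
  qed
next
  fix t g assume "t \<in> TT N" "is_germ t g"
  thus "braid_rep N (recipe N t g)" using TT_SS recipe_braid_rep by blast
next
  fix R assume "braid_rep N R"
  thus "\<exists>t\<in>TT N. \<exists>g w. is_germ t g \<and> w permutes {1..N} \<and> X_equiv N R (perm_act N w (recipe N t g))"
    by (rule braid_rep_from_recipe)
qed

end
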